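(* Let $(M,g)$ be a Riemannian manifold of dimension $n\ge 2$. For every $k=0,\dots,n-1$ one has $$d^{\widetilde\nabla^{\mathcal A}}\circ L^k=L^{k+1}\circ D^k\colon\ \Gamma(\mathcal H^kM)\to\Omega^{k+1}(M,\mathcal AM).$$ If the metric $g$ has constant sectional curvature, then $d^{\widetilde\nabla^{\mathcal A}}\circ d^{\widetilde\nabla^{\mathcal A}}=0$ and $D^{k+1}\circ D^k=0$ for all $k$, so both $(\Omega^*(M,\mathcal AM),d^{\widetilde\nabla^{\mathcal A}})$ and $(\Gamma(\mathcal H^*M),D^* )$ are complexes, and the operators $L^k$ define a chain map $(\Gamma(\mathcal H^*M),D^* )\to(\Omega^*(M,\mathcal AM),d^{\widetilde\nabla^{\mathcal A}})$ that induces an isomorphism in cohomology.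
   Context: $\nabla$ is the Levi-Civita connection of $g$, $\mathfrak o(TM)$ (resp. $\mathcal S(TM)$) the bundle of endomorphisms of $TM$ that are skew symmetric (resp. symmetric) with respect to $g$, and $R\in\Omega^2(M,\mathfrak o(TM))$ the Riemann curvature, $R(\xi_1,\xi_2)=[\nabla_{\xi_1},\nabla_{\xi_2}]-\nabla_{[\xi_1,\xi_2]}$. Put $\mathcal AM:=TM\oplus\mathfrak o(TM)$; sections, and $\mathcal AM$-valued $k$-forms, are written as columns $\binom{\psi}{\Psi}$ with top component $\psi\in\Omega^k(M,TM)$ and bottom component $\Psi\in\Omega^k(M,\mathfrak o(TM))$. The deformation connection is the linear connection $\widetilde\nabla^{\mathcal A}_\xi\binom{\eta}{\Phi}=\binom{\nabla_\xi\eta-\Phi(\xi)}{\nabla_\xi\Phi-R(\xi,\eta)}$ on $\mathcal AM$. For a vector bundle $E$, $\Omega^k(M,E)=\Gamma(\Lambda^kT^*M\otimes E)$, and $d^{\widetilde\nabla^{\mathcal A}}:\Omega^k(M,\mathcal AM)\to\Omega^{k+1}(M,\mathcal AM)$ is the covariant exterior derivative, $d^{\nabla}\varphi(\xi_0,\dots,\xi_k)=\sum_i(-1)^i\nabla_{\xi_i}(\varphi(\xi_0,\dots,\widehat{\xi_i},\dots,\xi_k))+\sum_{i<j}(-1)^{i+j}\varphi([\xi_i,\xi_j],\xi_0,\dots,\widehat{\xi_i},\dots,\widehat{\xi_j},\dots,\xi_k)$ (hats denote omission). For $\Psi\in\Omega^k(M,\mathfrak o(TM))$ let $\mathrm{Alt}(\Psi)\in\Omega^{k+1}(M,TM)$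 be $\mathrm{Alt}(\Psi)(\xi_0,\dots,\xi_k)=\sum_{i=0}^k(-1)^{k-i}\Psi(\xi_0,\dots,\widehat{\xi_i},\dots,\xi_k)(\xi_i)$; it comes from a vector bundle map. Harmonic subbundles $\mathcal H^kM\subset\Lambda^kT^*M\otimes\mathcal AM$: $\mathcal H^0M:=TM\subset\mathcal AM$; $\mathcal H^1M:=\mathcal S(TM)\subset T^*M\otimes TM\subset T^*M\otimes\mathcal AM$; for $2\le k\le n$, $\mathcal H^kM:=\ker(\mathrm{Alt}:\Lambda^kT^*M\otimes\mathfrak o(TM)\to\Lambda^{k+1}T^*M\otimes TM)$, viewed inside $\Lambda^kT^*M\otimes\mathcal AM$ via the bottom component. Splitting operators $L^k:\Gamma(\mathcal H^kM)\to\Omega^k(M,\mathcal AM)$: $L^0(\eta)=\binom{\eta}{\Phi}$, where $\Phi\in\Gamma(\mathfrak o(TM))$ is the unique section such that the top component of $\widetilde\nabla^{\mathcal A}\binom{\eta}{\Phi}$ lies in $\Gamma(\mathcal S(TM))$; $L^1(\psi)=\binom{\psi}{\Psi}$, where $\Psi\in\Omega^1(M,\mathfrak o(TM))$ is the unique form such that $d^{\widetilde\nabla^{\mathcal A}}\binom{\psi}{\Psi}$ has vanishing top component; for $k\ge2$, $L^k(\Psi)=\binom0\Psi$. BGG operators $D^k:\Gamma(\mathcal H^kM)\to\Gamma(\mathcal H^{k+1}M)$: $D^0(\eta)$ is the top component of $\widetilde\nabla^{\mathcal A}L^0(\eta)$; for $k\ge1$, $D^k(\alpha)=d^{\widetilde\nabla^{\mathcal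 A}}L^k(\alpha)$, which is a section of $\mathcal H^{k+1}M\subset\Lambda^{k+1}T^*M\otimes\mathcal AM$. *)

theory Defs
  imports "HOL-Analysis.Analysis" "HOL-Library.Function_Algebras"
begin

section \<open>Functions into a real vector space, and linear maps on subspaces\<close>

text \<open>Tangent vectors, endomorphisms, forms and sections are all functions below; they are added
  and scaled pointwise.\<close>

instantiation "fun" :: (type, real_vector) real_vector
begin

definition "scaleR r f = (\<lambda>x. r *\<^sub>R f x)"

instance
  by standard (auto simp: scaleR_fun_def fun_eq_iff scaleR_add_right scaleR_add_left)

end

lemma scaleR_fun_apply [simp]: "(r *\<^sub>R f) x = r *\<^sub>R f x"
  by (simp add: scaleR_fun_def)

definition lin_on :: "'v::real_vector set \<Rightarrow> ('v \<Rightarrow> 'w::real_vector) \<Rightarrow> bool" where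
  "lin_on V F \<longleftrightarrow> (\<forall>v\<in>V. \<forall>w\<in>V. \<forall>a b. F (a *\<^sub>R v + b *\<^sub>R w) = a *\<^sub>R F v + b *\<^sub>R F w)"

text \<open>Alternating \<open>k\<close>-linear maps \<open>V \<times> \<dots> \<times> V \<rightarrow> W\<close>, the arguments being given as a list. The maps are
  extended by zero to the lists that are not in \<open>V\<^sup>k\<close>, so that they are determined by their values
  on \<open>V\<^sup>k\<close> and form a subspace of the function type. The same convention is used throughout.\<close>

definition tuples :: "nat \<Rightarrow> 'v set \<Rightarrow> 'v list set" where
  "tuples k V = {vs. length vs = k \<and> set vs \<subseteq> V}"

definition alt_maps ::
    "nat \<Rightarrow> 'v::real_vector set \<Rightarrow> 'w::real_vector set \<Rightarrow> ('v list \<Rightarrow> 'w) set" where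
  "alt_maps k V W = {F.
     (\<forall>vs. vs \<notin> tuples k V \<longrightarrow> F vs = 0) \<and>
     (\<forall>vs\<in>tuples k V. F vs \<in> W) \<and>
     (\<forall>vs\<in>tuples k V. \<forall>i<k. lin_on V (\<lambda>v. F (vs[i := v]))) \<and>
     (\<forall>vs\<in>tuples k V. \<not> distinct vs \<longrightarrow> F vs = 0)}"

definition omit :: "nat \<Rightarrow> 'b list \<Rightarrow> 'b list" where
  "omit i xs = take i xs @ drop (Suc i) xs"


section \<open>Smooth manifolds\<close>

text \<open>Smoothness on open subsets of a Euclidean space.\<close>

primrec Ck_on ::
    "nat \<Rightarrow> 'e::real_normed_vector set \<Rightarrow> ('e \<Rightarrow> 'f::real_normed_vector) \<Rightarrow> bool" where
  "Ck_on 0 S f \<longleftrightarrow> continuous_on S f"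
| "Ck_on (Suc k) S f \<longleftrightarrow>
     f differentiable_on S \<and> (\<forall>v. Ck_on k S (\<lambda>x. frechet_derivative f (at x) v))"

definition smooth_on ::
    "'e::real_normed_vector set \<Rightarrow> ('e \<Rightarrow> 'f::real_normed_vector) \<Rightarrow> bool" where
  "smooth_on S f \<longleftrightarrow> (\<forall>k. Ck_on k S f)"

type_synonym ('a, 'e) chart = "'a set \<times> ('a \<Rightarrow> 'e)"

text \<open>The manifold is the whole type \<open>'a\<close>, of dimension \<open>DIM('e)\<close>; the Hausdorff property and second
  countability are imposed by the type class constraints in the theorem. The atlas need not be
  maximal.\<close>

definition smooth_atlas :: "('a::topological_space, 'e::euclidean_space) chart set \<Rightarrow> bool" where
  "smooth_atlas A \<longleftrightarrow>
     (\<Union>(U, x)\<in>A. U) = UNIV \<and>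
     (\<forall>(U, x)\<in>A. open U \<and> open (x ` U) \<and> homeomorphism U (x ` U) x (inv_into U x)) \<and>
     (\<forall>(U, x)\<in>A. \<forall>(V, y)\<in>A. smooth_on (x ` (U \<inter> V)) (y \<circ> inv_into U x))"

definition smooth_functions ::
    "('a::topological_space, 'e::euclidean_space) chart set \<Rightarrow> ('a \<Rightarrow> real) set" where
  "smooth_functions A = {f. \<forall>(U, x)\<in>A. smooth_on (x ` U) (f \<circ> inv_into U x)}"

text \<open>Tangent vectors at \<open>p\<close> are the derivations at \<open>p\<close> of the algebra of smooth functions (extended by
  zero to the other functions).\<close>

type_synonym 'a tvec = "('a \<Rightarrow> real) \<Rightarrow> real"

definition tangent_space ::
    "('a::topological_space, 'e::euclidean_space) chart set \<Rightarrow> 'a \<Rightarrow> 'a tvec set" where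
  "tangent_space A p = {v.
     (\<forall>f. f \<notin> smooth_functions A \<longrightarrow> v f = 0) \<and>
     lin_on (smooth_functions A) v \<and>
     (\<forall>f\<in>smooth_functions A. \<forall>h\<in>smooth_functions A. v (f * h) = f p * v h + h p * v f)}"

type_synonym 'a vfield = "'a \<Rightarrow> 'a tvec"

definition vfields ::
    "('a::topological_space, 'e::euclidean_space) chart set \<Rightarrow> 'a vfield set" where
  "vfields A = {\<xi>. (\<forall>p. \<xi> p \<in> tangent_space A p) \<and>
     (\<forall>f\<in>smooth_functions A. (\<lambda>p. \<xi> p f) \<in> smooth_functions A)}"

definition bracket :: "'a vfield \<Rightarrow> 'a vfield \<Rightarrow> 'a vfield" where
  "bracket \<xi> \<eta> = (\<lambda>p f. \<xi> p (\<lambda>q. \<eta> q f) - \<eta> p (\<lambda>q. \<xi> q f))"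


section \<open>Vector bundles and differential forms\<close>

text \<open>A vector bundle is given by its fibres, subspaces of an ambient real vector space, and by its
  smooth sections.\<close>

record ('a, 'v) vbundle =
  fibre :: "'a \<Rightarrow> 'v set"
  sections :: "('a \<Rightarrow> 'v) set"

definition TM ::
    "('a::topological_space, 'e::euclidean_space) chart set \<Rightarrow> ('a, 'a tvec) vbundle" where
  "TM A = \<lparr>fibre = tangent_space A, sections = vfields A\<rparr>"

definition eval :: "('a \<Rightarrow> 'a tvec list \<Rightarrow> 'v) \<Rightarrow> 'a vfield list \<Rightarrow> 'a \<Rightarrow> 'v" where
  "eval \<phi> \<xi>s = (\<lambda>p. \<phi> p (map (\<lambda>\<xi>. \<xi> p) \<xi>s))"

text \<open>Smooth sections of \<open>\<Lambda>\<^sup>kT\<^sup>*M \<otimes> E\<close>. A section \<open>s\<close> of \<open>E\<close> is identified with the \<open>0\<close>-form \<open>\<phi>\<close> with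
  \<open>\<phi> p [] = s p\<close>.\<close>

definition forms ::
    "('a::topological_space, 'e::euclidean_space) chart set \<Rightarrow> ('a, 'v::real_vector) vbundle \<Rightarrow> nat \<Rightarrow>
     ('a \<Rightarrow> 'a tvec list \<Rightarrow> 'v) set" where
  "forms A E k = {\<phi>. (\<forall>p. \<phi> p \<in> alt_maps k (tangent_space A p) (fibre E p)) \<and>
     (\<forall>\<xi>s\<in>tuples k (vfields A). eval \<phi> \<xi>s \<in> sections E)}"

text \<open>The covariant exterior derivative for a linear connection \<open>D\<close> on \<open>E\<close>: the \<open>(k+1)\<close>-form given on
  vector fields by the usual formula.\<close>

definition cov_ext_deriv ::
    "('a::topological_space, 'e::euclidean_space) chart set \<Rightarrow> ('a, 'v::real_vector) vbundle \<Rightarrow>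
     ('a vfield \<Rightarrow> ('a \<Rightarrow> 'v) \<Rightarrow> ('a \<Rightarrow> 'v)) \<Rightarrow> nat \<Rightarrow>
     ('a \<Rightarrow> 'a tvec list \<Rightarrow> 'v) \<Rightarrow> ('a \<Rightarrow> 'a tvec list \<Rightarrow> 'v)" where
  "cov_ext_deriv A E D k \<phi> = (THE \<omega>. \<omega> \<in> forms A E (Suc k) \<and>
     (\<forall>\<xi>s\<in>tuples (Suc k) (vfields A).
        eval \<omega> \<xi>s =
          (\<Sum>i\<le>k. (-1) ^ i *\<^sub>R D (\<xi>s ! i) (eval \<phi> (omit i \<xi>s))) +
          (\<Sum>(i, j)\<in>{(i, j). i < j \<and> j \<le> k}.
             (-1) ^ (i + j) *\<^sub>R eval \<phi> (bracket (\<xi>s ! i) (\<xi>s ! j) # omit i (omit j \<xi>s)))))"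


section \<open>Riemannian metrics, Levi-Civita connection and curvature\<close>

type_synonym 'a metric = "'a \<Rightarrow> 'a tvec \<Rightarrow> 'a tvec \<Rightarrow> real"

definition riemannian_metric ::
    "('a::topological_space, 'e::euclidean_space) chart set \<Rightarrow> 'a metric \<Rightarrow> bool" where
  "riemannian_metric A g \<longleftrightarrow>
     (\<forall>p. \<forall>v\<in>tangent_space A p.
        lin_on (tangent_space A p) (g p v) \<and>
        (\<forall>w\<in>tangent_space A p. g p v w = g p w v) \<and>
        (v \<noteq> 0 \<longrightarrow> g p v v > 0)) \<and>
     (\<forall>\<xi>\<in>vfields A. \<forall>\<eta>\<in>vfields A. (\<lambda>p. g p (\<xi> p) (\<eta> p)) \<in> smooth_functions A)"

type_synonym 'a connection = "'a vfield \<Rightarrow> 'a vfield \<Rightarrow> 'a vfield"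

definition levi_civita ::
    "('a::topological_space, 'e::euclidean_space) chart set \<Rightarrow> 'a metric \<Rightarrow> 'a connection \<Rightarrow> bool" where
  "levi_civita A g nabla \<longleftrightarrow>
     (\<forall>\<xi>\<in>vfields A. \<forall>\<eta>\<in>vfields A. nabla \<xi> \<eta> \<in> vfields A) \<and>
     (\<forall>\<xi>\<in>vfields A. \<forall>\<eta>\<in>vfields A. \<forall>\<zeta>\<in>vfields A.
        nabla (\<xi> + \<eta>) \<zeta> = nabla \<xi> \<zeta> + nabla \<eta> \<zeta> \<and>
        nabla \<xi> (\<eta> + \<zeta>) = nabla \<xi> \<eta> + nabla \<xi> \<zeta>) \<and>
     (\<forall>f\<in>smooth_functions A. \<forall>\<xi>\<in>vfields A. \<forall>\<eta>\<in>vfields A.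
        nabla (\<lambda>p. f p *\<^sub>R \<xi> p) \<eta> = (\<lambda>p. f p *\<^sub>R nabla \<xi> \<eta> p) \<and>
        nabla \<xi> (\<lambda>p. f p *\<^sub>R \<eta> p) = (\<lambda>p. f p *\<^sub>R nabla \<xi> \<eta> p + \<xi> p f *\<^sub>R \<eta> p)) \<and>
     (\<forall>\<xi>\<in>vfields A. \<forall>\<eta>\<in>vfields A. \<forall>\<zeta>\<in>vfields A. \<forall>p.
        \<xi> p (\<lambda>q. g q (\<eta> q) (\<zeta> q)) = g p (nabla \<xi> \<eta> p) (\<zeta> p) + g p (\<eta> p) (nabla \<xi> \<zeta> p)) \<and>
     (\<forall>\<xi>\<in>vfields A. \<forall>\<eta>\<in>vfields A. nabla \<xi> \<eta> - nabla \<eta> \<xi> = bracket \<xi> \<eta>)"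

type_synonym 'a endo = "'a tvec \<Rightarrow> 'a tvec"

text \<open>The bundle \<open>\<oo>(TM)\<close>. Endomorphisms of \<open>T\<^sub>pM\<close> are extended by zero as well.\<close>

definition skew_endos ::
    "('a::topological_space, 'e::euclidean_space) chart set \<Rightarrow> 'a metric \<Rightarrow> 'a \<Rightarrow> 'a endo set" where
  "skew_endos A g p = {F.
     (\<forall>v. v \<notin> tangent_space A p \<longrightarrow> F v = 0) \<and>
     F ` tangent_space A p \<subseteq> tangent_space A p \<and>
     lin_on (tangent_space A p) F \<and>
     (\<forall>v\<in>tangent_space A p. \<forall>w\<in>tangent_space A p. g p (F v) w = - g p v (F w))}"

definition skewTM ::
    "('a::topological_space, 'e::euclidean_space) chart set \<Rightarrow> 'a metric \<Rightarrow> ('a, 'a endo) vbundle" where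
  "skewTM A g = \<lparr>fibre = skew_endos A g,
     sections = {\<Phi>. (\<forall>p. \<Phi> p \<in> skew_endos A g p) \<and> (\<forall>\<eta>\<in>vfields A. (\<lambda>p. \<Phi> p (\<eta> p)) \<in> vfields A)}\<rparr>"

text \<open>The connection induced by \<open>nabla\<close> on \<open>\<oo>(TM)\<close>.\<close>

definition nabla_skew ::
    "('a::topological_space, 'e::euclidean_space) chart set \<Rightarrow> 'a metric \<Rightarrow> 'a connection \<Rightarrow>
     'a vfield \<Rightarrow> ('a \<Rightarrow> 'a endo) \<Rightarrow> ('a \<Rightarrow> 'a endo)" where
  "nabla_skew A g nabla \<xi> \<Phi> = (THE \<Theta>. \<Theta> \<in> sections (skewTM A g) \<and>
     (\<forall>\<eta>\<in>vfields A. \<forall>p. \<Theta> p (\<eta> p) = nabla \<xi> (\<lambda>q. \<Phi> q (\<eta> q)) p - \<Phi> p (nabla \<xi> \<eta> p)))"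

definition curvature ::
    "('a::topological_space, 'e::euclidean_space) chart set \<Rightarrow> 'a metric \<Rightarrow> 'a connection \<Rightarrow>
     'a \<Rightarrow> 'a tvec list \<Rightarrow> 'a endo" where
  "curvature A g nabla = (THE R. R \<in> forms A (skewTM A g) 2 \<and>
     (\<forall>\<xi>\<in>vfields A. \<forall>\<eta>\<in>vfields A. \<forall>\<zeta>\<in>vfields A. \<forall>p.
        R p [\<xi> p, \<eta> p] (\<zeta> p) =
          nabla \<xi> (nabla \<eta> \<zeta>) p - nabla \<eta> (nabla \<xi> \<zeta>) p - nabla (bracket \<xi> \<eta>) \<zeta> p))"

definition sectional_curvature ::
    "('a::topological_space, 'e::euclidean_space) chart set \<Rightarrow> 'a metric \<Rightarrow> 'a connection \<Rightarrow>
     'a \<Rightarrow> 'a tvec \<Rightarrow> 'a tvec \<Rightarrow> real" where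
  "sectional_curvature A g nabla p v w =
     g p (curvature A g nabla p [v, w] w) v / (g p v v * g p w w - (g p v w)\<^sup>2)"

definition constant_sectional_curvature ::
    "('a::topological_space, 'e::euclidean_space) chart set \<Rightarrow> 'a metric \<Rightarrow> 'a connection \<Rightarrow> bool" where
  "constant_sectional_curvature A g nabla \<longleftrightarrow>
     (\<exists>c. \<forall>p. \<forall>v\<in>tangent_space A p. \<forall>w\<in>tangent_space A p.
        v \<noteq> w \<and> independent {v, w} \<longrightarrow> sectional_curvature A g nabla p v w = c)"


section \<open>The deformation connection\<close>

text \<open>A column with top component \<open>\<psi>\<close> and bottom component \<open>\<Psi>\<close> is a pair at every point.\<close>

type_synonym 'a adj = "'a tvec \<times> 'a endo"
type_synonym 'a aform = "'a \<Rightarrow> 'a tvec list \<Rightarrow> 'a adj"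

definition AM ::
    "('a::topological_space, 'e::euclidean_space) chart set \<Rightarrow> 'a metric \<Rightarrow> ('a, 'a adj) vbundle" where
  "AM A g = \<lparr>fibre = (\<lambda>p. tangent_space A p \<times> skew_endos A g p),
     sections = {s. (\<lambda>p. fst (s p)) \<in> sections (TM A) \<and> (\<lambda>p. snd (s p)) \<in> sections (skewTM A g)}\<rparr>"

definition deformation_connection ::
    "('a::topological_space, 'e::euclidean_space) chart set \<Rightarrow> 'a metric \<Rightarrow> 'a connection \<Rightarrow>
     'a vfield \<Rightarrow> ('a \<Rightarrow> 'a adj) \<Rightarrow> ('a \<Rightarrow> 'a adj)" where
  "deformation_connection A g nabla \<xi> s =
     (let \<eta> = (\<lambda>p. fst (s p)); \<Phi> = (\<lambda>p. snd (s p)) in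
      (\<lambda>p. (nabla \<xi> \<eta> p - \<Phi> p (\<xi> p),
            nabla_skew A g nabla \<xi> \<Phi> p - curvature A g nabla p [\<xi> p, \<eta> p])))"

definition dA ::
    "('a::topological_space, 'e::euclidean_space) chart set \<Rightarrow> 'a metric \<Rightarrow> 'a connection \<Rightarrow>
     nat \<Rightarrow> 'a aform \<Rightarrow> 'a aform" where
  "dA A g nabla = cov_ext_deriv A (AM A g) (deformation_connection A g nabla)"

definition col :: "('a \<Rightarrow> 'a tvec list \<Rightarrow> 'a tvec) \<Rightarrow> ('a \<Rightarrow> 'a tvec list \<Rightarrow> 'a endo) \<Rightarrow> 'a aform" where
  "col \<psi> \<Psi> = (\<lambda>p vs. (\<psi> p vs, \<Psi> p vs))"

definition top_part :: "'a aform \<Rightarrow> 'a \<Rightarrow> 'a tvec list \<Rightarrow> 'a tvec" where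
  "top_part \<phi> = (\<lambda>p vs. fst (\<phi> p vs))"

definition bottom_part :: "'a aform \<Rightarrow> 'a \<Rightarrow> 'a tvec list \<Rightarrow> 'a endo" where
  "bottom_part \<phi> = (\<lambda>p vs. snd (\<phi> p vs))"


section \<open>Harmonic subbundles, splitting operators and BGG operators\<close>

text \<open>The map \<open>Alt\<close> in the fibre over a point with tangent space \<open>V\<close>.\<close>

definition Alt :: "'a tvec set \<Rightarrow> nat \<Rightarrow> ('a tvec list \<Rightarrow> 'a endo) \<Rightarrow> ('a tvec list \<Rightarrow> 'a tvec)" where
  "Alt V k \<Psi> = (\<lambda>vs. if vs \<in> tuples (Suc k) V
     then (\<Sum>i\<le>k. (-1) ^ (k - i) *\<^sub>R \<Psi> (omit i vs) (vs ! i)) else 0)"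

text \<open>The fibres of \<open>\<H>\<^sup>kM \<subseteq> \<Lambda>\<^sup>kT\<^sup>*M \<otimes> \<A>M\<close>. For \<open>k\<close> larger than the dimension, \<open>\<Lambda>\<^sup>kT\<^sup>*M\<close>, and with it this
  fibre, is zero.\<close>

definition harmonic_fibre ::
    "('a::topological_space, 'e::euclidean_space) chart set \<Rightarrow> 'a metric \<Rightarrow> nat \<Rightarrow> 'a \<Rightarrow>
     ('a tvec list \<Rightarrow> 'a adj) set" where
  "harmonic_fibre A g k p = {F \<in> alt_maps k (tangent_space A p) (fibre (AM A g) p).
     if k = 0 then (\<forall>vs. snd (F vs) = 0)
     else if k = 1 then (\<forall>vs. snd (F vs) = 0) \<and>
       (\<forall>v\<in>tangent_space A p. \<forall>w\<in>tangent_space A p. g p (fst (F [v])) w = g p v (fst (F [w])))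
     else (\<forall>vs. fst (F vs) = 0) \<and> Alt (tangent_space A p) k (\<lambda>vs. snd (F vs)) = 0}"

definition harmonic_sections ::
    "('a::topological_space, 'e::euclidean_space) chart set \<Rightarrow> 'a metric \<Rightarrow> nat \<Rightarrow> 'a aform set" where
  "harmonic_sections A g k = {\<alpha> \<in> forms A (AM A g) k. \<forall>p. \<alpha> p \<in> harmonic_fibre A g k p}"

definition splitting ::
    "('a::topological_space, 'e::euclidean_space) chart set \<Rightarrow> 'a metric \<Rightarrow> 'a connection \<Rightarrow>
     nat \<Rightarrow> 'a aform \<Rightarrow> 'a aform" where
  "splitting A g nabla k \<alpha> =
     (if k = 0 then col (top_part \<alpha>) (THE \<Phi>. \<Phi> \<in> forms A (skewTM A g) 0 \<and>
        col (top_part (dA A g nabla 0 (col (top_part \<alpha>) \<Phi>))) 0 \<in> harmonic_sections A g 1)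
      else if k = 1 then col (top_part \<alpha>) (THE \<Psi>. \<Psi> \<in> forms A (skewTM A g) 1 \<and>
        top_part (dA A g nabla 1 (col (top_part \<alpha>) \<Psi>)) = 0)
      else col 0 (bottom_part \<alpha>))"

definition bgg ::
    "('a::topological_space, 'e::euclidean_space) chart set \<Rightarrow> 'a metric \<Rightarrow> 'a connection \<Rightarrow>
     nat \<Rightarrow> 'a aform \<Rightarrow> 'a aform" where
  "bgg A g nabla k \<alpha> =
     (if k = 0 then col (top_part (dA A g nabla 0 (splitting A g nabla 0 \<alpha>))) 0
      else dA A g nabla k (splitting A g nabla k \<alpha>))"


section \<open>Cochain complexes of real vector spaces\<close>

definition cochain_complex :: "(nat \<Rightarrow> 'v::real_vector set) \<Rightarrow> (nat \<Rightarrow> 'v \<Rightarrow> 'v) \<Rightarrow> bool" where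
  "cochain_complex C d \<longleftrightarrow> (\<forall>k. subspace (C k) \<and> lin_on (C k) (d k) \<and> d k ` C k \<subseteq> C (Suc k) \<and>
     (\<forall>x\<in>C k. d (Suc k) (d k x) = 0))"

definition chain_map ::
    "(nat \<Rightarrow> 'v::real_vector set) \<Rightarrow> (nat \<Rightarrow> 'v \<Rightarrow> 'v) \<Rightarrow>
     (nat \<Rightarrow> 'w::real_vector set) \<Rightarrow> (nat \<Rightarrow> 'w \<Rightarrow> 'w) \<Rightarrow> (nat \<Rightarrow> 'v \<Rightarrow> 'w) \<Rightarrow> bool" where
  "chain_map C d C' d' f \<longleftrightarrow> (\<forall>k. lin_on (C k) (f k) \<and> f k ` C k \<subseteq> C' k \<and>
     (\<forall>x\<in>C k. d' k (f k x) = f (Suc k) (d k x)))"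

definition cocycles ::
    "(nat \<Rightarrow> 'v::real_vector set) \<Rightarrow> (nat \<Rightarrow> 'v \<Rightarrow> 'v) \<Rightarrow> nat \<Rightarrow> 'v set" where
  "cocycles C d k = {x \<in> C k. d k x = 0}"

definition coboundaries ::
    "(nat \<Rightarrow> 'v::real_vector set) \<Rightarrow> (nat \<Rightarrow> 'v \<Rightarrow> 'v) \<Rightarrow> nat \<Rightarrow> 'v set" where
  "coboundaries C d k = (case k of 0 \<Rightarrow> {0} | Suc l \<Rightarrow> d l ` C l)"

definition cohomology_class ::
    "(nat \<Rightarrow> 'v::real_vector set) \<Rightarrow> (nat \<Rightarrow> 'v \<Rightarrow> 'v) \<Rightarrow> nat \<Rightarrow> 'v \<Rightarrow> 'v set" where
  "cohomology_class C d k x = (\<lambda>b. x + b) ` coboundaries C d k"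

definition cohomology ::
    "(nat \<Rightarrow> 'v::real_vector set) \<Rightarrow> (nat \<Rightarrow> 'v \<Rightarrow> 'v) \<Rightarrow> nat \<Rightarrow> 'v set set" where
  "cohomology C d k = cohomology_class C d k ` cocycles C d k"

text \<open>The linear combination of two classes in the quotient space.\<close>

definition class_lincomb ::
    "(nat \<Rightarrow> 'v::real_vector set) \<Rightarrow> (nat \<Rightarrow> 'v \<Rightarrow> 'v) \<Rightarrow> nat \<Rightarrow>
     real \<Rightarrow> 'v set \<Rightarrow> real \<Rightarrow> 'v set \<Rightarrow> 'v set" where
  "class_lincomb C d k a X b Y = (\<Union>x\<in>X. \<Union>y\<in>Y. cohomology_class C d k (a *\<^sub>R x + b *\<^sub>R y))"

definition induced_map ::
    "(nat \<Rightarrow> 'w::real_vector set) \<Rightarrow> (nat \<Rightarrow> 'w \<Rightarrow> 'w) \<Rightarrow> (nat \<Rightarrow> 'v \<Rightarrow> 'w) \<Rightarrow> nat \<Rightarrow> 'v set \<Rightarrow> 'w set" where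
  "induced_map C' d' f k X = (\<Union>x\<in>X. cohomology_class C' d' k (f k x))"

definition cohomology_iso ::
    "(nat \<Rightarrow> 'v::real_vector set) \<Rightarrow> (nat \<Rightarrow> 'v \<Rightarrow> 'v) \<Rightarrow>
     (nat \<Rightarrow> 'w::real_vector set) \<Rightarrow> (nat \<Rightarrow> 'w \<Rightarrow> 'w) \<Rightarrow> (nat \<Rightarrow> 'v \<Rightarrow> 'w) \<Rightarrow> nat \<Rightarrow> bool" where
  "cohomology_iso C d C' d' f k \<longleftrightarrow>
     bij_betw (induced_map C' d' f k) (cohomology C d k) (cohomology C' d' k) \<and>
     (\<forall>X\<in>cohomology C d k. \<forall>Y\<in>cohomology C d k. \<forall>a b.
        induced_map C' d' f k (class_lincomb C d k a X b Y) =
        class_lincomb C' d' k a (induced_map C' d' f k X) b (induced_map C' d' f k Y))"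

end

(*
The deformation connection has curvature with vanishing top component, by the Bianchi identity; for
constant sectional curvature it is flat. Hence the top component of the square of its covariant
exterior derivative d always vanishes. Call an AM-valued k-form normal if k = 1 and its top component
is symmetric, or if k >= 2 and its top component vanishes (for k = 0 every section is normal). On
forms with vanishing top component, the top component of d is the algebraic map Alt up to sign. Every
endomorphism is uniquely the sum of a symmetric and a skew one, and Alt is bijective on o(TM)-valued
1-forms and surjective in higher degrees. So every form becomes normal after an exact form has been
subtracted, and the images of the splitting operators are exactly the normal forms with normal
derivative. The derivative of such a form is again of this kind, which gives dL = LD, and the comparison
of cohomologies is formal.
*)

theory Submission
  imports Defs
begin

text \<open>Curvature, the induced connection, the covariant exterior derivative and the splitting
  operators are definite descriptions, so each needs existence and uniqueness of a pointwise tensor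
  that is known only on vector fields. As tangent vectors are derivations of the algebra of global
  smooth functions, this takes frames that are cut off by bump functions, and Hadamard's lemma to
  see that the coordinate fields span. Forms are treated as maps on lists of vector fields. Taking
  Cartan's formula as a recursion for the exterior derivative reduces d d to the curvature without
  double sums; the result is stated modulo a subgroup of values, so that one induction covers both
  the vanishing top component and flatness. Alt has to be inverted by smooth endomorphisms F with
  prescribed g(F x, y); smoothness of raising an index is obtained by Gaussian elimination over the
  ring of smooth functions. Neither the splitting nor the BGG operators are ever computed: their
  linearity, and the harmonicity of the values of D, follow from uniqueness and from the vanishing
  top component of d d.\<close>

section \<open>Smooth functions on Euclidean space\<close>

text \<open>Openness matters: \<open>frechet_derivative f (at x)\<close> depends on the values of
  \<open>f\<close> near \<open>x\<close>, and these must all be taken in \<open>S\<close>.\<close>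

lemma Ck_on_cong:
  assumes "open S" "\<And>x. x \<in> S \<Longrightarrow> f x = g x" "Ck_on k S f"
  shows "Ck_on k S g"
  using assms(2,3)
proof (induction k arbitrary: f g)
  case 0
  then show ?case using continuous_on_cong[of S S f g] by auto
next
  case (Suc k)
  have d: "(g has_derivative frechet_derivative f (at x)) (at x)" if "x \<in> S" for x
  proof (rule has_derivative_transform_within_open[OF _ assms(1) that Suc.prems(1)])
    show "(f has_derivative frechet_derivative f (at x)) (at x)"
      using Suc.prems(2) that assms(1)
      by (simp add: differentiable_on_eq_differentiable_at frechet_derivative_works)
  qed
  then have "g differentiable_on S"
    using assms(1) by (auto simp: differentiable_on_eq_differentiable_at differentiable_def)
  moreover have "Ck_on k S (\<lambda>x. frechet_derivative g (at x) v)" for v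
    by (rule Suc.IH[of "\<lambda>x. frechet_derivative f (at x) v"])
      (use Suc.prems(2) frechet_derivative_at[OF d] in auto)
  ultimately show ?case by simp
qed

text \<open>The introduction rule for a derivative that is known explicitly; the recursive
  definition speaks only of \<open>frechet_derivative\<close>.\<close>

lemma Ck_on_Suc:
  assumes "open S" "\<And>x. x \<in> S \<Longrightarrow> (f has_derivative f' x) (at x)" "\<And>v. Ck_on k S (\<lambda>x. f' x v)"
  shows "Ck_on (Suc k) S f"
proof -
  have "f differentiable_on S"
    using assms(1,2) by (auto simp: differentiable_on_eq_differentiable_at differentiable_def)
  moreover have "Ck_on k S (\<lambda>x. frechet_derivative f (at x) v)" for v
    by (rule Ck_on_cong[OF assms(1) _ assms(3)[of v]]) (simp add: frechet_derivative_at[OF assms(2)])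
  ultimately show ?thesis by simp
qed

lemma Ck_on_SucD:
  assumes "Ck_on (Suc k) S f" "open S" "x \<in> S"
  shows "(f has_derivative frechet_derivative f (at x)) (at x)"
  using assms by (simp add: differentiable_on_eq_differentiable_at frechet_derivative_works)

lemma Ck_on_pred: "Ck_on (Suc k) S f \<Longrightarrow> Ck_on k S f"
proof (induction k arbitrary: f)
  case 0
  then show ?case by (simp add: differentiable_imp_continuous_on)
next
  case (Suc k)
  then have "f differentiable_on S" "\<And>v. Ck_on k S (\<lambda>x. frechet_derivative f (at x) v)" by auto
  then show ?case by simp
qed

lemma Ck_on_local:
  assumes "\<And>x. x \<in> S \<Longrightarrow> \<exists>T. open T \<and> x \<in> T \<and> Ck_on k T f"
  shows "Ck_on k S f"
  using assms
proof (induction k arbitrary: f)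
  case 0
  show ?case unfolding Ck_on.simps
  proof (rule continuous_at_imp_continuous_on, rule ballI)
    fix x assume "x \<in> S"
    then obtain T where "open T" "x \<in> T" "Ck_on 0 T f" using 0 by blast
    then show "isCont f x" by (simp add: continuous_on_eq_continuous_at)
  qed
next
  case (Suc k)
  have "f differentiable at x" if x: "x \<in> S" for x
  proof -
    obtain T where "open T" "x \<in> T" "Ck_on (Suc k) T f" using Suc.prems x by blast
    then show ?thesis by (simp add: differentiable_on_eq_differentiable_at)
  qed
  moreover have "Ck_on k S (\<lambda>x. frechet_derivative f (at x) v)" for v
  proof (rule Suc.IH)
    fix x assume "x \<in> S"
    then obtain T where "open T" "x \<in> T" "Ck_on (Suc k) T f" using Suc.prems by blast
    then show "\<exists>T. open T \<and> x \<in> T \<and> Ck_on k T (\<lambda>x. frechet_derivative f (at x) v)" by auto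
  qed
  ultimately show ?case
    by (simp add: differentiable_at_imp_differentiable_on)
qed

lemma Ck_on_subset: "Ck_on k S f \<Longrightarrow> T \<subseteq> S \<Longrightarrow> Ck_on k T f"
  by (induction k arbitrary: f) (auto intro: continuous_on_subset differentiable_on_subset)

lemma Ck_on_const: "open S \<Longrightarrow> Ck_on k S (\<lambda>x. c)"
proof (induction k arbitrary: c)
  case (Suc k)
  show ?case
    by (rule Ck_on_Suc[where f' = "\<lambda>x v. 0"]) (use Suc in auto)
qed auto

lemma Ck_on_linear: "open S \<Longrightarrow> bounded_linear L \<Longrightarrow> Ck_on k S L"
proof (cases k)
  case 0
  then show "bounded_linear L \<Longrightarrow> ?thesis" by (simp add: linear_continuous_on)
next
  case (Suc n)
  then show "open S \<Longrightarrow> bounded_linear L \<Longrightarrow> ?thesis"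
    using Ck_on_Suc[where f' = "\<lambda>x. L" and f = L] Ck_on_const bounded_linear_imp_has_derivative by blast
qed

lemma Ck_on_add:
  assumes "open S" "Ck_on k S f" "Ck_on k S g"
  shows "Ck_on k S (\<lambda>x. f x + g x)"
  using assms(2,3)
proof (induction k arbitrary: f g)
  case (Suc k)
  show ?case
    by (rule Ck_on_Suc[OF assms(1) has_derivative_add[OF Ck_on_SucD[OF Suc.prems(1) assms(1)] Ck_on_SucD[OF Suc.prems(2) assms(1)]]])
      (use Suc in auto)
qed (auto intro: continuous_on_add)

lemma Ck_on_linear_compose:
  assumes "open S" "bounded_linear L" "Ck_on k S f"
  shows "Ck_on k S (\<lambda>x. L (f x))"
  using assms(3)
proof (induction k arbitrary: f)
  case 0
  then show ?case using bounded_linear.continuous_on[OF assms(2)] by simp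
next
  case (Suc k)
  show ?case
    by (rule Ck_on_Suc[OF assms(1) bounded_linear.has_derivative[OF assms(2) Ck_on_SucD[OF Suc.prems assms(1)]]])
      (use Suc in auto)
qed

lemma Ck_on_sum:
  assumes "open S" "\<And>i. i \<in> I \<Longrightarrow> Ck_on k S (f i)"
  shows "Ck_on k S (\<lambda>x. \<Sum>i\<in>I. f i x)"
  using assms(2) by (induction I rule: infinite_finite_induct) (auto intro: Ck_on_add Ck_on_const assms(1))

lemma Ck_on_scaleR:
  assumes "open S" "Ck_on k S f" "Ck_on k S g"
  shows "Ck_on k S (\<lambda>x. f x *\<^sub>R g x)"
  using assms(2,3)
proof (induction k arbitrary: f g)
  case (Suc k)
  have p: "Ck_on k S f" "Ck_on k S g" using Suc.prems Ck_on_pred by blast+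
  show ?case
    by (rule Ck_on_Suc[OF assms(1) has_derivative_scaleR[OF Ck_on_SucD[OF Suc.prems(1) assms(1)] Ck_on_SucD[OF Suc.prems(2) assms(1)]]])
      (use Suc p in \<open>auto intro!: Ck_on_add assms(1)\<close>)
qed (auto intro: continuous_on_scaleR)

lemma Ck_on_mult:
  fixes f g :: "'e::real_normed_vector \<Rightarrow> real"
  assumes "open S" "Ck_on k S f" "Ck_on k S g"
  shows "Ck_on k S (\<lambda>x. f x * g x)"
  using Ck_on_scaleR[OF assms] by simp

lemma Ck_on_inverse:
  fixes f :: "'e::real_normed_vector \<Rightarrow> real"
  assumes "open S" "Ck_on k S f" "\<And>x. x \<in> S \<Longrightarrow> f x \<noteq> 0"
  shows "Ck_on k S (\<lambda>x. inverse (f x))"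
  using assms(2)
proof (induction k)
  case 0
  then show ?case using assms(3) by (auto intro: continuous_on_inverse)
next
  case (Suc k)
  have p: "Ck_on k S (\<lambda>x. inverse (f x))" using Suc Ck_on_pred by blast
  have m: "Ck_on k S (\<lambda>x. (-1) * (inverse (f x) * frechet_derivative f (at x) v * inverse (f x)))" for v
    by (intro Ck_on_mult Ck_on_const assms(1) p) (use Suc.prems in simp)
  show ?case
    by (rule Ck_on_Suc[OF assms(1) Deriv.has_derivative_inverse[OF assms(3) Ck_on_SucD[OF Suc.prems assms(1)]]])
      (use m in auto)
qed

text \<open>The derivative of a composition is not of the form to which the induction hypothesis
  applies. Expanding the derivative of \<open>h\<close> in \<open>Basis\<close> makes it a sum of
  products of a component of that derivative with the composition of \<open>h\<close> and a
  directional derivative of \<open>f\<close> in a fixed direction.\<close>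

lemma Ck_on_compose:
  fixes h :: "'d::real_normed_vector \<Rightarrow> 'e::euclidean_space"
  assumes "open S" "open T" "Ck_on k T f" "Ck_on k S h" "h ` S \<subseteq> T"
  shows "Ck_on k S (\<lambda>x. f (h x))"
  using assms(3,4)
proof (induction k arbitrary: f)
  case 0
  then show ?case using assms(5) by (auto intro: continuous_on_compose2)
next
  case (Suc k)
  have p: "Ck_on k S h" using Suc.prems Ck_on_pred by blast
  let ?d = "\<lambda>x v. \<Sum>b\<in>Basis. (frechet_derivative h (at x) v \<bullet> b) *\<^sub>R frechet_derivative f (at (h x)) b"
  have d: "((\<lambda>x. f (h x)) has_derivative ?d x) (at x)" if "x \<in> S" for x
  proof -
    have f': "(f has_derivative frechet_derivative f (at (h x))) (at (h x))"
      using that assms Suc.prems(1) by (intro Ck_on_SucD) auto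
    have "((\<lambda>x. f (h x)) has_derivative (\<lambda>v. frechet_derivative f (at (h x)) (frechet_derivative h (at x) v))) (at x)"
      using has_derivative_compose[OF Ck_on_SucD[OF Suc.prems(2) assms(1) that] f'] .
    moreover have "frechet_derivative f (at (h x)) (frechet_derivative h (at x) v) = ?d x v" for v
      using linear_sum[OF has_derivative_linear[OF f'], of "\<lambda>b. (frechet_derivative h (at x) v \<bullet> b) *\<^sub>R b" Basis]
      by (simp add: euclidean_representation linear_cmul[OF has_derivative_linear[OF f']])
    ultimately show ?thesis by simp
  qed
  have "Ck_on k S (\<lambda>x. ?d x v)" for v
    by (intro Ck_on_sum Ck_on_scaleR assms(1) Suc.IH p Ck_on_linear_compose[OF assms(1), of "\<lambda>y. y \<bullet> _"]
        bounded_linear_inner_left) (use Suc.prems in auto)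
  with d show ?case by (rule Ck_on_Suc[OF assms(1)])
qed

lemma smooth_on_cong:
  assumes "open S" "\<And>x. x \<in> S \<Longrightarrow> f x = g x" "smooth_on S f"
  shows "smooth_on S g"
  using assms Ck_on_cong unfolding smooth_on_def by blast

lemma smooth_on_subset: "smooth_on S f \<Longrightarrow> T \<subseteq> S \<Longrightarrow> smooth_on T f"
  using Ck_on_subset unfolding smooth_on_def by blast

lemma smooth_on_local:
  assumes "\<And>x. x \<in> S \<Longrightarrow> \<exists>T. open T \<and> x \<in> T \<and> smooth_on T f"
  shows "smooth_on S f"
  unfolding smooth_on_def
proof (intro allI Ck_on_local)
  fix k x assume "x \<in> S"
  then show "\<exists>T. open T \<and> x \<in> T \<and> Ck_on k T f"
    using assms[of x] unfolding smooth_on_def by blast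
qed

lemma smooth_on_const: "open S \<Longrightarrow> smooth_on S (\<lambda>x. c)"
  by (simp add: smooth_on_def Ck_on_const)

lemma smooth_on_linear: "open S \<Longrightarrow> bounded_linear L \<Longrightarrow> smooth_on S L"
  by (simp add: smooth_on_def Ck_on_linear)

lemma smooth_on_add: "open S \<Longrightarrow> smooth_on S f \<Longrightarrow> smooth_on S g \<Longrightarrow> smooth_on S (\<lambda>x. f x + g x)"
  by (simp add: smooth_on_def Ck_on_add)

lemma smooth_on_sum:
  "open S \<Longrightarrow> (\<And>i. i \<in> I \<Longrightarrow> smooth_on S (f i)) \<Longrightarrow> smooth_on S (\<lambda>x. \<Sum>i\<in>I. f i x)"
  by (simp add: smooth_on_def Ck_on_sum)

lemma smooth_on_mult:
  fixes f g :: "'e::real_normed_vector \<Rightarrow> real"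
  shows "open S \<Longrightarrow> smooth_on S f \<Longrightarrow> smooth_on S g \<Longrightarrow> smooth_on S (\<lambda>x. f x * g x)"
  by (simp add: smooth_on_def Ck_on_mult)

lemma smooth_on_minus:
  fixes f g :: "'e::real_normed_vector \<Rightarrow> real"
  assumes "open S" "smooth_on S f" "smooth_on S g"
  shows "smooth_on S (\<lambda>x. f x - g x)"
  using smooth_on_add[OF assms(1,2) smooth_on_mult[OF assms(1) smooth_on_const[OF assms(1), of "-1"] assms(3)]]
  by simp

lemma smooth_on_divide:
  fixes f g :: "'e::real_normed_vector \<Rightarrow> real"
  assumes "open S" "smooth_on S f" "smooth_on S g" "\<And>x. x \<in> S \<Longrightarrow> g x \<noteq> 0"
  shows "smooth_on S (\<lambda>x. f x / g x)"
  using assms unfolding smooth_on_def divide_inverse by (simp add: Ck_on_mult Ck_on_inverse)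

lemma smooth_on_compose:
  fixes h :: "'d::real_normed_vector \<Rightarrow> 'e::euclidean_space"
  assumes "open S" "open T" "smooth_on T f" "smooth_on S h" "h ` S \<subseteq> T"
  shows "smooth_on S (\<lambda>x. f (h x))"
  using assms unfolding smooth_on_def by (blast intro: Ck_on_compose)

lemma smooth_on_derivative:
  "smooth_on S f \<Longrightarrow> smooth_on S (\<lambda>x. frechet_derivative f (at x) v)"
  unfolding smooth_on_def by (metis Ck_on.simps(2))

lemma smooth_on_has_derivative:
  "smooth_on S f \<Longrightarrow> open S \<Longrightarrow> x \<in> S \<Longrightarrow> (f has_derivative frechet_derivative f (at x)) (at x)"
  unfolding smooth_on_def using Ck_on_SucD by blast

lemma smooth_on_imp_continuous_on: "smooth_on S f \<Longrightarrow> continuous_on S f"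
  unfolding smooth_on_def using Ck_on.simps(1) by blast

section \<open>Bump functions\<close>

lemma flat_tendsto: "((\<lambda>t::real. inverse t ^ n * exp (- inverse t)) \<longlongrightarrow> 0) (at_right 0)"
proof -
  have "((\<lambda>t::real. inverse t ^ n / exp (inverse t)) \<longlongrightarrow> 0) (at_right 0)"
    by (rule filterlim_compose[OF tendsto_power_div_exp_0 filterlim_inverse_at_top_right])
  then show ?thesis by (simp add: exp_minus divide_inverse)
qed

text \<open>The functions \<open>t\<^sup>-\<^sup>n exp (-1/t)\<close> are closed under differentiation up to linear combinations, so
  one induction handles all derivatives.\<close>

definition flat :: "nat \<Rightarrow> real \<Rightarrow> real" where
  "flat n t = (if t > 0 then inverse t ^ n * exp (- inverse t) else 0)"

lemma flat_has_derivative: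
  "(flat n has_field_derivative (- real n * flat (Suc n) t + flat (Suc (Suc n)) t)) (at t)"
proof -
  consider "t > 0" | "t < 0" | "t = 0" by linarith
  then show ?thesis
  proof cases
    case 1
    have "((\<lambda>t::real. inverse t ^ n * exp (- inverse t)) has_field_derivative
       (- real n * flat (Suc n) t + flat (Suc (Suc n)) t)) (at t)"
      using 1 by (cases n) (auto intro!: derivative_eq_intros simp: flat_def algebra_simps power2_eq_square,
          metis One_nat_def power_eq_if)
    then show ?thesis
      by (rule has_field_derivative_transform_within_open[of _ _ _ "{0<..}"]) (use 1 in \<open>auto simp: flat_def\<close>)
  next
    case 2
    have "((\<lambda>t. 0) has_field_derivative 0) (at t)" by simp
    then have "(flat n has_field_derivative 0) (at t)"
      by (rule has_field_derivative_transform_within_open[of _ _ _ "{..<0}"]) (use 2 in \<open>auto simp: flat_def\<close>)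
    then show ?thesis using 2 by (simp add: flat_def)
  next
    case 3
    \<comment> \<open>The difference quotient of \<open>flat n\<close> at 0 is
      \<open>flat (Suc n)\<close>, so both one-sided limits of the latter are wanted.\<close>
    have r: "((\<lambda>t. flat (Suc n) t) \<longlongrightarrow> 0) (at_right 0)"
      by (rule Lim_transform_eventually[OF flat_tendsto[of "Suc n"]])
        (auto simp: flat_def eventually_at_right_less intro!: eventually_at_rightI[of 0 1])
    have l: "((\<lambda>t. flat (Suc n) t) \<longlongrightarrow> 0) (at_left 0)"
      by (rule Lim_transform_eventually[OF tendsto_const])
        (auto simp: flat_def intro!: eventually_at_leftI[of "-1"])
    have "((\<lambda>t. flat (Suc n) t) \<longlongrightarrow> 0) (at 0)"
      using l r by (simp add: filterlim_split_at)
    then have "(flat n has_field_derivative 0) (at 0)"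
      unfolding has_field_derivative_iff
      by (rule Lim_transform_eventually) (auto simp: flat_def field_simps eventually_at_filter)
    then show ?thesis using 3 by (simp add: flat_def)
  qed
qed

lemma flat_smooth: "smooth_on UNIV (flat n)"
  unfolding smooth_on_def
proof
  fix k show "Ck_on k UNIV (flat n)"
  proof (induction k arbitrary: n)
    case 0
    then show ?case
      by (auto intro!: continuous_at_imp_continuous_on DERIV_isCont[OF flat_has_derivative])
  next
    case (Suc k)
    have "Ck_on k UNIV (\<lambda>t. (- real n * flat (Suc n) t + flat (Suc (Suc n)) t) * v)" for v
      by (intro Ck_on_mult Ck_on_add Ck_on_const open_UNIV Suc)
    then show ?case
      by (intro Ck_on_Suc[OF open_UNIV has_field_derivative_imp_has_derivative[OF flat_has_derivative]])
  qed
qed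

text \<open>The usual quotient a / (a + b), where a vanishes outside the ball of radius
  \<open>t\<close> and b inside the ball of radius \<open>s\<close>. Because \<open>s < t\<close>,
  they have no common zero.\<close>

lemma smooth_bump:
  fixes c :: "'e::euclidean_space"
  assumes "0 < s" "s < t"
  obtains \<beta> where "smooth_on UNIV \<beta>" "\<And>y. dist y c \<le> s \<Longrightarrow> \<beta> y = (1::real)" "\<And>y. dist y c \<ge> t \<Longrightarrow> \<beta> y = 0"
proof
  \<comment> \<open>The squared distance to \<open>c\<close>, written in coordinates: unlike the
    distance it is smooth at \<open>c\<close> as well.\<close>
  let ?d = "\<lambda>y. \<Sum>b\<in>Basis. (((y::'e) \<bullet> b - c \<bullet> b) * (y \<bullet> b - c \<bullet> b))"
  have d: "?d y = (dist y c)\<^sup>2" for y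
    by (simp only: dist_norm power2_norm_eq_inner, subst euclidean_inner) (simp only: inner_diff_left)
  let ?a = "\<lambda>y. flat 0 (t\<^sup>2 - ?d y)" and ?b = "\<lambda>y. flat 0 (?d y - s\<^sup>2)"
  let ?\<beta> = "\<lambda>y. ?a y / (?a y + ?b y)"
  have ds: "smooth_on UNIV ?d"
    by (intro smooth_on_sum smooth_on_mult smooth_on_minus smooth_on_linear smooth_on_const open_UNIV bounded_linear_inner_left)
  have a: "smooth_on UNIV ?a" "smooth_on UNIV ?b"
    by (intro smooth_on_compose[OF open_UNIV open_UNIV flat_smooth] smooth_on_minus smooth_on_const ds open_UNIV; simp)+
  have nz: "?a y + ?b y \<noteq> 0" for y
  proof -
    have "t\<^sup>2 - ?d y > 0 \<or> ?d y - s\<^sup>2 > 0"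
      using assms power_strict_mono[of s t 2] by linarith
    moreover have nn: "flat 0 u \<ge> 0" and p: "u > 0 \<Longrightarrow> flat 0 u > 0" for u by (auto simp: flat_def)
    ultimately have "?a y + ?b y > 0"
      using add_pos_nonneg[OF p nn] add_nonneg_pos[OF nn p] by blast
    then show ?thesis by simp
  qed
  show "smooth_on UNIV ?\<beta>"
    by (intro smooth_on_divide smooth_on_add a open_UNIV nz)
  show "?\<beta> y = 1" if "dist y c \<le> s" for y
  proof -
    have "?d y \<le> s\<^sup>2" using that by (simp add: d power_mono)
    then have "?b y = 0" by (simp add: flat_def)
    then show ?thesis using nz[of y] by simp
  qed
  show "?\<beta> y = 0" if "dist y c \<ge> t" for y
  proof -
    have "?d y \<ge> t\<^sup>2" using that assms by (simp add: d power_mono)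
    then show ?thesis by (simp add: flat_def)
  qed
qed

text \<open>Supplies the smooth coefficients in Hadamard's lemma. The weight \<open>t ^ m\<close> is
  there for the induction: differentiation in \<open>y\<close> brings out a factor \<open>t\<close>,
  so a directional derivative of the integral is an integral of the same kind, with
  \<open>Suc m\<close> and a directional derivative of \<open>F\<close>.\<close>

lemma smooth_on_segment_integral:
  fixes F :: "'e::euclidean_space \<Rightarrow> real"
  assumes "smooth_on (ball q r) F" "r > 0"
  shows "smooth_on (ball q r) (\<lambda>y. integral {0..1} (\<lambda>t. t ^ m * F (q + t *\<^sub>R (y - q))))"
  unfolding smooth_on_def
proof
  fix k
  have seg: "q + t *\<^sub>R (y - q) \<in> ball q r" if "y \<in> ball q r" "t \<in> {0..1}" for t y
  proof -
    have "\<bar>t\<bar> * norm (q - y) \<le> 1 * norm (q - y)"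
      using that by (intro mult_right_mono) auto
    then have "t * norm (y - q) \<le> norm (y - q)" using that by (simp add: norm_minus_commute)
    then have "dist (q + t *\<^sub>R (y - q)) q \<le> dist y q"
      using that by (simp add: dist_norm)
    then show ?thesis using that(1) by (simp add: dist_commute)
  qed
  have cont: "continuous_on (ball q r \<times> {0..1}) (\<lambda>(y, t). t ^ m * F (q + t *\<^sub>R (y - q)))"
    if "smooth_on (ball q r) F" for F :: "'e \<Rightarrow> real" and m
    unfolding split_beta
    by (intro continuous_intros continuous_on_compose2[OF smooth_on_imp_continuous_on[OF that]]) (use seg in auto)
  show "Ck_on k (ball q r) (\<lambda>y. integral {0..1} (\<lambda>t. t ^ m * F (q + t *\<^sub>R (y - q))))"
    using assms(1)
  proof (induction k arbitrary: F m)
    case 0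
    have "continuous_on (ball q r) (\<lambda>y. integral (cbox 0 1) (\<lambda>t. t ^ m * F (q + t *\<^sub>R (y - q))))"
      by (rule integral_continuous_on_param) (use cont[OF 0] in \<open>simp add: box_real\<close>)
    then show ?case by simp
  next
    case (Suc k)
    let ?F' = "\<lambda>x. frechet_derivative F (at x)"
    \<comment> \<open>\<open>leibniz_rule\<close> wants the derivative of the integrand as a
      continuous family of bounded linear functions; continuity is checked on the basis
      vectors.\<close>
    let ?fx = "\<lambda>y t. Blinfun (\<lambda>v. t ^ m * ?F' (q + t *\<^sub>R (y - q)) (t *\<^sub>R v))"
    have F': "(F has_derivative ?F' x) (at x)" if "x \<in> ball q r" for x
      using smooth_on_has_derivative[OF Suc.prems open_ball that] .
    have dF: "((\<lambda>y. t ^ m * F (q + t *\<^sub>R (y - q))) has_derivative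
        (\<lambda>v. t ^ m * ?F' (q + t *\<^sub>R (y - q)) (t *\<^sub>R v))) (at y)"
      if "y \<in> ball q r" "t \<in> {0..1}" for y t
    proof -
      have "((\<lambda>y. q + t *\<^sub>R (y - q)) has_derivative (\<lambda>v. t *\<^sub>R v)) (at y)"
        by (auto intro!: derivative_eq_intros)
      from has_derivative_compose[OF this F'[OF seg[OF that]]]
      show ?thesis by (intro has_derivative_mult_right)
    qed
    have bl: "bounded_linear (\<lambda>v. t ^ m * ?F' (q + t *\<^sub>R (y - q)) (t *\<^sub>R v))"
      if "y \<in> ball q r" "t \<in> {0..1}" for y t
      using has_derivative_bounded_linear[OF dF[OF that]] .
    have ap: "blinfun_apply (?fx y t) = (\<lambda>v. t ^ Suc m * ?F' (q + t *\<^sub>R (y - q)) v)"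
      if "y \<in> ball q r" "t \<in> {0..1}" for y t
      using bounded_linear_Blinfun_apply[OF bl[OF that]]
        linear_cmul[OF has_derivative_linear[OF F'[OF seg[OF that]]]]
      by (simp add: fun_eq_iff ac_simps)
    have cb: "continuous_on (ball q r \<times> {0..1}) (\<lambda>(y, t). ?fx y t)"
    proof (rule continuous_on_blinfun_componentwise)
      fix i :: 'e assume "i \<in> Basis"
      show "continuous_on (ball q r \<times> {0..1}) (\<lambda>x. blinfun_apply (case x of (y, t) \<Rightarrow> ?fx y t) i)"
        using cont[OF smooth_on_derivative[OF Suc.prems, of i], of "Suc m"]
        by (rule continuous_on_eq) (auto simp: ap)
    qed
    have "((\<lambda>y. integral (cbox 0 1) (\<lambda>t. t ^ m * F (q + t *\<^sub>R (y - q)))) has_derivative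
        blinfun_apply (integral (cbox 0 1) (?fx y))) (at y within ball q r)" if "y \<in> ball q r" for y
    proof (rule leibniz_rule)
      fix x t assume "x \<in> ball q r" "t \<in> cbox 0 (1::real)"
      then show "((\<lambda>y. t ^ m * F (q + t *\<^sub>R (y - q))) has_derivative blinfun_apply (?fx x t)) (at x within ball q r)"
        using dF[of x t] bounded_linear_Blinfun_apply[OF bl[of x t]] has_derivative_at_withinI by auto
    next
      fix x assume x: "x \<in> ball q r"
      have "continuous_on {0..1} (\<lambda>t. t ^ m * F (q + t *\<^sub>R (x - q)))"
        by (intro continuous_intros continuous_on_compose2[OF smooth_on_imp_continuous_on[OF Suc.prems]]) (use seg x in auto)
      then show "(\<lambda>t. t ^ m * F (q + t *\<^sub>R (x - q))) integrable_on cbox 0 1"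
        using integrable_continuous_interval by auto
    qed (use that cb in auto)
    note dW = this
    have D: "((\<lambda>y. integral {0..1} (\<lambda>t. t ^ m * F (q + t *\<^sub>R (y - q)))) has_derivative
        blinfun_apply (integral {0..1} (?fx y))) (at y)" if "y \<in> ball q r" for y
      using dW[OF that] by (simp only: cbox_interval at_within_open[OF that open_ball])
    have bi: "blinfun_apply (integral {0..1} (?fx y)) v =
        integral {0..1} (\<lambda>t. t ^ Suc m * ?F' (q + t *\<^sub>R (y - q)) v)" if "y \<in> ball q r" for y v
    proof -
      have "continuous_on {0..1} (?fx y)"
        using continuous_on_compose2[OF cb, of "{0..1}" "\<lambda>t. (y, t)"] that
        by (simp add: continuous_on_Pair continuous_on_id image_subset_iff)
      then have "blinfun_apply (integral {0..1} (?fx y)) v = integral {0..1} (\<lambda>t. blinfun_apply (?fx y t) v)"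
        by (intro blinfun_apply_integral integrable_continuous_interval)
      also have "\<dots> = integral {0..1} (\<lambda>t. t ^ Suc m * ?F' (q + t *\<^sub>R (y - q)) v)"
        by (rule integral_cong) (simp add: ap[OF that])
      finally show ?thesis .
    qed
    have "Ck_on k (ball q r) (\<lambda>y. blinfun_apply (integral {0..1} (?fx y)) v)" for v
      by (rule Ck_on_cong[OF open_ball bi[symmetric] Suc.IH[OF smooth_on_derivative[OF Suc.prems, of v], of "Suc m"]])
    with D show ?case by (rule Ck_on_Suc[OF open_ball])
  qed
qed

text \<open>Integrate the derivative of \<open>F\<close> along the segment from \<open>q\<close> to
  \<open>y\<close>, and expand its direction \<open>y - q\<close> in \<open>Basis\<close>.\<close>

lemma hadamard:
  fixes F :: "'e::euclidean_space \<Rightarrow> real"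
  assumes "smooth_on (ball q r) F" "r > 0"
  obtains G where "\<And>b. smooth_on (ball q r) (G b)"
    "\<And>y. y \<in> ball q r \<Longrightarrow> F y = F q + (\<Sum>b\<in>Basis. ((y - q) \<bullet> b) * G b y)"
    "\<And>b. G b q = frechet_derivative F (at q) b"
proof
  let ?F' = "\<lambda>x. frechet_derivative F (at x)"
  let ?G = "\<lambda>b y. integral {0..1} (\<lambda>t. t ^ 0 * ?F' (q + t *\<^sub>R (y - q)) b)"
  show "smooth_on (ball q r) (?G b)" for b
    by (rule smooth_on_segment_integral[OF smooth_on_derivative[OF assms(1)] assms(2)])
  show "?G b q = ?F' q b" for b by simp
  fix y assume y: "y \<in> ball q r"
  have seg: "q + t *\<^sub>R (y - q) \<in> ball q r" if "t \<in> {0..1}" for t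
  proof -
    have "(1 - t) *\<^sub>R q + t *\<^sub>R y \<in> ball q r"
      using convexD_alt[OF convex_ball, of q q r y t] assms(2) y that by simp
    then show ?thesis by (simp add: algebra_simps)
  qed
  have F': "(F has_derivative ?F' x) (at x)" if "x \<in> ball q r" for x
    using smooth_on_has_derivative[OF assms(1) open_ball that] .
  have d: "((\<lambda>t. F (q + t *\<^sub>R (y - q))) has_vector_derivative ?F' (q + t *\<^sub>R (y - q)) (y - q)) (at t within {0..1})"
    if "t \<in> {0..1}" for t
  proof -
    have "((\<lambda>t. q + t *\<^sub>R (y - q)) has_derivative (\<lambda>s. s *\<^sub>R (y - q))) (at t)"
      by (auto intro!: derivative_eq_intros)
    from has_derivative_compose[OF this F'[OF seg[OF that]]]
    show ?thesis
      using linear_cmul[OF has_derivative_linear[OF F'[OF seg[OF that]]]]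
      by (auto simp: has_vector_derivative_def intro: has_derivative_at_withinI)
  qed
  have c: "(\<lambda>t. ?F' (q + t *\<^sub>R (y - q)) b) integrable_on {0..1}" for b
  proof (rule integrable_continuous_interval)
    show "continuous_on {0..1} (\<lambda>t. ?F' (q + t *\<^sub>R (y - q)) b)"
      by (intro continuous_intros continuous_on_compose2[OF smooth_on_imp_continuous_on[OF smooth_on_derivative[OF assms(1)]]])
        (use seg in auto)
  qed
  have "((\<lambda>t. ?F' (q + t *\<^sub>R (y - q)) (y - q)) has_integral (F y - F q)) {0..1}"
    using fundamental_theorem_of_calculus[OF _ d] by simp
  then have "F y - F q = integral {0..1} (\<lambda>t. ?F' (q + t *\<^sub>R (y - q)) (y - q))"
    by (simp add: integral_unique)
  also have "\<dots> = integral {0..1} (\<lambda>t. \<Sum>b\<in>Basis. ((y - q) \<bullet> b) * ?F' (q + t *\<^sub>R (y - q)) b)"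
  proof (rule integral_cong)
    fix t :: real assume t: "t \<in> {0..1}"
    note l = has_derivative_linear[OF F'[OF seg[OF t]]]
    have "?F' (q + t *\<^sub>R (y - q)) (y - q) = ?F' (q + t *\<^sub>R (y - q)) (\<Sum>b\<in>Basis. ((y - q) \<bullet> b) *\<^sub>R b)"
      by (simp add: euclidean_representation)
    then show "?F' (q + t *\<^sub>R (y - q)) (y - q) = (\<Sum>b\<in>Basis. ((y - q) \<bullet> b) * ?F' (q + t *\<^sub>R (y - q)) b)"
      by (simp add: linear_sum[OF l] linear_cmul[OF l])
  qed
  also have "\<dots> = (\<Sum>b\<in>Basis. integral {0..1} (\<lambda>t. ((y - q) \<bullet> b) * ?F' (q + t *\<^sub>R (y - q)) b))"
    by (rule integral_sum) (use integrable_on_mult_right[OF c] in auto)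
  finally show "F y = F q + (\<Sum>b\<in>Basis. ((y - q) \<bullet> b) * ?G b y)" by simp
qed

section \<open>Local frames of vector fields\<close>

locale atlas =
  fixes A :: "('a::t2_space, 'e::euclidean_space) chart set"
  assumes smooth_atlas: "smooth_atlas A"
begin

abbreviation "CM \<equiv> smooth_functions A"
abbreviation "XM \<equiv> vfields A"
abbreviation "Tan \<equiv> tangent_space A"

lemma
  assumes "(U, x) \<in> A"
  shows chart_open: "open U" and chart_open_image: "open (x ` U)"
    and chart_inv: "q \<in> U \<Longrightarrow> inv_into U x (x q) = q"
    and chart_continuous: "continuous_on U x"
    and chart_inv_continuous: "continuous_on (x ` U) (inv_into U x)"
  using assms smooth_atlas unfolding smooth_atlas_def homeomorphism_def by blast+

lemma chart_transition:
  "(U, x) \<in> A \<Longrightarrow> (V, y) \<in> A \<Longrightarrow> smooth_on (x ` (U \<inter> V)) (y \<circ> inv_into U x)"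
  using smooth_atlas unfolding smooth_atlas_def by blast

lemma chart_exists: obtains U x where "(U, x) \<in> A" "p \<in> U"
proof -
  have "p \<in> (\<Union>(U, x)\<in>A. U)" using smooth_atlas unfolding smooth_atlas_def by auto
  then show thesis using that by blast
qed

lemma chart_open_image_Int:
  assumes "(U, x) \<in> A" "open W"
  shows "open (x ` (U \<inter> W))"
proof -
  have "x ` (U \<inter> W) = inv_into U x -` W \<inter> x ` U"
    using chart_inv[OF assms(1)] by (auto simp: image_iff)
  then show ?thesis
    using chart_inv_continuous[OF assms(1)] chart_open_image[OF assms(1)] assms(2)
    by (simp add: continuous_on_open_vimage)
qed

lemma smoothD: "f \<in> CM \<Longrightarrow> (U, x) \<in> A \<Longrightarrow> smooth_on (x ` U) (f \<circ> inv_into U x)"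
  unfolding smooth_functions_def by blast

lemma smooth_const [simp]: "(\<lambda>p. c) \<in> CM"
  unfolding smooth_functions_def by (auto simp: o_def intro!: smooth_on_const chart_open_image)

lemma smooth_add [simp, intro]: "f \<in> CM \<Longrightarrow> h \<in> CM \<Longrightarrow> (\<lambda>p. f p + h p) \<in> CM"
  unfolding smooth_functions_def by (auto simp: o_def intro!: smooth_on_add chart_open_image)

lemma smooth_mult [simp, intro]: "f \<in> CM \<Longrightarrow> h \<in> CM \<Longrightarrow> (\<lambda>p. f p * h p) \<in> CM"
  unfolding smooth_functions_def by (auto simp: o_def intro!: smooth_on_mult chart_open_image)

lemma smooth_diff [simp, intro]: "f \<in> CM \<Longrightarrow> h \<in> CM \<Longrightarrow> (\<lambda>p. f p - h p) \<in> CM"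
  unfolding smooth_functions_def by (auto simp: o_def intro!: smooth_on_minus chart_open_image)

lemma smooth_sum [simp, intro]: "(\<And>i. i \<in> I \<Longrightarrow> f i \<in> CM) \<Longrightarrow> (\<lambda>p. \<Sum>i\<in>I. f i p) \<in> CM"
  by (induction I rule: infinite_finite_induct) auto

text \<open>Smoothness is local, but membership in \<open>CM\<close> concerns functions on the whole
  manifold. A local formula for \<open>f\<close> is therefore given by an identity
  \<open>u * f = w\<close> between global functions, where \<open>u\<close> does not vanish at the
  point in question.\<close>

lemma smooth_local_quotient:
  assumes "\<And>p. \<exists>u\<in>CM. \<exists>w\<in>CM. u p \<noteq> 0 \<and> (\<forall>q. u q * f q = w q)"
  shows "f \<in> CM"
  unfolding smooth_functions_def
proof (clarify)
  fix U x assume c: "(U, x) \<in> A"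
  show "smooth_on (x ` U) (f \<circ> inv_into U x)"
  proof (rule smooth_on_local)
    fix y assume y: "y \<in> x ` U"
    obtain u w where uw: "u \<in> CM" "w \<in> CM" "u (inv_into U x y) \<noteq> 0" "\<And>q. u q * f q = w q"
      using assms by blast
    let ?u = "u \<circ> inv_into U x" and ?w = "w \<circ> inv_into U x"
    let ?T = "?u -` (- {0}) \<inter> x ` U"
    have o: "open ?T"
      using smooth_on_imp_continuous_on[OF smoothD[OF uw(1) c]] chart_open_image[OF c]
      by (metis continuous_on_open_vimage open_Compl closed_singleton)
    have "smooth_on ?T (\<lambda>z. ?w z / ?u z)"
      by (intro smooth_on_divide o smooth_on_subset[OF smoothD[OF uw(1) c]] smooth_on_subset[OF smoothD[OF uw(2) c]]) auto
    then have "smooth_on ?T (f \<circ> inv_into U x)"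
      by (rule smooth_on_cong[OF o, rotated]) (simp add: uw(4)[symmetric])
    then show "\<exists>T. open T \<and> y \<in> T \<and> smooth_on T (f \<circ> inv_into U x)"
      using o y uw(3) by (intro exI[of _ ?T]) auto
  qed
qed

text \<open>The support lies in the image of a closed ball. This image is compact, hence closed
  because the manifold is Hausdorff. So every point has a neighbourhood on which the function is
  either given by \<open>F\<close> in the chart or zero.\<close>

lemma smooth_extension:
  assumes c: "(U, x) \<in> A" and F: "smooth_on (ball c r) F" "\<And>y. s \<le> dist y c \<Longrightarrow> F y = 0"
    and sr: "s < r" "ball c r \<subseteq> x ` U"
  shows "(\<lambda>q. if q \<in> U then F (x q) else 0) \<in> CM"
  unfolding smooth_functions_def
proof (clarify)
  let ?f = "\<lambda>q. if q \<in> U then F (x q) else 0"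
  let ?K = "inv_into U x ` cball c s"
  have "cball c s \<subseteq> x ` U" using sr by auto
  then have K: "closed ?K"
    using chart_inv_continuous[OF c] by (intro compact_imp_closed compact_continuous_image) (auto intro: continuous_on_subset)
  fix V y assume d: "(V, y) \<in> A"
  show "smooth_on (y ` V) (?f \<circ> inv_into V y)"
  proof (rule smooth_on_local)
    fix z assume "z \<in> y ` V"
    then obtain q where q: "q \<in> V" "z = y q" by blast
    show "\<exists>T. open T \<and> z \<in> T \<and> smooth_on T (?f \<circ> inv_into V y)"
    proof (cases "q \<in> U \<and> x q \<in> ball c r")
      case True
      let ?W = "x -` ball c r \<inter> U"
      have "open ?W"
        using chart_continuous[OF c] chart_open[OF c] by (simp add: continuous_on_open_vimage)
      then have o: "open (y ` (V \<inter> ?W))" by (rule chart_open_image_Int[OF d])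
      have "smooth_on (y ` (V \<inter> ?W)) (\<lambda>z. F ((x \<circ> inv_into V y) z))"
        by (rule smooth_on_compose[OF o open_ball F(1) smooth_on_subset[OF chart_transition[OF d c]]])
          (use chart_inv[OF d] in auto)
      then have "smooth_on (y ` (V \<inter> ?W)) (?f \<circ> inv_into V y)"
        by (rule smooth_on_cong[OF o, rotated]) (use chart_inv[OF d] in auto)
      then show ?thesis using o True q by blast
    next
      case False
      have "q \<notin> ?K"
      proof
        assume "q \<in> ?K"
        then obtain w where w: "w \<in> cball c s" "q = inv_into U x w" by blast
        then have "w \<in> x ` U" using sr by auto
        then have "q \<in> U" "x q = w" using w by (auto simp: inv_into_into f_inv_into_f)
        then show False using False w sr by auto
      qed
      have o: "open (y ` (V \<inter> - ?K))" by (rule chart_open_image_Int[OF d]) (use K in auto)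
      have z: "?f q' = 0" if "q' \<notin> ?K" for q'
      proof (cases "q' \<in> U")
        case True
        have "x q' \<notin> cball c s" using that chart_inv[OF c True] by (metis image_eqI)
        then show ?thesis using F(2)[of "x q'"] by (simp add: dist_commute)
      qed simp
      have "0 = (?f \<circ> inv_into V y) w" if "w \<in> y ` (V \<inter> - ?K)" for w
      proof -
        obtain q' where "q' \<in> V" "q' \<notin> ?K" "w = y q'" using \<open>w \<in> _\<close> by blast
        then show ?thesis using z[OF \<open>q' \<notin> ?K\<close>] chart_inv[OF d \<open>q' \<in> V\<close>] by (simp only: comp_apply)
      qed
      then have "smooth_on (y ` (V \<inter> - ?K)) (?f \<circ> inv_into V y)"
        by (rule smooth_on_cong[OF o _ smooth_on_const[OF o, of 0]])
      then show ?thesis using o q \<open>q \<notin> ?K\<close> by blast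
    qed
  qed
qed

section \<open>Tangent vectors as derivations of the global smooth functions\<close>

lemma tangent_notin: "v \<in> Tan p \<Longrightarrow> f \<notin> CM \<Longrightarrow> v f = 0"
  unfolding tangent_space_def by blast

lemma tangent_lin: "v \<in> Tan p \<Longrightarrow> f \<in> CM \<Longrightarrow> h \<in> CM \<Longrightarrow> v (\<lambda>q. a * f q + b * h q) = a * v f + b * v h"
  unfolding tangent_space_def lin_on_def by (auto simp: scaleR_fun_def plus_fun_def)

lemma tangent_add: "v \<in> Tan p \<Longrightarrow> f \<in> CM \<Longrightarrow> h \<in> CM \<Longrightarrow> v (\<lambda>q. f q + h q) = v f + v h"
  using tangent_lin[of v p f h 1 1] by simp

lemma tangent_mult: "v \<in> Tan p \<Longrightarrow> f \<in> CM \<Longrightarrow> h \<in> CM \<Longrightarrow> v (\<lambda>q. f q * h q) = f p * v h + h p * v f"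
  unfolding tangent_space_def by (auto simp: times_fun_def)

lemma tangent_const: assumes "v \<in> Tan p" shows "v (\<lambda>q. c) = 0"
proof -
  have "v (\<lambda>q. 1) = 0" using tangent_mult[OF assms smooth_const[of 1] smooth_const[of 1]] by simp
  then show ?thesis using tangent_lin[OF assms smooth_const[of 1] smooth_const[of 1], of c 0] by simp
qed

lemma tangent_diff: "v \<in> Tan p \<Longrightarrow> f \<in> CM \<Longrightarrow> h \<in> CM \<Longrightarrow> v (\<lambda>q. f q - h q) = v f - v h"
  using tangent_lin[of v p f h 1 "-1"] by simp

lemma tangent_sum:
  assumes "v \<in> Tan p" "\<And>i. i \<in> I \<Longrightarrow> f i \<in> CM"
  shows "v (\<lambda>q. \<Sum>i\<in>I. f i q) = (\<Sum>i\<in>I. v (f i))"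
  using assms(2)
  by (induction I rule: infinite_finite_induct) (auto simp: tangent_const[OF assms(1)] tangent_add[OF assms(1)])

text \<open>A derivation accepts only global functions, so the coordinates enter through functions
  \<open>h b\<close> that agree with them near \<open>q\<close>. Hadamard's expansion of
  \<open>f - f q\<close> is multiplied with cut-offs until it is an identity on the whole manifold;
  then the product rule at \<open>q\<close> leaves the values of the coefficients at
  \<open>q\<close>.\<close>

lemma tangent_in_coordinates:
  assumes c: "(U, x) \<in> A" and q: "q \<in> U" and e: "e > 0" "ball (x q) e \<subseteq> x ` U"
    and h: "\<And>b. h b \<in> CM" "\<And>b q'. q' \<in> U \<Longrightarrow> x q' \<in> ball (x q) e \<Longrightarrow> h b q' = x q' \<bullet> b"
    and v: "v \<in> Tan q" and f: "f \<in> CM"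
  shows "v f = (\<Sum>b\<in>Basis. v (h b) * frechet_derivative (f \<circ> inv_into U x) (at (x q)) b)"
proof -
  let ?F = "f \<circ> inv_into U x"
  have F: "smooth_on (ball (x q) e) ?F" by (rule smooth_on_subset[OF smoothD[OF f c] e(2)])
  obtain G where G: "\<And>b. smooth_on (ball (x q) e) (G b)"
    "\<And>y. y \<in> ball (x q) e \<Longrightarrow> ?F y = ?F (x q) + (\<Sum>b\<in>Basis. ((y - x q) \<bullet> b) * G b y)"
    "\<And>b. G b (x q) = frechet_derivative ?F (at (x q)) b"
    using hadamard[OF F e(1)] by blast
  obtain \<beta> where \<beta>: "smooth_on UNIV \<beta>" "\<And>y. dist y (x q) \<le> e / 3 \<Longrightarrow> \<beta> y = (1::real)"
    "\<And>y. dist y (x q) \<ge> e / 2 \<Longrightarrow> \<beta> y = 0"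
    by (rule smooth_bump[of "e / 3" "e / 2" "x q"]) (use e in auto)
  have \<beta>': "smooth_on (ball (x q) e) \<beta>" using smooth_on_subset[OF \<beta>(1)] by blast
  define \<kappa> where "\<kappa> = (\<lambda>q'. if q' \<in> U then \<beta> (x q') else 0)"
  define \<gamma> where "\<gamma> b = (\<lambda>q'. if q' \<in> U then \<beta> (x q') * G b (x q') else 0)" for b
  have \<kappa>: "\<kappa> \<in> CM" unfolding \<kappa>_def
    by (rule smooth_extension[OF c \<beta>' \<beta>(3), of "e/2"]) (use e in auto)
  have \<gamma>: "\<gamma> b \<in> CM" for b unfolding \<gamma>_def
    by (rule smooth_extension[OF c smooth_on_mult[OF open_ball \<beta>' G(1)], of "e/2"]) (use e \<beta>(3) in auto)
  have q1: "\<kappa> q = 1" "\<gamma> b q = G b (x q)" for b using q \<beta>(2) e by (auto simp: \<kappa>_def \<gamma>_def)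
  \<comment> \<open>Two factors \<kappa>: one makes the difference of coordinates global, the other
    is absorbed into the coefficient \<gamma> b.\<close>
  have eq: "\<kappa> q' * \<kappa> q' * (f q' - f q) = (\<Sum>b\<in>Basis. \<kappa> q' * (h b q' - h b q) * \<gamma> b q')" for q'
  proof (cases "q' \<in> U \<and> x q' \<in> ball (x q) e")
    case True
    then have "f q' = f q + (\<Sum>b\<in>Basis. ((x q' - x q) \<bullet> b) * G b (x q'))"
      using G(2)[of "x q'"] chart_inv[OF c] q by simp
    moreover have "h b q' - h b q = (x q' - x q) \<bullet> b" for b
      using h(2)[of q' b] h(2)[of q b] True q e(1) by (simp add: inner_diff_left)
    ultimately show ?thesis
      using True by (simp add: \<kappa>_def \<gamma>_def sum_distrib_left mult_ac)
  next
    case False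
    then have "\<kappa> q' = 0" using \<beta>(3)[of "x q'"] e(1) by (auto simp: \<kappa>_def dist_commute)
    then show ?thesis by simp
  qed
  have "v f = v (\<lambda>q'. \<kappa> q' * \<kappa> q' * (f q' - f q))"
    using \<kappa> f by (simp add: tangent_mult[OF v, of "\<lambda>q'. \<kappa> q' * \<kappa> q'"] tangent_diff[OF v] tangent_const[OF v] q1)
  also have "\<dots> = (\<Sum>b\<in>Basis. v (\<lambda>q'. \<kappa> q' * (h b q' - h b q) * \<gamma> b q'))"
    unfolding eq using \<kappa> \<gamma> h(1) by (simp add: tangent_sum[OF v])
  also have "\<dots> = (\<Sum>b\<in>Basis. v (h b) * G b (x q))"
  proof (rule sum.cong[OF refl])
    fix b
    have "v (\<lambda>q'. \<kappa> q' * (h b q' - h b q) * \<gamma> b q') = G b (x q) * v (\<lambda>q'. \<kappa> q' * (h b q' - h b q))"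
      using \<kappa> \<gamma> h(1) by (simp add: tangent_mult[OF v, of "\<lambda>q'. \<kappa> q' * (h b q' - h b q)"] q1)
    also have "v (\<lambda>q'. \<kappa> q' * (h b q' - h b q)) = v (h b)"
      using \<kappa> h(1) by (simp add: tangent_mult[OF v, of \<kappa>] tangent_diff[OF v] tangent_const[OF v] q1)
    finally show "v (\<lambda>q'. \<kappa> q' * (h b q' - h b q) * \<gamma> b q') = v (h b) * G b (x q)" by simp
  qed
  finally show ?thesis by (simp add: G(3))
qed

text \<open>The fields \<open>E b\<close> are coordinate fields times the cut-off \<kappa>, and
  \<open>h b\<close> are coordinates cut off by a wider bump function that is 1 on the support of
  \<kappa>. So the last identity holds at every point of the manifold, not only near
  \<open>p\<close>, and it can be fed into maps that are linear over \<open>CM\<close>.\<close>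

lemma local_frame:
  obtains \<kappa> h E where "\<kappa> \<in> CM" "\<And>b. h b \<in> CM" "\<And>b. E b \<in> XM" "\<kappa> p = 1"
    "\<And>b c. b \<in> Basis \<Longrightarrow> c \<in> Basis \<Longrightarrow> E b p (h (c::'e)) = (if b = c then 1 else 0)"
    "\<And>q v. v \<in> Tan q \<Longrightarrow> \<kappa> q *\<^sub>R v = (\<Sum>b\<in>Basis. v (h b) *\<^sub>R E b q)"
proof -
  obtain U x where c: "(U, x) \<in> A" and p: "p \<in> U" by (rule chart_exists)
  have "open (x ` U)" "x p \<in> x ` U" using chart_open_image[OF c] p by auto
  then obtain R where R: "R > 0" "ball (x p) R \<subseteq> x ` U" using openE by blast
  obtain \<beta> where \<beta>: "smooth_on UNIV \<beta>" "\<And>y. dist y (x p) \<le> R / 2 \<Longrightarrow> \<beta> y = (1::real)"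
    "\<And>y. dist y (x p) \<ge> 3 * R / 4 \<Longrightarrow> \<beta> y = 0"
    by (rule smooth_bump[of "R / 2" "3 * R / 4" "x p"]) (use R in auto)
  obtain \<zeta> where \<zeta>: "smooth_on UNIV \<zeta>" "\<And>y. dist y (x p) \<le> R / 8 \<Longrightarrow> \<zeta> y = (1::real)"
    "\<And>y. dist y (x p) \<ge> R / 4 \<Longrightarrow> \<zeta> y = 0"
    by (rule smooth_bump[of "R / 8" "R / 4" "x p"]) (use R in auto)
  have s: "smooth_on (ball (x p) R) \<beta>" "smooth_on (ball (x p) R) \<zeta>"
    using smooth_on_subset[OF \<beta>(1)] smooth_on_subset[OF \<zeta>(1)] by blast+
  define \<kappa> where "\<kappa> = (\<lambda>q. if q \<in> U then \<zeta> (x q) else 0)"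
  define h where "h b = (\<lambda>q. if q \<in> U then \<beta> (x q) * (x q \<bullet> b) else 0)" for b
  let ?D = "\<lambda>f y. frechet_derivative (f \<circ> inv_into U x) (at y)"
  define E where "E b = (\<lambda>q f. if f \<in> CM \<and> q \<in> U then \<zeta> (x q) * ?D f (x q) b else 0)" for b
  have \<kappa>: "\<kappa> \<in> CM" unfolding \<kappa>_def
    by (rule smooth_extension[OF c s(2), of "R / 4"]) (use R \<zeta>(3) in auto)
  have h: "h b \<in> CM" for b unfolding h_def
    by (rule smooth_extension[OF c smooth_on_mult[OF open_ball s(1) smooth_on_linear[OF open_ball bounded_linear_inner_left]], of "3 * R / 4"])
      (use R \<beta>(3) in auto)
  have D: "((f \<circ> inv_into U x) has_derivative ?D f (x q)) (at (x q))" if "f \<in> CM" "q \<in> U" for f q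
    using smooth_on_has_derivative[OF smoothD[OF that(1) c] chart_open_image[OF c]] that(2) by blast
  have E: "E b \<in> XM" for b
  proof -
    have "E b q \<in> Tan q" for q
      unfolding tangent_space_def lin_on_def
    proof (intro CollectI conjI ballI allI impI)
      show "E b q f = 0" if "f \<notin> CM" for f using that by (simp add: E_def)
      fix f k assume fk: "f \<in> CM" "k \<in> CM"
      show "E b q (r *\<^sub>R f + t *\<^sub>R k) = r *\<^sub>R E b q f + t *\<^sub>R E b q k" for r t
      proof (cases "q \<in> U")
        case True
        have "r *\<^sub>R f + t *\<^sub>R k = (\<lambda>q. r * f q + t * k q)" by (simp add: fun_eq_iff)
        moreover have "((\<lambda>q. r * f q + t * k q) \<circ> inv_into U x has_derivative
            (\<lambda>v. r * ?D f (x q) v + t * ?D k (x q) v)) (at (x q))"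
          using D[OF fk(1) True] D[OF fk(2) True] unfolding o_def
          by (intro has_derivative_add has_derivative_mult_right)
        from frechet_derivative_at[OF this] have "?D (\<lambda>q. r * f q + t * k q) (x q) b = r * ?D f (x q) b + t * ?D k (x q) b"
          by metis
        ultimately show ?thesis using fk True by (simp add: E_def algebra_simps)
      qed (simp add: E_def)
      show "E b q (f * k) = f q * E b q k + k q * E b q f"
      proof (cases "q \<in> U")
        case True
        have "f * k = (\<lambda>q. f q * k q)" by (simp add: fun_eq_iff)
        moreover have "((\<lambda>q. f q * k q) \<circ> inv_into U x has_derivative
            (\<lambda>v. f q * ?D k (x q) v + ?D f (x q) v * k q)) (at (x q))"
          using has_derivative_mult[OF D[OF fk(1) True] D[OF fk(2) True]] chart_inv[OF c True] by (simp add: o_def)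
        from frechet_derivative_at[OF this] have "?D (\<lambda>q. f q * k q) (x q) b = f q * ?D k (x q) b + ?D f (x q) b * k q"
          by metis
        ultimately show ?thesis using fk True by (simp add: E_def algebra_simps)
      qed (simp add: E_def)
    qed
    moreover have "(\<lambda>q. E b q f) \<in> CM" if f: "f \<in> CM" for f
    proof -
      have "(\<lambda>q. if q \<in> U then (\<lambda>y. \<zeta> y * ?D f y b) (x q) else 0) \<in> CM"
        by (rule smooth_extension[OF c smooth_on_mult[OF open_ball s(2) smooth_on_derivative[OF smooth_on_subset[OF smoothD[OF f c] R(2)]]], of "R / 4"])
          (use R \<zeta>(3) in auto)
      then show ?thesis using f by (simp add: E_def)
    qed
    ultimately show ?thesis unfolding vfields_def by blast
  qed
  have "\<kappa> p = 1" using p \<zeta>(2) R by (simp add: \<kappa>_def)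
  moreover have "E b p (h c') = (if b = c' then 1 else 0)" if "b \<in> Basis" "c' \<in> Basis" for b c'
  proof -
    have hc: "(h c' \<circ> inv_into U x) y = y \<bullet> c'" if "y \<in> ball (x p) (R/2)" for y
    proof -
      have "y \<in> x ` U" using that R by auto
      then show ?thesis
        using that \<beta>(2)[of y] by (simp add: h_def inv_into_into f_inv_into_f dist_commute)
    qed
    have "((\<lambda>y. y \<bullet> c') has_derivative (\<lambda>v. v \<bullet> c')) (at (x p))"
      by (auto intro!: derivative_eq_intros)
    then have "((h c' \<circ> inv_into U x) has_derivative (\<lambda>v. v \<bullet> c')) (at (x p))"
      by (rule has_derivative_transform_within_open[of _ _ _ _ "ball (x p) (R/2)"]) (use R hc in auto)
    from frechet_derivative_at[OF this] have "?D (h c') (x p) b = b \<bullet> c'" by metis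
    then show ?thesis using p h \<zeta>(2) R that by (simp add: E_def inner_Basis)
  qed
  moreover have "\<kappa> q *\<^sub>R v = (\<Sum>b\<in>Basis. v (h b) *\<^sub>R E b q)" if v: "v \<in> Tan q" for q v
  proof
    fix f
    have ap: "(\<Sum>b\<in>Basis. v (h b) *\<^sub>R E b q) f = (\<Sum>b\<in>Basis. v (h b) * E b q f)"
    proof -
      have "sum g I f = (\<Sum>b\<in>I. g b f)" for g :: "'e \<Rightarrow> ('a \<Rightarrow> real) \<Rightarrow> real" and I
        by (induction I rule: infinite_finite_induct) auto
      then show ?thesis by simp
    qed
    show "(\<kappa> q *\<^sub>R v) f = (\<Sum>b\<in>Basis. v (h b) *\<^sub>R E b q) f"
    proof (cases "f \<in> CM \<and> q \<in> U \<and> dist (x q) (x p) < R / 4")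
      case True
      \<comment> \<open>Within R/2 of \<open>x p\<close> the functions \<open>h b\<close> are the
        coordinates. The narrow cut-off lives within R/4, so each point of its support keeps a ball
        of radius R/4 on which this is so.\<close>
      have b: "ball (x q) (R/4) \<subseteq> ball (x p) (R/2)"
      proof
        fix y assume "y \<in> ball (x q) (R/4)"
        then show "y \<in> ball (x p) (R/2)" using True dist_triangle[of "x p" y "x q"] by (simp add: dist_commute)
      qed
      have "v f = (\<Sum>b\<in>Basis. v (h b) * ?D f (x q) b)"
      proof (rule tangent_in_coordinates[OF c _ _ _ h _ v])
        have "ball (x p) (R/2) \<subseteq> ball (x p) R" using R by (intro subset_ball) simp
        then show "ball (x q) (R/4) \<subseteq> x ` U" using b R by blast
        show "h b q' = x q' \<bullet> b" if "q' \<in> U" "x q' \<in> ball (x q) (R/4)" for b q'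
        proof -
          have "x q' \<in> ball (x p) (R/2)" using that(2) b by blast
          then show ?thesis using that(1) \<beta>(2)[of "x q'"] by (simp add: h_def dist_commute)
        qed
      qed (use True R in auto)
      then show ?thesis using True unfolding ap by (simp add: \<kappa>_def E_def sum_distrib_left mult_ac)
    next
      case False
      then have "\<kappa> q * v f = 0" "E b q f = 0" for b
        using tangent_notin[OF v, of f] \<zeta>(3)[of "x q"] by (auto simp: \<kappa>_def E_def)
      then show ?thesis unfolding ap by simp
    qed
  qed
  ultimately show thesis by (rule that[of \<kappa> h E, OF \<kappa> h E])
qed

end

section \<open>Alternating maps and the Lie algebra of vector fields\<close>

lemma tuples_0 [simp]: "tuples 0 V = {[]}"
  by (auto simp: tuples_def)

lemma Cons_in_tuples [simp]: "x # r \<in> tuples (Suc k) V \<longleftrightarrow> x \<in> V \<and> r \<in> tuples k V"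
  by (auto simp: tuples_def)

lemma tuples_SucE:
  assumes "r \<in> tuples (Suc k) V" obtains x r' where "r = x # r'" "x \<in> V" "r' \<in> tuples k V"
  using assms by (cases r) (auto simp: tuples_def)

lemma tuples_update [simp]: "r \<in> tuples k V \<Longrightarrow> x \<in> V \<Longrightarrow> r[i := x] \<in> tuples k V"
  using set_update_subset_insert[of r i x] by (auto simp: tuples_def)

lemma tuples_nth: "r \<in> tuples k V \<Longrightarrow> i < k \<Longrightarrow> r ! i \<in> V"
  by (auto simp: tuples_def)

lemma tuples_length: "r \<in> tuples k V \<Longrightarrow> length r = k"
  by (auto simp: tuples_def)

lemma omit_0 [simp]: "omit 0 (x # r) = r"
  by (simp add: omit_def)

lemma omit_Suc [simp]: "omit (Suc i) (x # r) = x # omit i r"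
  by (simp add: omit_def)

lemma tuples_omit: "r \<in> tuples (Suc k) V \<Longrightarrow> i \<le> k \<Longrightarrow> omit i r \<in> tuples k V"
proof (induction k arbitrary: r i)
  case 0
  then show ?case by (auto elim!: tuples_SucE)
next
  case (Suc k)
  then show ?case by (cases i) (auto elim!: tuples_SucE[of r])
qed

text \<open>Alternating maps by recursion on the number of arguments; \<open>H\<close> is the notion of linearity in one
  argument.\<close>

primrec alt_rec ::
    "'x set \<Rightarrow> 's::zero set \<Rightarrow> (('x \<Rightarrow> 's) \<Rightarrow> bool) \<Rightarrow> nat \<Rightarrow> ('x list \<Rightarrow> 's) \<Rightarrow> bool" where
  "alt_rec V S H 0 T \<longleftrightarrow> T [] \<in> S"
| "alt_rec V S H (Suc k) T \<longleftrightarrow>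
     (\<forall>x\<in>V. alt_rec V S H k (\<lambda>r. T (x # r))) \<and>
     (\<forall>r\<in>tuples k V. H (\<lambda>x. T (x # r))) \<and>
     (\<forall>x r. x # r \<in> tuples k V \<longrightarrow> T (x # x # r) = 0)"

lemma alt_rec_swap:
  fixes T :: "'x::ab_group_add list \<Rightarrow> 's::ab_group_add"
  assumes "alt_rec V S H (Suc (Suc k)) T" "x \<in> V" "y \<in> V" "r \<in> tuples k V"
    and V: "\<And>x y. x \<in> V \<Longrightarrow> y \<in> V \<Longrightarrow> x + y \<in> V"
    and H: "\<And>G x y. H G \<Longrightarrow> x \<in> V \<Longrightarrow> y \<in> V \<Longrightarrow> G (x + y) = G x + G y"
  shows "T (x # y # r) = - T (y # x # r)"
proof -
  have h: "T ((a + b) # c # r) = T (a # c # r) + T (b # c # r)" if "a \<in> V" "b \<in> V" "c \<in> V" for a b c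
    using assms(1,4) that H[of "\<lambda>x. T (x # c # r)" a b] by simp
  have h': "T (c # (a + b) # r) = T (c # a # r) + T (c # b # r)" if "a \<in> V" "b \<in> V" "c \<in> V" for a b c
    using assms(1,4) that H[of "\<lambda>x. T (c # x # r)" a b] by simp
  have z: "T (a # a # r) = 0" if "a \<in> V" for a using assms(1,4) that by simp
  have "0 = T ((x + y) # (x + y) # r)" using z V assms by simp
  also have "\<dots> = T (x # (x + y) # r) + T (y # (x + y) # r)"
    by (rule h) (use V assms(2,3) in auto)
  also have "\<dots> = T (x # y # r) + T (y # x # r)"
    using assms(2,3) by (simp add: h' z)
  finally show ?thesis by (metis add_eq_0_iff2)
qed

text \<open>The recursive form asks for zeros only if two adjacent arguments agree. An equal
  argument further down in the list is handled by swapping the first two arguments and using the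
  induction hypothesis.\<close>

lemma alt_rec_iff:
  fixes T :: "'x::ab_group_add list \<Rightarrow> 's::ab_group_add"
  assumes V: "\<And>x y. x \<in> V \<Longrightarrow> y \<in> V \<Longrightarrow> x + y \<in> V"
    and H: "\<And>G x y. H G \<Longrightarrow> x \<in> V \<Longrightarrow> y \<in> V \<Longrightarrow> G (x + y) = G x + G y"
    and ne: "V \<noteq> {}"
  shows "alt_rec V S H k T \<longleftrightarrow> (\<forall>r\<in>tuples k V. T r \<in> S) \<and>
    (\<forall>r\<in>tuples k V. \<forall>i<k. H (\<lambda>x. T (r[i := x]))) \<and>
    (\<forall>r\<in>tuples k V. \<not> distinct r \<longrightarrow> T r = 0)" (is "_ \<longleftrightarrow> ?R k T")
proof
  show "alt_rec V S H k T \<Longrightarrow> ?R k T"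
  proof (induction k arbitrary: T)
    case (Suc k)
    have IH: "?R k (\<lambda>r. T (x # r))" if "x \<in> V" for x
      using Suc.IH[of "\<lambda>r. T (x # r)"] Suc.prems that by simp
    have h: "H (\<lambda>x. T (x # r))" if "r \<in> tuples k V" for r using Suc.prems that by auto
    have z: "T (x # r) = 0" if xr: "x \<in> V" "r \<in> tuples k V" "x \<in> set r" for x r
    proof -
      obtain j y r' where j: "k = Suc j" "r = y # r'" "y \<in> V" "r' \<in> tuples j V"
        using xr by (cases k) (auto elim!: tuples_SucE)
      show ?thesis
      proof (cases "x = y")
        case True
        then show ?thesis using Suc.prems j by auto
      next
        case False
        then have "T (y # x # r') = 0" using IH[OF j(3)] xr j by auto
        moreover have "T (x # y # r') = - T (y # x # r')"
          by (rule alt_rec_swap[where V = V and H = H]) (use Suc.prems j xr V H in auto)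
        ultimately show ?thesis using j by simp
      qed
    qed
    show ?case
    proof (intro conjI ballI allI impI)
      fix r i assume r: "r \<in> tuples (Suc k) V" and i: "i < Suc k"
      then show "H (\<lambda>x. T (r[i := x]))"
        using IH h by (cases i) (auto elim!: tuples_SucE)
    next
      fix r assume "r \<in> tuples (Suc k) V" "\<not> distinct r"
      then show "T r = 0" using IH z by (auto elim!: tuples_SucE)
    qed (use IH in \<open>auto elim!: tuples_SucE\<close>)
  qed auto
next
  show "?R k T \<Longrightarrow> alt_rec V S H k T"
  proof (induction k arbitrary: T)
    case (Suc k)
    have "alt_rec V S H k (\<lambda>r. T (x # r))" if x: "x \<in> V" for x
    proof (rule Suc.IH, intro conjI ballI allI impI)
      fix r i assume "r \<in> tuples k V" "i < k"
      then have "H (\<lambda>y. T ((x # r)[Suc i := y]))" using Suc.prems x by (metis Cons_in_tuples Suc_mono)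
      then show "H (\<lambda>y. T (x # r[i := y]))" by simp
    qed (use Suc.prems x in auto)
    moreover have "H (\<lambda>x. T (x # r))" if "r \<in> tuples k V" for r
    proof -
      \<comment> \<open>Any element will do, as slot 0 is overwritten.\<close>
      obtain x where "x \<in> V" using ne by blast
      then have "H (\<lambda>y. T ((x # r)[0 := y]))" using Suc.prems that by (metis Cons_in_tuples zero_less_Suc)
      then show ?thesis by simp
    qed
    moreover have "T (x # x # r) = 0" if "x # r \<in> tuples k V" for x r
    proof -
      have "x \<in> V" using that by (auto simp: tuples_def)
      then show ?thesis using Suc.prems that by auto
    qed
    ultimately show ?case by simp
  qed auto
qed

text \<open>Cartan calculus for maps on lists of vector fields: the Lie derivative, and the exterior derivative
  through \<open>\<iota>\<^sub>\<xi> d = L\<^sub>\<xi> - d \<iota>\<^sub>\<xi>\<close>.\<close>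

primrec lie :: "('a vfield \<Rightarrow> 's \<Rightarrow> 's::ab_group_add) \<Rightarrow> 'a vfield \<Rightarrow> 'a vfield list \<Rightarrow> ('a vfield list \<Rightarrow> 's) \<Rightarrow> 's" where
  "lie D \<xi> [] T = D \<xi> (T [])"
| "lie D \<xi> (\<zeta> # r) T = lie D \<xi> r (\<lambda>r. T (\<zeta> # r)) - T (bracket \<xi> \<zeta> # r)"

primrec ed :: "('a vfield \<Rightarrow> 's \<Rightarrow> 's::ab_group_add) \<Rightarrow> 'a vfield list \<Rightarrow> ('a vfield list \<Rightarrow> 's) \<Rightarrow> 's" where
  "ed D [] T = 0"
| "ed D (\<xi> # r) T = lie D \<xi> r T - ed D r (\<lambda>r. T (\<xi> # r))"

definition fsc :: "('a \<Rightarrow> real) \<Rightarrow> ('a \<Rightarrow> 'v::real_vector) \<Rightarrow> 'a \<Rightarrow> 'v" (infixr "\<odot>" 75) where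
  "f \<odot> s = (\<lambda>p. f p *\<^sub>R s p)"

lemma fsc_apply [simp]: "(f \<odot> s) p = f p *\<^sub>R s p"
  by (simp add: fsc_def)

lemma fsc_add: "f \<odot> (s + t) = f \<odot> s + f \<odot> t"
  by (simp add: fun_eq_iff scaleR_add_right)

lemma fsc_diff: "f \<odot> (s - t) = f \<odot> s - f \<odot> t"
  by (simp add: fun_eq_iff scaleR_diff_right)

lemma fsc_const: "(\<lambda>p. c) \<odot> s = c *\<^sub>R s"
  by (simp add: fun_eq_iff)

lemma fsc_0 [simp]: "f \<odot> 0 = (0 :: 'a \<Rightarrow> 'v::real_vector)"
  by (simp add: fun_eq_iff)

lemma fsc_commute: "f \<odot> h \<odot> s = h \<odot> f \<odot> s"
  by (simp add: fun_eq_iff mult.commute)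

context atlas
begin

section \<open>The module and the Lie algebra of vector fields\<close>

lemma tangent_subspace: "subspace (Tan p)"
  unfolding subspace_def tangent_space_def lin_on_def by (auto simp: algebra_simps)

lemma XM_tangent: "\<xi> \<in> XM \<Longrightarrow> \<xi> p \<in> Tan p"
  unfolding vfields_def by blast

lemma XM_smooth [simp, intro]: assumes "\<xi> \<in> XM" shows "(\<lambda>q. \<xi> q f) \<in> CM"
proof (cases "f \<in> CM")
  case False
  then show ?thesis using tangent_notin[OF XM_tangent[OF assms]] by simp
qed (use assms in \<open>simp add: vfields_def\<close>)

lemma XM_I:
  "(\<And>p. \<xi> p \<in> Tan p) \<Longrightarrow> (\<And>f. f \<in> CM \<Longrightarrow> (\<lambda>p. \<xi> p f) \<in> CM) \<Longrightarrow> \<xi> \<in> XM"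
  unfolding vfields_def by blast

lemma XM_add [simp, intro]: "\<xi> \<in> XM \<Longrightarrow> \<eta> \<in> XM \<Longrightarrow> \<xi> + \<eta> \<in> XM"
  by (rule XM_I) (auto intro: subspace_add[OF tangent_subspace] XM_tangent)

lemma XM_fsc [simp, intro]: "f \<in> CM \<Longrightarrow> \<xi> \<in> XM \<Longrightarrow> f \<odot> \<xi> \<in> XM"
  by (rule XM_I) (auto intro: subspace_scale[OF tangent_subspace] XM_tangent)

lemma XM_0 [simp, intro]: "0 \<in> XM"
  by (rule XM_I) (auto intro: subspace_0[OF tangent_subspace])

lemma XM_scaleR [simp, intro]: "\<xi> \<in> XM \<Longrightarrow> c *\<^sub>R \<xi> \<in> XM"
  using XM_fsc[OF smooth_const] by (simp add: fsc_const)

lemma XM_diff [simp, intro]: "\<xi> \<in> XM \<Longrightarrow> \<eta> \<in> XM \<Longrightarrow> \<xi> - \<eta> \<in> XM"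
  using XM_add[of \<xi> "(-1) *\<^sub>R \<eta>"] XM_scaleR[of \<eta> "-1"]
  unfolding scaleR_minus1_left by (simp only: diff_conv_add_uminus)

lemma XM_sum [simp, intro]: "(\<And>i. i \<in> I \<Longrightarrow> \<xi> i \<in> XM) \<Longrightarrow> (\<Sum>i\<in>I. \<xi> i) \<in> XM"
  by (induction I rule: infinite_finite_induct) auto

lemma XM_nonempty: "XM \<noteq> {}"
  using XM_0 by blast

lemma bracket_apply: "bracket \<xi> \<eta> p f = \<xi> p (\<lambda>q. \<eta> q f) - \<eta> p (\<lambda>q. \<xi> q f)"
  by (simp add: bracket_def)

lemma bracket_XM [simp, intro]:
  assumes x: "\<xi> \<in> XM" and e: "\<eta> \<in> XM" shows "bracket \<xi> \<eta> \<in> XM"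
proof (rule XM_I)
  fix p
  note t = XM_tangent[OF x, of p] XM_tangent[OF e, of p]
  note t' = XM_tangent[OF x] XM_tangent[OF e]
  show "bracket \<xi> \<eta> p \<in> Tan p"
    unfolding tangent_space_def lin_on_def
  proof (intro CollectI conjI ballI allI impI)
    show "bracket \<xi> \<eta> p f = 0" if "f \<notin> CM" for f
      by (simp add: bracket_apply tangent_notin[OF t'(1) that] tangent_notin[OF t'(2) that] tangent_const[OF t(1)] tangent_const[OF t(2)])
    fix f h assume fh: "f \<in> CM" "h \<in> CM"
    have c: "a *\<^sub>R f + b *\<^sub>R h = (\<lambda>q. a * f q + b * h q)" for a b by (simp add: fun_eq_iff)
    show "bracket \<xi> \<eta> p (a *\<^sub>R f + b *\<^sub>R h) = a *\<^sub>R bracket \<xi> \<eta> p f + b *\<^sub>R bracket \<xi> \<eta> p h" for a b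
      unfolding c bracket_apply tangent_lin[OF t'(1) fh] tangent_lin[OF t'(2) fh]
      using x e by (simp add: tangent_lin[OF t(1)] tangent_lin[OF t(2)] algebra_simps)
    have m: "f * h = (\<lambda>q. f q * h q)" by (simp add: fun_eq_iff)
    show "bracket \<xi> \<eta> p (f * h) = f p * bracket \<xi> \<eta> p h + h p * bracket \<xi> \<eta> p f"
      unfolding m bracket_apply tangent_mult[OF t'(1) fh] tangent_mult[OF t'(2) fh]
      using x e fh by (simp add: tangent_add[OF t(1)] tangent_add[OF t(2)] tangent_mult[OF t(1)] tangent_mult[OF t(2)] algebra_simps)
  qed
next
  show "(\<lambda>p. bracket \<xi> \<eta> p f) \<in> CM" if "f \<in> CM" for f
    unfolding bracket_apply using x e by simp
qed

lemma bracket_self [simp]: "bracket \<xi> \<xi> = 0"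
  by (simp add: fun_eq_iff bracket_apply)

lemma bracket_anti: "bracket \<xi> \<eta> = - bracket \<eta> \<xi>"
  by (simp add: fun_eq_iff bracket_apply)

lemma
  assumes x: "\<xi> \<in> XM" and e: "\<eta> \<in> XM" and z: "\<zeta> \<in> XM"
  shows bracket_add_right: "bracket \<xi> (\<eta> + \<zeta>) = bracket \<xi> \<eta> + bracket \<xi> \<zeta>"
    and bracket_add_left: "bracket (\<eta> + \<zeta>) \<xi> = bracket \<eta> \<xi> + bracket \<zeta> \<xi>"
    and bracket_jacobi: "bracket \<xi> (bracket \<eta> \<zeta>) - bracket \<eta> (bracket \<xi> \<zeta>) = bracket (bracket \<xi> \<eta>) \<zeta>"
    and bracket_fsc_right: "f \<in> CM \<Longrightarrow> bracket \<xi> (f \<odot> \<eta>) = f \<odot> bracket \<xi> \<eta> + (\<lambda>p. \<xi> p f) \<odot> \<eta>"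
  using x e z
  by (simp_all add: fun_eq_iff bracket_apply tangent_add[OF XM_tangent[OF x]] tangent_diff[OF XM_tangent[OF x]]
      tangent_diff[OF XM_tangent[OF e]] tangent_diff[OF XM_tangent[OF z]] tangent_mult[OF XM_tangent[OF x]] algebra_simps)

text \<open>The frame expansion of \<open>v\<close> with its coefficients frozen; at
  \<open>p\<close> the cut-off is 1.\<close>

lemma vfield_through:
  assumes "v \<in> Tan p" obtains \<xi> where "\<xi> \<in> XM" "\<xi> p = v"
proof -
  obtain \<kappa> h and E :: "'e \<Rightarrow> _" where E: "\<And>b. E b \<in> XM" "\<kappa> p = 1" "\<And>q v. v \<in> Tan q \<Longrightarrow> \<kappa> q *\<^sub>R v = (\<Sum>b\<in>Basis. v (h b) *\<^sub>R E b q)"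
    by (rule local_frame[of p]) blast
  have s: "(\<Sum>i\<in>I. G i) p = (\<Sum>i\<in>I. G i p)" for G :: "'e \<Rightarrow> 'a vfield" and I
    by (induction I rule: infinite_finite_induct) auto
  show thesis
    by (rule that[of "\<Sum>b\<in>Basis. v (h b) *\<^sub>R E b"]) (use E(1,2) E(3)[OF assms] in \<open>auto simp: s\<close>)
qed

text \<open>The values lie in an arbitrary vector space, so that one notion serves real functions
  and sections of all the bundles. Linearity over \<open>CM\<close>, and not merely over the reals,
  is what makes a map a tensor.\<close>

definition fun_lin :: "('a vfield \<Rightarrow> 'a \<Rightarrow> 'v::real_vector) \<Rightarrow> bool" where
  "fun_lin G \<longleftrightarrow> (\<forall>\<xi>\<in>XM. \<forall>\<eta>\<in>XM. G (\<xi> + \<eta>) = G \<xi> + G \<eta>) \<and> (\<forall>f\<in>CM. \<forall>\<xi>\<in>XM. G (f \<odot> \<xi>) = f \<odot> G \<xi>)"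

lemma fun_linI:
  "(\<And>\<xi> \<eta>. \<xi> \<in> XM \<Longrightarrow> \<eta> \<in> XM \<Longrightarrow> G (\<xi> + \<eta>) = G \<xi> + G \<eta>) \<Longrightarrow>
   (\<And>f \<xi>. f \<in> CM \<Longrightarrow> \<xi> \<in> XM \<Longrightarrow> G (f \<odot> \<xi>) = f \<odot> G \<xi>) \<Longrightarrow> fun_lin G"
  unfolding fun_lin_def by blast

lemma fun_lin_add: "fun_lin G \<Longrightarrow> \<xi> \<in> XM \<Longrightarrow> \<eta> \<in> XM \<Longrightarrow> G (\<xi> + \<eta>) = G \<xi> + G \<eta>"
  unfolding fun_lin_def by blast

lemma fun_lin_fsc: "fun_lin G \<Longrightarrow> f \<in> CM \<Longrightarrow> \<xi> \<in> XM \<Longrightarrow> G (f \<odot> \<xi>) = f \<odot> G \<xi>"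
  unfolding fun_lin_def by blast

lemma fun_lin_scaleR: "fun_lin G \<Longrightarrow> \<xi> \<in> XM \<Longrightarrow> G (c *\<^sub>R \<xi>) = c *\<^sub>R G \<xi>"
  using fun_lin_fsc[OF _ smooth_const] by (simp add: fsc_const)

lemma fun_lin_zero: "fun_lin G \<Longrightarrow> G 0 = 0"
  using fun_lin_scaleR[of G 0 0] by simp

lemma fun_lin_diff: "fun_lin G \<Longrightarrow> \<xi> \<in> XM \<Longrightarrow> \<eta> \<in> XM \<Longrightarrow> G (\<xi> - \<eta>) = G \<xi> - G \<eta>"
  using fun_lin_add[of G \<xi> "(-1) *\<^sub>R \<eta>"] fun_lin_scaleR[of G \<eta> "-1"] XM_scaleR[of \<eta> "-1"]
  unfolding scaleR_minus1_left by (simp only: diff_conv_add_uminus)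

lemma fun_lin_sum:
  "fun_lin G \<Longrightarrow> (\<And>i. i \<in> I \<Longrightarrow> \<xi> i \<in> XM) \<Longrightarrow> G (\<Sum>i\<in>I. \<xi> i) = (\<Sum>i\<in>I. G (\<xi> i))"
  by (induction I rule: infinite_finite_induct) (auto simp: fun_lin_zero fun_lin_add)

text \<open>A function-linear map is given by its values at each point: multiplied with the cut-off function of
  a local frame, a vector field that vanishes at \<open>p\<close> is a combination of vector fields with
  coefficients that vanish at \<open>p\<close>.\<close>

lemma fun_lin_tensorial:
  assumes G: "fun_lin G" and xe: "\<xi> \<in> XM" "\<eta> \<in> XM" and eq: "\<xi> p = \<eta> p"
  shows "G \<xi> p = G \<eta> p"
proof -
  obtain \<kappa> h and E :: "'e \<Rightarrow> _" where k: "\<kappa> \<in> CM" "\<kappa> p = 1" and h: "\<And>b. h b \<in> CM" and E: "\<And>b. E b \<in> XM"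
    and fr: "\<And>q v. v \<in> Tan q \<Longrightarrow> \<kappa> q *\<^sub>R v = (\<Sum>b\<in>Basis. v (h b) *\<^sub>R E b q)"
    by (rule local_frame[of p]) blast
  have s: "(\<Sum>i\<in>I. F i) q = (\<Sum>i\<in>I. F i q)" for F :: "'e \<Rightarrow> 'a \<Rightarrow> 'w::real_vector" and I q
    by (induction I rule: infinite_finite_induct) auto
  have *: "G \<zeta> p = (\<Sum>b\<in>Basis. \<zeta> p (h b) *\<^sub>R G (E b) p)" if z: "\<zeta> \<in> XM" for \<zeta>
  proof -
    have "\<kappa> \<odot> \<zeta> = (\<Sum>b\<in>Basis. (\<lambda>q. \<zeta> q (h b)) \<odot> E b)"
      by (rule ext) (simp add: s fr[OF XM_tangent[OF z]])
    then have "\<kappa> \<odot> G \<zeta> = (\<Sum>b\<in>Basis. (\<lambda>q. \<zeta> q (h b)) \<odot> G (E b))"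
      using z E k by (simp add: fun_lin_fsc[OF G, symmetric] fun_lin_sum[OF G, symmetric])
    then have "(\<kappa> \<odot> G \<zeta>) p = (\<Sum>b\<in>Basis. (\<lambda>q. \<zeta> q (h b)) \<odot> G (E b)) p" by simp
    then show ?thesis using k(2) by (simp add: s)
  qed
  show ?thesis using *[OF xe(1)] *[OF xe(2)] eq by simp
qed

end

section \<open>Forms and the exterior derivative of a connection\<close>

text \<open>The simplifier does not unfold pointwise operations any more, so that equations between sections
  stay equations between functions.\<close>

lemmas pw = plus_fun_apply minus_apply uminus_apply zero_fun_apply scaleR_fun_apply fsc_apply

declare pw [simp del]

text \<open>What the calculus of forms uses of a bundle: its sections form a module over the smooth
  functions and take values in the fibres, which are subspaces.\<close>

locale vector_bundle = atlas A
  for A :: "('a::t2_space, 'e::euclidean_space) chart set" +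
  fixes E :: "('a, 'v::real_vector) vbundle"
  assumes fibre_subspace: "subspace (fibre E p)"
    and section_fibre: "s \<in> sections E \<Longrightarrow> s p \<in> fibre E p"
    and section_0: "0 \<in> sections E"
    and section_add: "s \<in> sections E \<Longrightarrow> t \<in> sections E \<Longrightarrow> s + t \<in> sections E"
    and section_fsc: "f \<in> smooth_functions A \<Longrightarrow> s \<in> sections E \<Longrightarrow> f \<odot> s \<in> sections E"
begin

lemma section_scaleR: "s \<in> sections E \<Longrightarrow> c *\<^sub>R s \<in> sections E"
  using section_fsc[OF smooth_const] by (simp add: fsc_const)

lemma section_uminus: "s \<in> sections E \<Longrightarrow> - s \<in> sections E"
  using section_scaleR[of s "-1"] by simp

lemma section_diff: "s \<in> sections E \<Longrightarrow> t \<in> sections E \<Longrightarrow> s - t \<in> sections E"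
  using section_add[of s "- t"] section_uminus by simp

text \<open>Forms as maps on lists of vector fields. \<open>eval_mform\<close> and
  \<open>form_of_mform\<close> pass between these and pointwise forms; all calculations are done on
  this side.\<close>

abbreviation mform :: "nat \<Rightarrow> ('a vfield list \<Rightarrow> 'a \<Rightarrow> 'v) \<Rightarrow> bool" where
  "mform \<equiv> alt_rec XM (sections E) fun_lin"

lemmas mform_iff = alt_rec_iff[of XM fun_lin, OF XM_add fun_lin_add XM_nonempty]
lemmas mform_swap = alt_rec_swap[of XM _ fun_lin, OF _ _ _ _ XM_add fun_lin_add]

lemma mform_section: "mform k T \<Longrightarrow> r \<in> tuples k XM \<Longrightarrow> T r \<in> sections E"
  by (simp add: mform_iff)

lemma mform_slot: "mform k T \<Longrightarrow> r \<in> tuples k XM \<Longrightarrow> i < k \<Longrightarrow> fun_lin (\<lambda>\<xi>. T (r[i := \<xi>]))"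
  by (simp add: mform_iff)

lemma mform_not_distinct: "mform k T \<Longrightarrow> r \<in> tuples k XM \<Longrightarrow> \<not> distinct r \<Longrightarrow> T r = 0"
  by (simp add: mform_iff)

lemma mform_Cons: "mform (Suc k) T \<Longrightarrow> \<xi> \<in> XM \<Longrightarrow> mform k (\<lambda>r. T (\<xi> # r))"
  by simp

lemma mform_head: "mform (Suc k) T \<Longrightarrow> r \<in> tuples k XM \<Longrightarrow> fun_lin (\<lambda>\<xi>. T (\<xi> # r))"
  by simp

lemma fun_lin_plus: "fun_lin F \<Longrightarrow> fun_lin G \<Longrightarrow> fun_lin (\<lambda>\<xi>. F \<xi> + G \<xi> :: 'a \<Rightarrow> 'w::real_vector)"
  by (rule fun_linI) (simp_all add: fun_lin_add fun_lin_fsc fsc_add)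

lemma fun_lin_minus_fun: "fun_lin F \<Longrightarrow> fun_lin G \<Longrightarrow> fun_lin (\<lambda>\<xi>. F \<xi> - G \<xi> :: 'a \<Rightarrow> 'w::real_vector)"
  by (rule fun_linI) (simp_all add: fun_lin_add fun_lin_fsc fsc_diff)

lemma fun_lin_fsc_fun: "fun_lin F \<Longrightarrow> fun_lin (\<lambda>\<xi>. f \<odot> F \<xi> :: 'a \<Rightarrow> 'w::real_vector)"
  by (rule fun_linI) (simp_all add: fun_lin_add fun_lin_fsc fsc_add fsc_commute)

lemma mform_add: "mform k T \<Longrightarrow> mform k T' \<Longrightarrow> mform k (\<lambda>r. T r + T' r)"
  by (induction k arbitrary: T T') (simp_all add: section_add fun_lin_plus)

lemma mform_diff: "mform k T \<Longrightarrow> mform k T' \<Longrightarrow> mform k (\<lambda>r. T r - T' r)"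
  by (induction k arbitrary: T T') (simp_all add: section_diff fun_lin_minus_fun)

lemma mform_fsc: "f \<in> CM \<Longrightarrow> mform k T \<Longrightarrow> mform k (\<lambda>r. f \<odot> T r)"
  by (induction k arbitrary: T) (simp_all add: section_fsc fun_lin_fsc_fun)

lemma map_point_tuples: "r \<in> tuples k XM \<Longrightarrow> map (\<lambda>\<xi>. \<xi> p) r \<in> tuples k (Tan p)"
  using XM_tangent by (auto simp: tuples_def)

lemma eval_mform:
  assumes \<phi>: "\<phi> \<in> forms A E k" shows "mform k (eval \<phi>)"
proof -
  have a: "\<phi> p \<in> alt_maps k (Tan p) (fibre E p)" for p using \<phi> unfolding forms_def by blast
  have "(\<forall>r\<in>tuples k XM. eval \<phi> r \<in> sections E) \<and>
    (\<forall>r\<in>tuples k XM. \<forall>i<k. fun_lin (\<lambda>\<xi>. eval \<phi> (r[i := \<xi>]))) \<and>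
    (\<forall>r\<in>tuples k XM. \<not> distinct r \<longrightarrow> eval \<phi> r = 0)"
  proof (intro conjI ballI allI impI)
    show "eval \<phi> r \<in> sections E" if "r \<in> tuples k XM" for r
      using \<phi> that unfolding forms_def by blast
    show "eval \<phi> r = 0" if "r \<in> tuples k XM" "\<not> distinct r" for r
    proof
      fix p
      have "\<not> distinct (map (\<lambda>\<xi>. \<xi> p) r)" using that(2) by (simp add: distinct_map)
      then show "eval \<phi> r p = 0 p"
        using a[of p] map_point_tuples[OF that(1)] unfolding alt_maps_def eval_def by (simp add: pw)
    qed
    fix r i assume r: "r \<in> tuples k XM" "i < k"
    have l: "lin_on (Tan p) (\<lambda>v. \<phi> p ((map (\<lambda>\<xi>. \<xi> p) r)[i := v]))" for p
      using a[of p] map_point_tuples[OF r(1)] r(2) unfolding alt_maps_def by blast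
    have e: "eval \<phi> (r[i := \<xi>]) p = \<phi> p ((map (\<lambda>\<xi>. \<xi> p) r)[i := \<xi> p])" for \<xi> p
      by (simp add: eval_def map_update)
    show "fun_lin (\<lambda>\<xi>. eval \<phi> (r[i := \<xi>]))"
    proof (rule fun_linI)
      fix \<xi> \<eta> assume "\<xi> \<in> XM" "\<eta> \<in> XM"
      then show "eval \<phi> (r[i := \<xi> + \<eta>]) = eval \<phi> (r[i := \<xi>]) + eval \<phi> (r[i := \<eta>])"
        using l[unfolded lin_on_def, rule_format, of "\<xi> p" p "\<eta> p" 1 1 for p] XM_tangent
        by (simp add: fun_eq_iff e pw)
    next
      fix f \<xi> assume "f \<in> CM" "\<xi> \<in> XM"
      then show "eval \<phi> (r[i := f \<odot> \<xi>]) = f \<odot> eval \<phi> (r[i := \<xi>])"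
        using l[unfolded lin_on_def, rule_format, of "\<xi> p" p "\<xi> p" "f p" 0 for p] XM_tangent
        by (simp add: fun_eq_iff e pw)
    qed
  qed
  then show ?thesis by (simp only: mform_iff)
qed

lemma mform_tensorial:
  assumes "mform k T'" "r \<in> tuples k XM" "r' \<in> tuples k XM" "map (\<lambda>\<xi>. \<xi> p) r = map (\<lambda>\<xi>. \<xi> p) r'"
  shows "T' r p = T' r' p"
  using assms
proof (induction k arbitrary: T' r r')
  case (Suc k)
  obtain \<xi> s where r: "r = \<xi> # s" "\<xi> \<in> XM" "s \<in> tuples k XM" using Suc.prems(2) by (rule tuples_SucE)
  obtain \<xi>' s' where r': "r' = \<xi>' # s'" "\<xi>' \<in> XM" "s' \<in> tuples k XM" using Suc.prems(3) by (rule tuples_SucE)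
  have "T' (\<xi> # s) p = T' (\<xi> # s') p"
    using Suc.IH[OF mform_Cons[OF Suc.prems(1) r(2)] r(3) r'(3)] Suc.prems(4) r r' by simp
  also have "\<dots> = T' (\<xi>' # s') p"
    using fun_lin_tensorial[OF mform_head[OF Suc.prems(1) r'(3)] r(2) r'(2)] Suc.prems(4) r r' by simp
  finally show ?case using r r' by simp
qed simp

text \<open>The existence half of the definite descriptions for forms. Tangent vectors are extended
  to vector fields by an arbitrary choice; the choice is not linear, but by
  \<open>mform_tensorial\<close> the value at \<open>p\<close> does not depend on it, and so it
  inherits multilinearity.\<close>

lemma form_of_mform:
  assumes T': "mform k T'"
  obtains \<phi> where "\<phi> \<in> forms A E k" "\<And>r. r \<in> tuples k XM \<Longrightarrow> eval \<phi> r = T' r"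
proof -
  define ext where "ext p v = (SOME \<xi>. \<xi> \<in> XM \<and> \<xi> p = v)" for p v
  have ext: "ext p v \<in> XM" "ext p v p = v" if "v \<in> Tan p" for p v
    using someI_ex[of "\<lambda>\<xi>. \<xi> \<in> XM \<and> \<xi> p = v"] vfield_through[OF that] unfolding ext_def by blast+
  define \<phi> where "\<phi> p vs = (if vs \<in> tuples k (Tan p) then T' (map (ext p) vs) p else 0)" for p vs
  have et: "map (ext p) vs \<in> tuples k XM" if "vs \<in> tuples k (Tan p)" for p vs
    using that ext by (auto simp: tuples_def)
  have em: "map (\<lambda>\<xi>. \<xi> p) (map (ext p) vs) = vs" if "vs \<in> tuples k (Tan p)" for p vs
    using that ext by (auto simp: tuples_def o_def intro!: map_idI)
  have val: "\<phi> p vs = T' r p" if "r \<in> tuples k XM" "map (\<lambda>\<xi>. \<xi> p) r = vs" for p vs r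
  proof -
    have vs: "vs \<in> tuples k (Tan p)" using map_point_tuples[OF that(1), of p] that(2) by simp
    show ?thesis
      using mform_tensorial[OF T' et[OF vs] that(1), of p] em[OF vs] that(2) vs by (simp add: \<phi>_def del: map_map)
  qed
  have ev: "eval \<phi> r = T' r" if "r \<in> tuples k XM" for r
    using val[OF that] by (simp add: fun_eq_iff eval_def)
  have "\<phi> p \<in> alt_maps k (Tan p) (fibre E p)" for p
    unfolding alt_maps_def
  proof (intro CollectI conjI ballI allI impI)
    show "\<phi> p vs = 0" if "vs \<notin> tuples k (Tan p)" for vs using that by (simp add: \<phi>_def)
    fix vs assume vs: "vs \<in> tuples k (Tan p)"
    have v: "\<phi> p vs = T' (map (ext p) vs) p" using vs by (simp add: \<phi>_def)
    show "\<phi> p vs \<in> fibre E p"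
      unfolding v by (rule section_fibre[OF mform_section[OF T' et[OF vs]]])
    show "\<phi> p vs = 0" if nd: "\<not> distinct vs"
    proof -
      have "\<not> distinct (map (ext p) vs)" using nd by (simp add: distinct_map)
      then show ?thesis unfolding v using mform_not_distinct[OF T' et[OF vs]] by (simp add: pw)
    qed
    fix i assume i: "i < k"
    note fl = mform_slot[OF T' et[OF vs] i]
    have u: "\<phi> p (vs[i := \<xi> p]) = T' ((map (ext p) vs)[i := \<xi>]) p" if "\<xi> \<in> XM" for \<xi>
      by (rule val) (use et[OF vs] em[OF vs] that in \<open>auto simp: map_update simp del: map_map\<close>)
    show "lin_on (Tan p) (\<lambda>v. \<phi> p (vs[i := v]))"
      unfolding lin_on_def
    proof (intro ballI allI)
      fix v w a b assume vw: "v \<in> Tan p" "w \<in> Tan p"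
      let ?x = "ext p v" and ?y = "ext p w"
      have "\<phi> p (vs[i := a *\<^sub>R v + b *\<^sub>R w]) = T' ((map (ext p) vs)[i := a *\<^sub>R ?x + b *\<^sub>R ?y]) p"
        using u[of "a *\<^sub>R ?x + b *\<^sub>R ?y"] ext vw by (simp add: pw)
      also have "\<dots> = a *\<^sub>R T' ((map (ext p) vs)[i := ?x]) p + b *\<^sub>R T' ((map (ext p) vs)[i := ?y]) p"
        using ext vw by (simp add: fun_lin_add[OF fl] fun_lin_scaleR[OF fl] pw)
      finally show "\<phi> p (vs[i := a *\<^sub>R v + b *\<^sub>R w]) = a *\<^sub>R \<phi> p (vs[i := v]) + b *\<^sub>R \<phi> p (vs[i := w])"
        using u[of ?x] u[of ?y] ext vw by simp
    qed
  qed
  then have "\<phi> \<in> forms A E k"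
    unfolding forms_def using ev mform_section[OF T'] by auto
  then show thesis using that ev by blast
qed

lemma tuples_through:
  assumes "vs \<in> tuples k (Tan p)" obtains r where "r \<in> tuples k XM" "map (\<lambda>\<xi>. \<xi> p) r = vs"
proof -
  have "\<exists>r. r \<in> tuples k XM \<and> map (\<lambda>\<xi>. \<xi> p) r = vs"
    using assms
  proof (induction k arbitrary: vs)
    case (Suc k)
    then obtain v ws where v: "vs = v # ws" "v \<in> Tan p" "ws \<in> tuples k (Tan p)" by (blast elim: tuples_SucE)
    then obtain r where "r \<in> tuples k XM" "map (\<lambda>\<xi>. \<xi> p) r = ws" using Suc.IH by blast
    moreover obtain \<xi> where "\<xi> \<in> XM" "\<xi> p = v" using vfield_through[OF v(2)] .
    ultimately show ?case using v by (intro exI[of _ "\<xi> # r"]) simp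
  qed simp
  then show thesis using that by blast
qed

lemma form_outside: "\<phi> \<in> forms A E k \<Longrightarrow> vs \<notin> tuples k (Tan p) \<Longrightarrow> \<phi> p vs = 0"
  unfolding forms_def alt_maps_def by blast

lemma form_eqI:
  assumes "\<phi> \<in> forms A E k" "\<psi> \<in> forms A E k" "\<And>r. r \<in> tuples k XM \<Longrightarrow> eval \<phi> r = eval \<psi> r"
  shows "\<phi> = \<psi>"
proof (intro ext)
  fix p vs
  show "\<phi> p vs = \<psi> p vs"
  proof (cases "vs \<in> tuples k (Tan p)")
    case True
    then obtain r where r: "r \<in> tuples k XM" "map (\<lambda>\<xi>. \<xi> p) r = vs" by (rule tuples_through)
    show ?thesis using fun_cong[OF assms(3)[OF r(1)], of p] r(2) by (simp add: eval_def)
  qed (simp add: form_outside[OF assms(1)] form_outside[OF assms(2)])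
qed

lemma forms_subspace: "subspace (forms A E k)"
  unfolding subspace_def
proof (intro conjI ballI allI)
  show "0 \<in> forms A E k"
    using subspace_0[OF fibre_subspace] section_0
    by (auto simp: forms_def alt_maps_def eval_def lin_on_def zero_fun_def)
  have e: "eval (\<phi> + \<psi>) r = eval \<phi> r + eval \<psi> r" "eval (c *\<^sub>R \<phi>) r = c *\<^sub>R eval \<phi> r" for \<phi> \<psi> :: "'a \<Rightarrow> 'a tvec list \<Rightarrow> 'v" and r c
    by (simp_all add: eval_def fun_eq_iff pw)
  show "\<phi> + \<psi> \<in> forms A E k" if "\<phi> \<in> forms A E k" "\<psi> \<in> forms A E k" for \<phi> \<psi>
    using that subspace_add[OF fibre_subspace] section_add
    by (auto simp: forms_def alt_maps_def e lin_on_def pw algebra_simps)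
  show "c *\<^sub>R \<phi> \<in> forms A E k" if "\<phi> \<in> forms A E k" for \<phi> c
    using that subspace_scale[OF fibre_subspace] section_scaleR
    by (auto simp: forms_def alt_maps_def e lin_on_def pw algebra_simps)
qed

end

locale bundle_connection = vector_bundle A E
  for A :: "('a::t2_space, 'e::euclidean_space) chart set" and E :: "('a, 'v::real_vector) vbundle" +
  fixes D :: "'a vfield \<Rightarrow> ('a \<Rightarrow> 'v) \<Rightarrow> 'a \<Rightarrow> 'v"
  assumes D_section: "\<xi> \<in> vfields A \<Longrightarrow> s \<in> sections E \<Longrightarrow> D \<xi> s \<in> sections E"
    and D_add: "\<xi> \<in> vfields A \<Longrightarrow> s \<in> sections E \<Longrightarrow> t \<in> sections E \<Longrightarrow> D \<xi> (s + t) = D \<xi> s + D \<xi> t"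
    and D_fsc: "f \<in> smooth_functions A \<Longrightarrow> \<xi> \<in> vfields A \<Longrightarrow> s \<in> sections E \<Longrightarrow>
      D \<xi> (f \<odot> s) = f \<odot> D \<xi> s + (\<lambda>p. \<xi> p f) \<odot> s"
    and D_add_left: "\<xi> \<in> vfields A \<Longrightarrow> \<eta> \<in> vfields A \<Longrightarrow> s \<in> sections E \<Longrightarrow> D (\<xi> + \<eta>) s = D \<xi> s + D \<eta> s"
    and D_fsc_left: "f \<in> smooth_functions A \<Longrightarrow> \<xi> \<in> vfields A \<Longrightarrow> s \<in> sections E \<Longrightarrow> D (f \<odot> \<xi>) s = f \<odot> D \<xi> s"
begin

lemma D_scaleR:
  assumes "\<xi> \<in> XM" "s \<in> sections E" shows "D \<xi> (c *\<^sub>R s) = c *\<^sub>R D \<xi> s"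
proof -
  have "(\<lambda>p. \<xi> p (\<lambda>q. c)) = (\<lambda>p. 0)" using tangent_const[OF XM_tangent[OF assms(1)]] by simp
  then show ?thesis
    using D_fsc[OF smooth_const assms, of c] by (simp add: fsc_const)
qed

lemma D_diff: "\<xi> \<in> XM \<Longrightarrow> s \<in> sections E \<Longrightarrow> t \<in> sections E \<Longrightarrow> D \<xi> (s - t) = D \<xi> s - D \<xi> t"
  using D_add[of \<xi> s "- t"] D_scaleR[of \<xi> t "-1"] section_uminus[of t] by simp

lemma D_0: "\<xi> \<in> XM \<Longrightarrow> D \<xi> 0 = 0"
  using D_scaleR[of \<xi> 0 0] section_0 by simp

section \<open>Lie derivative and exterior derivative on lists of vector fields\<close>

abbreviation "L \<equiv> lie D"
abbreviation "d \<equiv> ed D"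
abbreviation sec :: "nat \<Rightarrow> ('a vfield list \<Rightarrow> 'a \<Rightarrow> 'v) \<Rightarrow> bool" where
  "sec k T \<equiv> \<forall>r\<in>tuples k XM. T r \<in> sections E"

lemma lie_cong:
  "\<xi> \<in> XM \<Longrightarrow> r \<in> tuples k XM \<Longrightarrow> (\<And>r. r \<in> tuples k XM \<Longrightarrow> T r = T' r) \<Longrightarrow> L \<xi> r T = L \<xi> r T'"
proof (induction k arbitrary: r T T')
  case (Suc k)
  obtain \<zeta> s where r: "r = \<zeta> # s" "\<zeta> \<in> XM" "s \<in> tuples k XM" using Suc.prems(2) by (rule tuples_SucE)
  have "L \<xi> s (\<lambda>r. T (\<zeta> # r)) = L \<xi> s (\<lambda>r. T' (\<zeta> # r))"
    by (rule Suc.IH) (use Suc.prems r in auto)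
  then show ?case using Suc.prems r by simp
qed simp

lemma lie_section: "\<xi> \<in> XM \<Longrightarrow> r \<in> tuples k XM \<Longrightarrow> sec k T \<Longrightarrow> L \<xi> r T \<in> sections E"
proof (induction k arbitrary: r T)
  case (Suc k)
  obtain \<zeta> s where r: "r = \<zeta> # s" "\<zeta> \<in> XM" "s \<in> tuples k XM" using Suc.prems(2) by (rule tuples_SucE)
  have "L \<xi> s (\<lambda>r. T (\<zeta> # r)) \<in> sections E"
    by (rule Suc.IH) (use Suc.prems r in auto)
  then show ?case using Suc.prems r by (simp add: section_diff)
qed (simp add: D_section)

lemma lie_add: "\<xi> \<in> XM \<Longrightarrow> r \<in> tuples k XM \<Longrightarrow> sec k T \<Longrightarrow> sec k T' \<Longrightarrow> L \<xi> r (\<lambda>r. T r + T' r) = L \<xi> r T + L \<xi> r T'"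
proof (induction k arbitrary: r T T')
  case (Suc k)
  obtain \<zeta> s where r: "r = \<zeta> # s" "\<zeta> \<in> XM" "s \<in> tuples k XM" using Suc.prems(2) by (rule tuples_SucE)
  have "L \<xi> s (\<lambda>r. T (\<zeta> # r) + T' (\<zeta> # r)) = L \<xi> s (\<lambda>r. T (\<zeta> # r)) + L \<xi> s (\<lambda>r. T' (\<zeta> # r))"
    by (rule Suc.IH) (use Suc.prems r in auto)
  then show ?case using r by simp
qed (simp add: D_add)

lemma lie_diff: "\<xi> \<in> XM \<Longrightarrow> r \<in> tuples k XM \<Longrightarrow> sec k T \<Longrightarrow> sec k T' \<Longrightarrow> L \<xi> r (\<lambda>r. T r - T' r) = L \<xi> r T - L \<xi> r T'"
proof (induction k arbitrary: r T T')
  case (Suc k)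
  obtain \<zeta> s where r: "r = \<zeta> # s" "\<zeta> \<in> XM" "s \<in> tuples k XM" using Suc.prems(2) by (rule tuples_SucE)
  have "L \<xi> s (\<lambda>r. T (\<zeta> # r) - T' (\<zeta> # r)) = L \<xi> s (\<lambda>r. T (\<zeta> # r)) - L \<xi> s (\<lambda>r. T' (\<zeta> # r))"
    by (rule Suc.IH) (use Suc.prems r in auto)
  then show ?case using r by simp
qed (simp add: D_diff)

lemma lie_fsc: "\<xi> \<in> XM \<Longrightarrow> f \<in> CM \<Longrightarrow> r \<in> tuples k XM \<Longrightarrow> sec k T \<Longrightarrow>
    L \<xi> r (\<lambda>r. f \<odot> T r) = f \<odot> L \<xi> r T + (\<lambda>p. \<xi> p f) \<odot> T r"
proof (induction k arbitrary: r T)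
  case (Suc k)
  obtain \<zeta> s where r: "r = \<zeta> # s" "\<zeta> \<in> XM" "s \<in> tuples k XM" using Suc.prems(3) by (rule tuples_SucE)
  have "L \<xi> s (\<lambda>r. f \<odot> T (\<zeta> # r)) = f \<odot> L \<xi> s (\<lambda>r. T (\<zeta> # r)) + (\<lambda>p. \<xi> p f) \<odot> T (\<zeta> # s)"
    by (rule Suc.IH) (use Suc.prems r in auto)
  then show ?case using r by (simp add: fsc_diff)
qed (simp add: D_fsc)

lemma lie_0: "\<xi> \<in> XM \<Longrightarrow> r \<in> tuples k XM \<Longrightarrow> L \<xi> r (\<lambda>r. 0) = 0"
  using lie_diff[of \<xi> r k "\<lambda>r. 0" "\<lambda>r. 0"] by (simp add: section_0)

lemma lie_add_left: "\<xi> \<in> XM \<Longrightarrow> \<eta> \<in> XM \<Longrightarrow> r \<in> tuples k XM \<Longrightarrow> mform k T \<Longrightarrow> L (\<xi> + \<eta>) r T = L \<xi> r T + L \<eta> r T"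
proof (induction k arbitrary: r T)
  case (Suc k)
  obtain \<zeta> s where r: "r = \<zeta> # s" "\<zeta> \<in> XM" "s \<in> tuples k XM" using Suc.prems(3) by (rule tuples_SucE)
  have "L (\<xi> + \<eta>) s (\<lambda>r. T (\<zeta> # r)) = L \<xi> s (\<lambda>r. T (\<zeta> # r)) + L \<eta> s (\<lambda>r. T (\<zeta> # r))"
    by (rule Suc.IH) (use Suc.prems r in auto)
  then show ?case using r Suc.prems fun_lin_add[OF mform_head[OF Suc.prems(4) r(3)], of "bracket \<xi> \<zeta>" "bracket \<eta> \<zeta>"]
    by (simp add: bracket_add_left)
qed (simp add: D_add_left)

lemma mform_sec: "mform k T \<Longrightarrow> sec k T"
  using mform_section by blast

text \<open>In the arguments, the derivative of a coefficient \<open>f\<close> from the Leibniz rule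
  of the connection cancels against the one from \<open>bracket \<xi> (f \<odot> \<zeta>)\<close>.
  In \<xi> itself the Lie derivative is merely additive.\<close>

lemma lie_mform: "\<xi> \<in> XM \<Longrightarrow> mform k T \<Longrightarrow> mform k (\<lambda>r. L \<xi> r T)"
proof (induction k arbitrary: T)
  case (Suc k)
  note mC = mform_Cons[OF Suc.prems(2)] and mh = mform_head[OF Suc.prems(2)]
  have 1: "mform k (\<lambda>r. L \<xi> r (\<lambda>r. T (\<zeta> # r)) - T (bracket \<xi> \<zeta> # r))" if "\<zeta> \<in> XM" for \<zeta>
    by (rule mform_diff[OF Suc.IH[OF Suc.prems(1) mC[OF that]] mC[OF bracket_XM[OF Suc.prems(1) that]]])
  have 2: "fun_lin (\<lambda>\<zeta>. L \<xi> r (\<lambda>r. T (\<zeta> # r)) - T (bracket \<xi> \<zeta> # r))" if r: "r \<in> tuples k XM" for r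
  proof (rule fun_linI)
    fix \<zeta> \<eta> assume ze: "\<zeta> \<in> XM" "\<eta> \<in> XM"
    have "L \<xi> r (\<lambda>r. T ((\<zeta> + \<eta>) # r)) = L \<xi> r (\<lambda>r. T (\<zeta> # r) + T (\<eta> # r))"
      by (rule lie_cong[OF Suc.prems(1) r]) (use fun_lin_add[OF mh] ze in auto)
    also have "\<dots> = L \<xi> r (\<lambda>r. T (\<zeta> # r)) + L \<xi> r (\<lambda>r. T (\<eta> # r))"
      by (rule lie_add[OF Suc.prems(1) r]) (use mform_sec[OF mC] ze in auto)
    finally show "L \<xi> r (\<lambda>r. T ((\<zeta> + \<eta>) # r)) - T (bracket \<xi> (\<zeta> + \<eta>) # r) =
        L \<xi> r (\<lambda>r. T (\<zeta> # r)) - T (bracket \<xi> \<zeta> # r) + (L \<xi> r (\<lambda>r. T (\<eta> # r)) - T (bracket \<xi> \<eta> # r))"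
      using ze Suc.prems(1) fun_lin_add[OF mh[OF r], of "bracket \<xi> \<zeta>" "bracket \<xi> \<eta>"] by (simp add: bracket_add_right)
  next
    fix f \<zeta> assume fz: "f \<in> CM" "\<zeta> \<in> XM"
    have "L \<xi> r (\<lambda>r. T (f \<odot> \<zeta> # r)) = L \<xi> r (\<lambda>r. f \<odot> T (\<zeta> # r))"
      by (rule lie_cong[OF Suc.prems(1) r]) (use fun_lin_fsc[OF mh] fz in auto)
    also have "\<dots> = f \<odot> L \<xi> r (\<lambda>r. T (\<zeta> # r)) + (\<lambda>p. \<xi> p f) \<odot> T (\<zeta> # r)"
      by (rule lie_fsc[OF Suc.prems(1) fz(1) r mform_sec[OF mC[OF fz(2)]]])
    finally show "L \<xi> r (\<lambda>r. T (f \<odot> \<zeta> # r)) - T (bracket \<xi> (f \<odot> \<zeta>) # r) =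
        f \<odot> (L \<xi> r (\<lambda>r. T (\<zeta> # r)) - T (bracket \<xi> \<zeta> # r))"
      using fz Suc.prems(1) fun_lin_add[OF mh[OF r], of "f \<odot> bracket \<xi> \<zeta>" "(\<lambda>p. \<xi> p f) \<odot> \<zeta>"]
        fun_lin_fsc[OF mh[OF r]]
      by (simp add: bracket_fsc_right[where \<zeta> = \<zeta>] fsc_diff)
  qed
  have 3: "L \<xi> (\<zeta> # \<zeta> # r) T = 0" if zr: "\<zeta> # r \<in> tuples k XM" for \<zeta> r
  proof -
    obtain j where j: "k = Suc j" "\<zeta> \<in> XM" "r \<in> tuples j XM" using zr by (cases k) auto
    have "L \<xi> r (\<lambda>r. T (\<zeta> # \<zeta> # r)) = L \<xi> r (\<lambda>r. 0)"
      by (rule lie_cong[OF Suc.prems(1) j(3)]) (use Suc.prems j in auto)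
    moreover have "T (\<zeta> # bracket \<xi> \<zeta> # r) = - T (bracket \<xi> \<zeta> # \<zeta> # r)"
      by (rule mform_swap) (use Suc.prems j in auto)
    ultimately show ?thesis using lie_0[OF Suc.prems(1) j(3)] by simp
  qed
  show ?case using 1 2 3 by simp
qed (simp add: D_section)

lemma ed_cong:
  "r \<in> tuples (Suc k) XM \<Longrightarrow> (\<And>r. r \<in> tuples k XM \<Longrightarrow> T r = T' r) \<Longrightarrow> d r T = d r T'"
proof (induction k arbitrary: r T T')
  case 0
  then show ?case by (auto elim!: tuples_SucE)
next
  case (Suc k)
  obtain \<zeta> s where r: "r = \<zeta> # s" "\<zeta> \<in> XM" "s \<in> tuples (Suc k) XM" using Suc.prems(1) by (rule tuples_SucE)
  have "d s (\<lambda>r. T (\<zeta> # r)) = d s (\<lambda>r. T' (\<zeta> # r))"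
    by (rule Suc.IH) (use Suc.prems r in auto)
  moreover have "L \<zeta> s T = L \<zeta> s T'" by (rule lie_cong[OF r(2,3) Suc.prems(2)])
  ultimately show ?case using r by simp
qed

lemma ed_add: "r \<in> tuples (Suc k) XM \<Longrightarrow> sec k T \<Longrightarrow> sec k T' \<Longrightarrow> d r (\<lambda>r. T r + T' r) = d r T + d r T'"
proof (induction k arbitrary: r T T')
  case 0
  then show ?case by (auto elim!: tuples_SucE simp: D_add)
next
  case (Suc k)
  obtain \<zeta> s where r: "r = \<zeta> # s" "\<zeta> \<in> XM" "s \<in> tuples (Suc k) XM" using Suc.prems(1) by (rule tuples_SucE)
  have "d s (\<lambda>r. T (\<zeta> # r) + T' (\<zeta> # r)) = d s (\<lambda>r. T (\<zeta> # r)) + d s (\<lambda>r. T' (\<zeta> # r))"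
    by (rule Suc.IH) (use Suc.prems r in auto)
  moreover have "L \<zeta> s (\<lambda>r. T r + T' r) = L \<zeta> s T + L \<zeta> s T'" by (rule lie_add[OF r(2,3) Suc.prems(2,3)])
  ultimately show ?case using r by simp
qed

lemma ed_diff: "r \<in> tuples (Suc k) XM \<Longrightarrow> sec k T \<Longrightarrow> sec k T' \<Longrightarrow> d r (\<lambda>r. T r - T' r) = d r T - d r T'"
proof (induction k arbitrary: r T T')
  case 0
  then show ?case by (auto elim!: tuples_SucE simp: D_diff)
next
  case (Suc k)
  obtain \<zeta> s where r: "r = \<zeta> # s" "\<zeta> \<in> XM" "s \<in> tuples (Suc k) XM" using Suc.prems(1) by (rule tuples_SucE)
  have "d s (\<lambda>r. T (\<zeta> # r) - T' (\<zeta> # r)) = d s (\<lambda>r. T (\<zeta> # r)) - d s (\<lambda>r. T' (\<zeta> # r))"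
    by (rule Suc.IH) (use Suc.prems r in auto)
  moreover have "L \<zeta> s (\<lambda>r. T r - T' r) = L \<zeta> s T - L \<zeta> s T'" by (rule lie_diff[OF r(2,3) Suc.prems(2,3)])
  ultimately show ?case using r by simp
qed

lemma ed_0: "r \<in> tuples (Suc k) XM \<Longrightarrow> d r (\<lambda>r. 0) = 0"
  using ed_diff[of r k "\<lambda>r. 0" "\<lambda>r. 0"] by (simp add: section_0)

text \<open>Neither of the two terms of Cartan's formula is linear over \<open>CM\<close> in the
  first argument. Linearity in the second argument is available by induction, and it is carried over
  to the first one by skew symmetry, which needs only additivity and the vanishing on two equal
  arguments.\<close>

lemma ed_mform: "mform k T \<Longrightarrow> mform (Suc k) (\<lambda>r. d r T)"
proof (induction k arbitrary: T)
  case 0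
  then show ?case by (auto intro!: fun_linI simp: D_section D_add_left D_fsc_left)
next
  case (Suc k)
  note mC = mform_Cons[OF Suc.prems] and mh = mform_head[OF Suc.prems]
  have 1: "mform (Suc k) (\<lambda>r. d (\<xi> # r) T)" if "\<xi> \<in> XM" for \<xi>
    using mform_diff[OF lie_mform[OF that Suc.prems] Suc.IH[OF mC[OF that]]] by simp
  have add: "d ((\<xi> + \<eta>) # r) T = d (\<xi> # r) T + d (\<eta> # r) T"
    if "\<xi> \<in> XM" "\<eta> \<in> XM" and r: "r \<in> tuples (Suc k) XM" for \<xi> \<eta> r
  proof -
    have "d r (\<lambda>r. T ((\<xi> + \<eta>) # r)) = d r (\<lambda>r. T (\<xi> # r) + T (\<eta> # r))"
      by (rule ed_cong[OF r]) (use fun_lin_add[OF mh] that in auto)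
    also have "\<dots> = d r (\<lambda>r. T (\<xi> # r)) + d r (\<lambda>r. T (\<eta> # r))"
      by (rule ed_add[OF r]) (use mform_sec[OF mC] that in auto)
    finally show ?thesis using lie_add_left[OF that(1,2) r Suc.prems] by simp
  qed
  \<comment> \<open>Unfolding Cartan's formula twice, the Lie derivatives along \<xi> cancel. What
    remains is \<open>T\<close> on \<open>bracket \<xi> \<xi>\<close>, which is 0, and the
    derivative of \<open>T\<close> with \<xi> inserted twice.\<close>
  have alt: "d (\<xi> # \<xi> # r) T = 0" if x: "\<xi> \<in> XM" and r: "r \<in> tuples k XM" for \<xi> r
  proof -
    have "d r (\<lambda>r. T (\<xi> # \<xi> # r)) = 0"
    proof (cases k)
      case 0
      then show ?thesis using r by simp
    next
      case (Suc j)
      have "d r (\<lambda>r. T (\<xi> # \<xi> # r)) = d r (\<lambda>r. 0)"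
        by (rule ed_cong[of _ j]) (use r x Suc Suc.prems in auto)
      then show ?thesis using ed_0 r Suc by simp
    qed
    then show ?thesis using fun_lin_zero[OF mh[OF r]] by simp
  qed
  have swap: "d (\<xi> # \<eta> # r) T = - d (\<eta> # \<xi> # r) T" if xe: "\<xi> \<in> XM" "\<eta> \<in> XM" and r: "r \<in> tuples k XM" for \<xi> \<eta> r
  proof -
    have "0 = d ((\<xi> + \<eta>) # (\<xi> + \<eta>) # r) T" using alt[OF _ r, of "\<xi> + \<eta>"] xe by simp
    also have "\<dots> = d (\<xi> # (\<xi> + \<eta>) # r) T + d (\<eta> # (\<xi> + \<eta>) # r) T"
      by (rule add) (use xe r in auto)
    also have "\<dots> = d (\<xi> # \<xi> # r) T + d (\<xi> # \<eta> # r) T + (d (\<eta> # \<xi> # r) T + d (\<eta> # \<eta> # r) T)"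
      using fun_lin_add[OF mform_head[OF 1 r], of \<xi> \<xi> \<eta>] fun_lin_add[OF mform_head[OF 1 r], of \<eta> \<xi> \<eta>] xe
      by (simp only:)
    also have "\<dots> = d (\<xi> # \<eta> # r) T + d (\<eta> # \<xi> # r) T"
      using alt[OF xe(1) r] alt[OF xe(2) r] by (simp only: add_0_left add_0_right)
    finally show ?thesis by (metis add_eq_0_iff2)
  qed
  have 2: "fun_lin (\<lambda>\<xi>. d (\<xi> # r) T)" if r: "r \<in> tuples (Suc k) XM" for r
  proof (rule fun_linI)
    fix f \<xi> assume fx: "f \<in> CM" "\<xi> \<in> XM"
    obtain \<eta> s where s: "r = \<eta> # s" "\<eta> \<in> XM" "s \<in> tuples k XM" using r by (rule tuples_SucE)
    have "d (f \<odot> \<xi> # r) T = - d (\<eta> # f \<odot> \<xi> # s) T"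
      unfolding s(1) by (rule swap) (use fx s in auto)
    also have "\<dots> = - (f \<odot> d (\<eta> # \<xi> # s) T)"
      using fun_lin_fsc[OF mform_head[OF 1[OF s(2)] s(3)] fx] by (simp only:)
    also have "\<dots> = f \<odot> d (\<xi> # r) T"
      unfolding s(1) swap[OF fx(2) s(2,3)] by (simp add: fun_eq_iff pw algebra_simps)
    finally show "d (f \<odot> \<xi> # r) T = f \<odot> d (\<xi> # r) T" .
  qed (use add r in auto)
  have 3: "d (\<xi> # \<xi> # r) T = 0" if "\<xi> # r \<in> tuples (Suc k) XM" for \<xi> r
    by (rule alt) (use that in auto)
  show ?case
    unfolding alt_rec.simps(2)[of _ _ _ "Suc k"] using 1 2 3 by blast
qed

end

context bundle_connection
begin

section \<open>Curvature as the obstruction to d d = 0\<close>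

lemma sec_lie: "sec k T \<Longrightarrow> \<xi> \<in> XM \<Longrightarrow> sec k (\<lambda>r. L \<xi> r T)"
  using lie_section by blast

lemma sec_ed: "mform k T \<Longrightarrow> sec (Suc k) (\<lambda>r. d r T)"
  by (rule mform_sec[OF ed_mform])

text \<open>Only the subgroup \<open>N\<close> of values that contains the curvature of the connection matters: for \<open>N = 0\<close>
  this is the flat case, and for the deformation connection \<open>N\<close> can always be taken to consist of the
  sections with vanishing top component.\<close>

context
  fixes N :: "('a \<Rightarrow> 'v) set"
  assumes N0: "0 \<in> N" and Nadd: "s \<in> N \<Longrightarrow> t \<in> N \<Longrightarrow> s + t \<in> N" and Ndiff: "s \<in> N \<Longrightarrow> t \<in> N \<Longrightarrow> s - t \<in> N"
    and curv: "\<xi> \<in> XM \<Longrightarrow> \<eta> \<in> XM \<Longrightarrow> s \<in> sections E \<Longrightarrow> D \<xi> (D \<eta> s) - D \<eta> (D \<xi> s) - D (bracket \<xi> \<eta>) s \<in> N"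
begin

lemma curv': "\<xi> \<in> XM \<Longrightarrow> \<eta> \<in> XM \<Longrightarrow> s \<in> sections E \<Longrightarrow> D \<xi> (D \<eta> s) - D (bracket \<xi> \<eta>) s - D \<eta> (D \<xi> s) \<in> N"
proof -
  assume a: "\<xi> \<in> XM" "\<eta> \<in> XM" "s \<in> sections E"
  have "D \<xi> (D \<eta> s) - D (bracket \<xi> \<eta>) s - D \<eta> (D \<xi> s) = D \<xi> (D \<eta> s) - D \<eta> (D \<xi> s) - D (bracket \<xi> \<eta>) s"
    by (simp add: algebra_simps)
  then show ?thesis by (rule ssubst[where P = "\<lambda>u. u \<in> N"]) (rule curv[OF a])
qed

text \<open>The terms with brackets cancel by the Jacobi identity, so the discrepancy is passed down
  the list unchanged until it becomes the curvature applied to a value of \<open>T\<close>.\<close>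

lemma lie_commutator:
  "\<xi> \<in> XM \<Longrightarrow> \<eta> \<in> XM \<Longrightarrow> r \<in> tuples k XM \<Longrightarrow> mform k T \<Longrightarrow>
    L \<xi> r (\<lambda>r. L \<eta> r T) - L \<eta> r (\<lambda>r. L \<xi> r T) - L (bracket \<xi> \<eta>) r T \<in> N"
proof (induction k arbitrary: r T)
  case (Suc k)
  obtain \<zeta> s where r: "r = \<zeta> # s" "\<zeta> \<in> XM" "s \<in> tuples k XM" using Suc.prems(3) by (rule tuples_SucE)
  let ?T = "\<lambda>\<zeta> r. T (\<zeta> # r)"
  note xe = Suc.prems(1,2) and m = mform_Cons[OF Suc.prems(4)]
  have e: "L \<xi> s (\<lambda>r. L \<eta> (\<zeta> # r) T) = L \<xi> s (\<lambda>r. L \<eta> r (?T \<zeta>)) - L \<xi> s (?T (bracket \<eta> \<zeta>))"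
    if "\<xi> \<in> XM" "\<eta> \<in> XM" for \<xi> \<eta>
    using lie_diff[OF that(1) r(3) sec_lie[OF mform_sec[OF m[OF r(2)]] that(2)] mform_sec[OF m[OF bracket_XM[OF that(2) r(2)]]]]
    by simp
  have t: "T (bracket \<xi> (bracket \<eta> \<zeta>) # s) - T (bracket \<eta> (bracket \<xi> \<zeta>) # s) = T (bracket (bracket \<xi> \<eta>) \<zeta> # s)"
    unfolding bracket_jacobi[OF xe r(2), symmetric]
    using fun_lin_diff[OF mform_head[OF Suc.prems(4) r(3)], of "bracket \<xi> (bracket \<eta> \<zeta>)" "bracket \<eta> (bracket \<xi> \<zeta>)"] xe r(2)
    by simp
  have "L \<xi> r (\<lambda>r. L \<eta> r T) - L \<eta> r (\<lambda>r. L \<xi> r T) - L (bracket \<xi> \<eta>) r T =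
      L \<xi> s (\<lambda>r. L \<eta> r (?T \<zeta>)) - L \<eta> s (\<lambda>r. L \<xi> r (?T \<zeta>)) - L (bracket \<xi> \<eta>) s (?T \<zeta>)"
    using e[OF xe] e[OF xe(2,1)] t unfolding r(1) by (simp add: algebra_simps)
  also have "\<dots> \<in> N" by (rule Suc.IH[OF xe r(3) m[OF r(2)]])
  finally show ?case .
qed (simp add: curv)

text \<open>Cartan's formula at the head of the list reduces this commutator to a commutator of two
  Lie derivatives and to the same statement for \<open>T\<close> with the head inserted.\<close>

lemma lie_ed_commutator:
  "\<xi> \<in> XM \<Longrightarrow> r \<in> tuples (Suc k) XM \<Longrightarrow> mform k T \<Longrightarrow>
    L \<xi> r (\<lambda>r. d r T) - d r (\<lambda>r. L \<xi> r T) \<in> N"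
proof (induction k arbitrary: r T)
  case 0
  then show ?case by (auto elim!: tuples_SucE simp: curv' D_0)
next
  case (Suc k)
  obtain \<eta> s where r: "r = \<eta> # s" "\<eta> \<in> XM" "s \<in> tuples (Suc k) XM" using Suc.prems(2) by (rule tuples_SucE)
  let ?T = "\<lambda>\<zeta> r. T (\<zeta> # r)"
  note x = Suc.prems(1) and m = mform_Cons[OF Suc.prems(3)]
  have b: "bracket \<xi> \<eta> \<in> XM" using x r by simp
  have e1: "L \<xi> s (\<lambda>r. d (\<eta> # r) T) = L \<xi> s (\<lambda>r. L \<eta> r T) - L \<xi> s (\<lambda>r. d r (?T \<eta>))"
    using lie_diff[OF x r(3) sec_lie[OF mform_sec[OF Suc.prems(3)] r(2)] sec_ed[OF m[OF r(2)]]] by simp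
  have e2: "d s (\<lambda>r. L \<xi> (\<eta> # r) T) = d s (\<lambda>r. L \<xi> r (?T \<eta>)) - d s (?T (bracket \<xi> \<eta>))"
    using ed_diff[OF r(3) sec_lie[OF mform_sec[OF m[OF r(2)]] x] mform_sec[OF m[OF b]]] by simp
  have "L \<xi> r (\<lambda>r. d r T) - d r (\<lambda>r. L \<xi> r T) =
      (L \<xi> s (\<lambda>r. L \<eta> r T) - L \<eta> s (\<lambda>r. L \<xi> r T) - L (bracket \<xi> \<eta>) s T) -
      (L \<xi> s (\<lambda>r. d r (?T \<eta>)) - d s (\<lambda>r. L \<xi> r (?T \<eta>)))"
    unfolding r(1) lie.simps(2) ed.simps(2) e1[unfolded ed.simps(2)] e2[unfolded lie.simps(2)]
    by (simp only: algebra_simps)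
  also have "\<dots> \<in> N"
    by (intro Ndiff lie_commutator[OF x r(2,3) Suc.prems(3)] Suc.IH[OF x r(3) m[OF r(2)]])
  finally show ?case .
qed

text \<open>By Cartan's formula, d d at \<open>\<xi> # s\<close> is the commutator of d with the Lie
  derivative along \<xi>, plus d d of \<open>T\<close> with \<xi> inserted.\<close>

lemma ed_ed:
  "r \<in> tuples (Suc (Suc k)) XM \<Longrightarrow> mform k T \<Longrightarrow> d r (\<lambda>r. d r T) \<in> N"
proof (induction k arbitrary: r T)
  case 0
  then show ?case by (auto elim!: tuples_SucE simp: curv' D_0)
next
  case (Suc k)
  obtain \<xi> s where r: "r = \<xi> # s" "\<xi> \<in> XM" "s \<in> tuples (Suc (Suc k)) XM" using Suc.prems(1) by (rule tuples_SucE)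
  let ?T = "\<lambda>r. T (\<xi> # r)"
  note m = mform_Cons[OF Suc.prems(2) r(2)]
  have "d s (\<lambda>r. d (\<xi> # r) T) = d s (\<lambda>r. L \<xi> r T) - d s (\<lambda>r. d r ?T)"
    using ed_diff[OF r(3) sec_lie[OF mform_sec[OF Suc.prems(2)] r(2)] sec_ed[OF m]] by simp
  then have "d r (\<lambda>r. d r T) = (L \<xi> s (\<lambda>r. d r T) - d s (\<lambda>r. L \<xi> r T)) + d s (\<lambda>r. d r ?T)"
    unfolding r(1) by (simp add: algebra_simps)
  also have "\<dots> \<in> N"
    by (intro Nadd lie_ed_commutator[OF r(2,3) Suc.prems(2)] Suc.IH[OF r(3) m])
  finally show ?case .
qed

end

text \<open>In \<open>lie\<close> the bracket replaces the j-th argument where it stands, while in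
  the usual formula it comes first. Moving it there past j arguments produces the sign.\<close>

lemma lie_expansion:
  "\<xi> \<in> XM \<Longrightarrow> r \<in> tuples k XM \<Longrightarrow> mform k T \<Longrightarrow>
    L \<xi> r T = D \<xi> (T r) - (\<Sum>j<k. (-1) ^ j *\<^sub>R T (bracket \<xi> (r ! j) # omit j r))"
proof (induction k arbitrary: r T)
  case (Suc k)
  obtain \<zeta> s where r: "r = \<zeta> # s" "\<zeta> \<in> XM" "s \<in> tuples k XM" using Suc.prems(2) by (rule tuples_SucE)
  have sw: "T (\<zeta> # bracket \<xi> (s ! j) # omit j s) = - T (bracket \<xi> (s ! j) # \<zeta> # omit j s)" if j: "j < k" for j
  proof -
    obtain i where k: "k = Suc i" using j by (cases k) auto
    show ?thesis
      by (rule mform_swap[of _ i])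
        (use Suc.prems r j k tuples_omit[of s i XM j] tuples_nth[OF r(3) j] in auto)
  qed
  have "(\<Sum>j<Suc k. (-1) ^ j *\<^sub>R T (bracket \<xi> (r ! j) # omit j r)) =
      T (bracket \<xi> \<zeta> # s) - (\<Sum>j<k. (-1) ^ j *\<^sub>R T (bracket \<xi> (s ! j) # \<zeta> # omit j s))"
    unfolding sum.lessThan_Suc_shift r(1) by (simp add: sum_negf)
  moreover have "(\<Sum>j<k. (-1) ^ j *\<^sub>R T (\<zeta> # bracket \<xi> (s ! j) # omit j s)) =
      - (\<Sum>j<k. (-1) ^ j *\<^sub>R T (bracket \<xi> (s ! j) # \<zeta> # omit j s))"
    using sw by (simp add: sum_negf[symmetric])
  ultimately show ?case
    using Suc.IH[OF Suc.prems(1) r(3) mform_Cons[OF Suc.prems(3) r(2)]] by (simp add: r(1))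
qed simp

lemma sum_pairs_Suc:
  "(\<Sum>(i, j)\<in>{(i, j). i < j \<and> j \<le> Suc k}. F i j) =
    (\<Sum>j\<le>k. F 0 (Suc j)) + (\<Sum>(i, j)\<in>{(i, j). i < j \<and> j \<le> k}. F (Suc i) (Suc j) :: 's::comm_monoid_add)"
proof -
  let ?P = "\<lambda>k. {(i::nat, j). i < j \<and> j \<le> k}"
  have fin: "finite (?P k)" for k
    by (rule finite_subset[of _ "{..k} \<times> {..k}"]) auto
  have eq: "?P (Suc k) = (\<lambda>j. (0, Suc j)) ` {..k} \<union> (\<lambda>(i, j). (Suc i, Suc j)) ` ?P k"
  proof (intro set_eqI)
    fix x :: "nat \<times> nat"
    obtain i j where x: "x = (i, j)" by (cases x)
    show "x \<in> ?P (Suc k) \<longleftrightarrow> x \<in> (\<lambda>j. (0, Suc j)) ` {..k} \<union> (\<lambda>(i, j). (Suc i, Suc j)) ` ?P k"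
      unfolding x by (cases i; cases j) (auto simp: image_iff)
  qed
  have "(\<Sum>(i, j)\<in>?P (Suc k). F i j) =
      (\<Sum>(i, j)\<in>(\<lambda>j. (0, Suc j)) ` {..k}. F i j) + (\<Sum>(i, j)\<in>(\<lambda>(i, j). (Suc i, Suc j)) ` ?P k. F i j)"
    unfolding eq by (rule sum.union_disjoint) (use fin[of k] in auto)
  also have "(\<Sum>(i, j)\<in>(\<lambda>j. (0, Suc j)) ` {..k}. F i j) = (\<Sum>j\<le>k. F 0 (Suc j))"
    by (subst sum.reindex) (auto simp: inj_on_def)
  also have "(\<Sum>(i, j)\<in>(\<lambda>(i, j). (Suc i, Suc j)) ` ?P k. F i j) = (\<Sum>(i, j)\<in>?P k. F (Suc i) (Suc j))"
    by (subst sum.reindex) (auto simp: inj_on_def split_beta intro!: sum.cong)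
  finally show ?thesis .
qed

text \<open>Identifies the recursion with the formula in \<open>cov_ext_deriv\<close>. For pairs of
  arguments behind the head, the minus sign of the recursion is cancelled by moving the bracket in
  front of the head; as both indices grow by one, the sign of the pair is unchanged.\<close>

lemma ed_expansion:
  "r \<in> tuples (Suc k) XM \<Longrightarrow> mform k T \<Longrightarrow>
    d r T = (\<Sum>i\<le>k. (-1) ^ i *\<^sub>R D (r ! i) (T (omit i r))) +
      (\<Sum>(i, j)\<in>{(i, j). i < j \<and> j \<le> k}. (-1) ^ (i + j) *\<^sub>R T (bracket (r ! i) (r ! j) # omit i (omit j r)))"
proof (induction k arbitrary: r T)
  case 0
  have e: "{(i::nat, j). i < j \<and> j \<le> 0} = {}" by auto
  show ?case unfolding e using 0 by (auto elim!: tuples_SucE)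
next
  case (Suc k)
  obtain \<xi> s where r: "r = \<xi> # s" "\<xi> \<in> XM" "s \<in> tuples (Suc k) XM" using Suc.prems(1) by (rule tuples_SucE)
  let ?P = "{(i::nat, j). i < j \<and> j \<le> k}"
  have sw: "T (\<xi> # bracket (s ! i) (s ! j) # omit i (omit j s)) = - T (bracket (s ! i) (s ! j) # \<xi> # omit i (omit j s))"
    if ij: "(i, j) \<in> ?P" for i j
  proof -
    obtain l where k: "k = Suc l" using ij by (cases k) auto
    show ?thesis
      by (rule mform_swap[of _ l])
        (use Suc.prems r ij k tuples_omit[of s k XM j] tuples_omit[of "omit j s" l XM i] tuples_nth[OF r(3)] in auto)
  qed
  have 1: "(\<Sum>(i, j)\<in>?P. (-1) ^ (i + j) *\<^sub>R T (\<xi> # bracket (s ! i) (s ! j) # omit i (omit j s))) =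
      - (\<Sum>(i, j)\<in>?P. (-1) ^ (i + j) *\<^sub>R T (bracket (s ! i) (s ! j) # \<xi> # omit i (omit j s)))"
    unfolding sum_negf[symmetric] by (rule sum.cong) (use sw in auto)
  have IH: "d s (\<lambda>r. T (\<xi> # r)) = (\<Sum>i\<le>k. (-1) ^ i *\<^sub>R D (s ! i) (T (\<xi> # omit i s))) -
      (\<Sum>(i, j)\<in>?P. (-1) ^ (i + j) *\<^sub>R T (bracket (s ! i) (s ! j) # \<xi> # omit i (omit j s)))"
    unfolding Suc.IH[OF r(3) mform_Cons[OF Suc.prems(2) r(2)]] 1 by simp
  have li: "L \<xi> s T = D \<xi> (T s) - (\<Sum>j\<le>k. (-1) ^ j *\<^sub>R T (bracket \<xi> (s ! j) # omit j s))"
    using lie_expansion[OF r(2,3) Suc.prems(2)] by (simp only: lessThan_Suc_atMost)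
  have 2: "(\<Sum>i\<le>Suc k. (-1) ^ i *\<^sub>R D (r ! i) (T (omit i r))) =
      D \<xi> (T s) - (\<Sum>i\<le>k. (-1) ^ i *\<^sub>R D (s ! i) (T (\<xi> # omit i s)))"
    unfolding sum.atMost_Suc_shift r(1) by (simp add: sum_negf)
  have 3: "(\<Sum>(i, j)\<in>{(i, j). i < j \<and> j \<le> Suc k}. (-1) ^ (i + j) *\<^sub>R T (bracket (r ! i) (r ! j) # omit i (omit j r))) =
      - (\<Sum>j\<le>k. (-1) ^ j *\<^sub>R T (bracket \<xi> (s ! j) # omit j s)) +
      (\<Sum>(i, j)\<in>?P. (-1) ^ (i + j) *\<^sub>R T (bracket (s ! i) (s ! j) # \<xi> # omit i (omit j s)))"
    unfolding sum_pairs_Suc r(1) by (simp add: sum_negf)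
  show ?case
    unfolding 2 3 unfolding r(1) ed.simps li IH by (simp add: algebra_simps)
qed

lemma cov_ext_deriv:
  assumes \<phi>: "\<phi> \<in> forms A E k"
  shows cov_ext_deriv_form: "cov_ext_deriv A E D k \<phi> \<in> forms A E (Suc k)"
    and eval_cov_ext_deriv: "r \<in> tuples (Suc k) XM \<Longrightarrow> eval (cov_ext_deriv A E D k \<phi>) r = d r (eval \<phi>)"
proof -
  let ?c = "cov_ext_deriv A E D k \<phi>"
  obtain \<omega> where w: "\<omega> \<in> forms A E (Suc k)" "\<And>r. r \<in> tuples (Suc k) XM \<Longrightarrow> eval \<omega> r = d r (eval \<phi>)"
    by (rule form_of_mform[OF ed_mform[OF eval_mform[OF \<phi>]]]) blast
  note e = ed_expansion[OF _ eval_mform[OF \<phi>]]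
  have "?c = \<omega>"
    unfolding cov_ext_deriv_def
  proof (rule the_equality)
    show "\<omega> \<in> forms A E (Suc k) \<and> (\<forall>\<xi>s\<in>tuples (Suc k) XM.
        eval \<omega> \<xi>s =
          (\<Sum>i\<le>k. (-1) ^ i *\<^sub>R D (\<xi>s ! i) (eval \<phi> (omit i \<xi>s))) +
          (\<Sum>(i, j)\<in>{(i, j). i < j \<and> j \<le> k}.
             (-1) ^ (i + j) *\<^sub>R eval \<phi> (bracket (\<xi>s ! i) (\<xi>s ! j) # omit i (omit j \<xi>s))))"
      using w e by simp
    fix \<omega>' assume w': "\<omega>' \<in> forms A E (Suc k) \<and> (\<forall>\<xi>s\<in>tuples (Suc k) XM.
        eval \<omega>' \<xi>s =
          (\<Sum>i\<le>k. (-1) ^ i *\<^sub>R D (\<xi>s ! i) (eval \<phi> (omit i \<xi>s))) +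
          (\<Sum>(i, j)\<in>{(i, j). i < j \<and> j \<le> k}.
             (-1) ^ (i + j) *\<^sub>R eval \<phi> (bracket (\<xi>s ! i) (\<xi>s ! j) # omit i (omit j \<xi>s))))"
    show "\<omega>' = \<omega>"
      by (rule form_eqI[of _ "Suc k"]) (use w w' e in auto)
  qed
  then show "?c \<in> forms A E (Suc k)" "r \<in> tuples (Suc k) XM \<Longrightarrow> eval ?c r = d r (eval \<phi>)"
    using w by auto
qed

lemma eval_lincomb: "eval (a *\<^sub>R \<phi> + b *\<^sub>R \<psi>) r = (\<lambda>p. a) \<odot> eval \<phi> r + (\<lambda>p. b) \<odot> eval \<psi> r"
  by (simp add: eval_def fun_eq_iff pw)

lemma lie_scaleR: "\<xi> \<in> XM \<Longrightarrow> r \<in> tuples k XM \<Longrightarrow> sec k T \<Longrightarrow> L \<xi> r (\<lambda>r. (\<lambda>p. c) \<odot> T r) = (\<lambda>p. c) \<odot> L \<xi> r T"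
proof -
  assume a: "\<xi> \<in> XM" "r \<in> tuples k XM" "sec k T"
  have "(\<lambda>p. \<xi> p (\<lambda>q. c)) \<odot> T r = 0"
    using tangent_const[OF XM_tangent[OF a(1)]] by (simp add: fun_eq_iff pw)
  then show ?thesis using lie_fsc[OF a(1) smooth_const a(2,3)] by simp
qed

lemma ed_scaleR: "r \<in> tuples (Suc k) XM \<Longrightarrow> sec k T \<Longrightarrow> d r (\<lambda>r. (\<lambda>p. c) \<odot> T r) = (\<lambda>p. c) \<odot> d r T"
proof (induction k arbitrary: r T)
  case 0
  then show ?case by (auto elim!: tuples_SucE simp: fsc_const D_scaleR)
next
  case (Suc k)
  obtain \<zeta> s where r: "r = \<zeta> # s" "\<zeta> \<in> XM" "s \<in> tuples (Suc k) XM" using Suc.prems(1) by (rule tuples_SucE)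
  have "d s (\<lambda>r. (\<lambda>p. c) \<odot> T (\<zeta> # r)) = (\<lambda>p. c) \<odot> d s (\<lambda>r. T (\<zeta> # r))"
    by (rule Suc.IH) (use Suc.prems r in auto)
  then show ?case using r lie_scaleR[OF r(2,3) Suc.prems(2)] by (simp add: fsc_diff)
qed

lemma cov_ext_deriv_lin_on: "lin_on (forms A E k) (cov_ext_deriv A E D k)"
  unfolding lin_on_def
proof (intro ballI allI)
  fix \<phi> \<psi> and a b :: real assume p: "\<phi> \<in> forms A E k" "\<psi> \<in> forms A E k"
  let ?c = "cov_ext_deriv A E D k" and ?S = "a *\<^sub>R \<phi> + b *\<^sub>R \<psi>"
  note sub = subspace_add[OF forms_subspace subspace_scale[OF forms_subspace] subspace_scale[OF forms_subspace]]
  have S: "?S \<in> forms A E k" using sub p by blast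
  note s = mform_sec[OF eval_mform[OF p(1)]] mform_sec[OF eval_mform[OF p(2)]]
  have sf: "sec k (\<lambda>r. (\<lambda>p. a) \<odot> eval \<phi> r)" "sec k (\<lambda>r. (\<lambda>p. b) \<odot> eval \<psi> r)"
    using s section_fsc[OF smooth_const] by auto
  have "eval (?c ?S) r = eval (a *\<^sub>R ?c \<phi> + b *\<^sub>R ?c \<psi>) r" if r: "r \<in> tuples (Suc k) XM" for r
  proof -
    have "d r (eval ?S) = d r (\<lambda>r. (\<lambda>p. a) \<odot> eval \<phi> r + (\<lambda>p. b) \<odot> eval \<psi> r)"
      by (rule ed_cong[OF r eval_lincomb])
    also have "\<dots> = (\<lambda>p. a) \<odot> d r (eval \<phi>) + (\<lambda>p. b) \<odot> d r (eval \<psi>)"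
      by (simp only: ed_add[OF r sf] ed_scaleR[OF r s(1)] ed_scaleR[OF r s(2)])
    finally show ?thesis
      by (simp only: eval_lincomb eval_cov_ext_deriv[OF S r] eval_cov_ext_deriv[OF p(1) r] eval_cov_ext_deriv[OF p(2) r])
  qed
  then show "?c ?S = a *\<^sub>R ?c \<phi> + b *\<^sub>R ?c \<psi>"
    by (intro form_eqI[OF cov_ext_deriv_form[OF S] sub[OF cov_ext_deriv_form[OF p(1)] cov_ext_deriv_form[OF p(2)]]])
qed

end

section \<open>The Levi-Civita connection and curvature\<close>

definition act :: "('a \<Rightarrow> 'a endo) \<Rightarrow> 'a vfield \<Rightarrow> 'a vfield" where
  "act \<Phi> \<eta> = (\<lambda>p. \<Phi> p (\<eta> p))"

lemma act_plus: "act (\<Phi> + \<Psi>) \<eta> = act \<Phi> \<eta> + act \<Psi> \<eta>"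
  by (simp add: fun_eq_iff act_def pw)

lemma act_minus: "act (\<Phi> - \<Psi>) \<eta> = act \<Phi> \<eta> - act \<Psi> \<eta>"
  by (simp add: fun_eq_iff act_def pw)

lemma act_uminus: "act (- \<Phi>) \<eta> = - act \<Phi> \<eta>"
  by (simp add: fun_eq_iff act_def pw)

lemma act_fsc_left: "act (f \<odot> \<Phi>) \<eta> = f \<odot> act \<Phi> \<eta>"
  by (simp add: fun_eq_iff act_def pw)

lemma act_0: "act 0 \<eta> = 0"
  by (simp add: fun_eq_iff act_def pw)

locale riemannian = atlas A
  for A :: "('a::t2_space, 'e::euclidean_space) chart set" +
  fixes g :: "'a metric" and nabla :: "'a connection"
  assumes metric: "riemannian_metric A g" and levi_civita: "levi_civita A g nabla"
begin

section \<open>The metric at a point and on vector fields\<close>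

lemma g_lin: "v \<in> Tan p \<Longrightarrow> u \<in> Tan p \<Longrightarrow> w \<in> Tan p \<Longrightarrow> g p v (a *\<^sub>R u + b *\<^sub>R w) = a * g p v u + b * g p v w"
  using metric unfolding riemannian_metric_def lin_on_def by auto

lemma g_sym: "v \<in> Tan p \<Longrightarrow> w \<in> Tan p \<Longrightarrow> g p v w = g p w v"
  using metric unfolding riemannian_metric_def by blast

lemma g_pos: "v \<in> Tan p \<Longrightarrow> v \<noteq> 0 \<Longrightarrow> g p v v > 0"
  using metric unfolding riemannian_metric_def by blast

lemma Tan_add: "v \<in> Tan p \<Longrightarrow> w \<in> Tan p \<Longrightarrow> v + w \<in> Tan p"
  by (rule subspace_add[OF tangent_subspace])

lemma Tan_scaleR: "v \<in> Tan p \<Longrightarrow> c *\<^sub>R v \<in> Tan p"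
  by (rule subspace_scale[OF tangent_subspace])

lemma Tan_0: "0 \<in> Tan p"
  by (rule subspace_0[OF tangent_subspace])

lemma Tan_diff: "v \<in> Tan p \<Longrightarrow> w \<in> Tan p \<Longrightarrow> v - w \<in> Tan p"
  by (rule subspace_diff[OF tangent_subspace])

lemma Tan_uminus: "v \<in> Tan p \<Longrightarrow> - v \<in> Tan p"
  by (rule subspace_neg[OF tangent_subspace])

lemma
  assumes "v \<in> Tan p" "u \<in> Tan p" "w \<in> Tan p"
  shows g_add_right: "g p v (u + w) = g p v u + g p v w"
    and g_add_left: "g p (u + w) v = g p u v + g p w v"
    and g_diff_right: "g p v (u - w) = g p v u - g p v w"
    and g_diff_left: "g p (u - w) v = g p u v - g p w v"
  using g_lin[OF assms, of 1 1] g_lin[OF assms, of 1 "-1"] g_sym[OF assms(1) Tan_add[OF assms(2,3)]]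
    g_sym[OF assms(1) Tan_diff[OF assms(2,3)]] g_sym[OF assms(1,2)] g_sym[OF assms(1,3)]
  by simp_all

lemma
  assumes "v \<in> Tan p" "u \<in> Tan p"
  shows g_scaleR_right: "g p v (c *\<^sub>R u) = c * g p v u"
    and g_scaleR_left: "g p (c *\<^sub>R u) v = c * g p u v"
    and g_minus_left: "g p (- u) v = - g p u v"
  using g_lin[OF assms(1,2,2), of c 0] g_lin[OF assms(1,2,2), of "-1" 0]
    g_sym[OF assms(1) Tan_scaleR[OF assms(2)]] g_sym[OF assms(1) Tan_uminus[OF assms(2)]] g_sym[OF assms]
  by simp_all

lemma g_zero: "v \<in> Tan p \<Longrightarrow> g p v 0 = 0" "v \<in> Tan p \<Longrightarrow> g p 0 v = 0"
  using g_scaleR_right[of v p v 0] g_scaleR_left[of v p v 0] by simp_all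

lemma g_nondegenerate:
  assumes "v \<in> Tan p" "w \<in> Tan p" "\<And>u. u \<in> Tan p \<Longrightarrow> g p v u = g p w u"
  shows "v = w"
proof (rule ccontr)
  assume "v \<noteq> w"
  then have "g p (v - w) (v - w) > 0" using g_pos[OF Tan_diff[OF assms(1,2)]] by simp
  moreover have "g p (v - w) (v - w) = 0"
    using g_diff_left[OF Tan_diff[OF assms(1,2)] assms(1,2)] assms(3)[OF Tan_diff[OF assms(1,2)]] by simp
  ultimately show False by simp
qed

definition gf :: "'a vfield \<Rightarrow> 'a vfield \<Rightarrow> 'a \<Rightarrow> real" where
  "gf \<xi> \<eta> = (\<lambda>p. g p (\<xi> p) (\<eta> p))"

lemma gf_CM [simp, intro]: "\<xi> \<in> XM \<Longrightarrow> \<eta> \<in> XM \<Longrightarrow> gf \<xi> \<eta> \<in> CM"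
  using metric unfolding riemannian_metric_def gf_def by blast

lemma gf_sym: "\<xi> \<in> XM \<Longrightarrow> \<eta> \<in> XM \<Longrightarrow> gf \<xi> \<eta> = gf \<eta> \<xi>"
  by (simp add: gf_def fun_eq_iff g_sym[OF XM_tangent XM_tangent])

lemma
  assumes "\<xi> \<in> XM" "\<eta> \<in> XM" "\<zeta> \<in> XM"
  shows gf_add_right: "gf \<xi> (\<eta> + \<zeta>) = gf \<xi> \<eta> + gf \<xi> \<zeta>"
    and gf_add_left: "gf (\<eta> + \<zeta>) \<xi> = gf \<eta> \<xi> + gf \<zeta> \<xi>"
    and gf_diff_right: "gf \<xi> (\<eta> - \<zeta>) = gf \<xi> \<eta> - gf \<xi> \<zeta>"
    and gf_diff_left: "gf (\<eta> - \<zeta>) \<xi> = gf \<eta> \<xi> - gf \<zeta> \<xi>"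
  using XM_tangent[OF assms(1)] XM_tangent[OF assms(2)] XM_tangent[OF assms(3)]
  by (simp_all add: gf_def fun_eq_iff pw g_add_right g_add_left g_diff_right g_diff_left)

lemma
  assumes "\<xi> \<in> XM" "\<eta> \<in> XM"
  shows gf_fsc_right: "gf \<xi> (f \<odot> \<eta>) = f * gf \<xi> \<eta>"
    and gf_fsc_left: "gf (f \<odot> \<eta>) \<xi> = f * gf \<eta> \<xi>"
    and gf_minus_left: "gf (- \<eta>) \<xi> = - gf \<eta> \<xi>"
  using XM_tangent[OF assms(1)] XM_tangent[OF assms(2)]
  by (simp_all add: gf_def fun_eq_iff pw g_scaleR_right g_scaleR_left g_minus_left)

lemma XM_uminus [simp, intro]: "\<xi> \<in> XM \<Longrightarrow> - \<xi> \<in> XM"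
  using XM_scaleR[of \<xi> "-1"] by simp

lemma bracket_minus_right:
  assumes "\<xi> \<in> XM" "\<eta> \<in> XM" shows "bracket \<xi> (- \<eta>) = - bracket \<xi> \<eta>"
proof -
  have "bracket \<xi> 0 = 0" using bracket_add_right[OF assms(1) XM_0 XM_0] by simp
  then show ?thesis
    using bracket_add_right[OF assms(1,2) XM_uminus[OF assms(2)]] by (simp add: eq_neg_iff_add_eq_0 add.commute)
qed

lemma XM_eqI:
  assumes "\<xi> \<in> XM" "\<eta> \<in> XM" "\<And>\<zeta>. \<zeta> \<in> XM \<Longrightarrow> gf \<xi> \<zeta> = gf \<eta> \<zeta>"
  shows "\<xi> = \<eta>"
proof
  fix p show "\<xi> p = \<eta> p"
  proof (rule g_nondegenerate[OF XM_tangent[OF assms(1)] XM_tangent[OF assms(2)]])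
    fix u assume "u \<in> Tan p"
    then obtain \<zeta> where "\<zeta> \<in> XM" "\<zeta> p = u" by (rule vfield_through)
    then show "g p (\<xi> p) u = g p (\<eta> p) u" using fun_cong[OF assms(3), of \<zeta> p] by (simp add: gf_def)
  qed
qed

section \<open>Rules for the Levi-Civita connection\<close>

lemma nabla_XM [simp, intro]: "\<xi> \<in> XM \<Longrightarrow> \<eta> \<in> XM \<Longrightarrow> nabla \<xi> \<eta> \<in> XM"
  using levi_civita unfolding levi_civita_def by blast

lemma nabla_add_left: "\<xi> \<in> XM \<Longrightarrow> \<eta> \<in> XM \<Longrightarrow> \<zeta> \<in> XM \<Longrightarrow> nabla (\<xi> + \<eta>) \<zeta> = nabla \<xi> \<zeta> + nabla \<eta> \<zeta>"
  using levi_civita unfolding levi_civita_def by blast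

lemma nabla_add_right: "\<xi> \<in> XM \<Longrightarrow> \<eta> \<in> XM \<Longrightarrow> \<zeta> \<in> XM \<Longrightarrow> nabla \<xi> (\<eta> + \<zeta>) = nabla \<xi> \<eta> + nabla \<xi> \<zeta>"
  using levi_civita unfolding levi_civita_def by blast

lemma nabla_fsc_left: "f \<in> CM \<Longrightarrow> \<xi> \<in> XM \<Longrightarrow> \<eta> \<in> XM \<Longrightarrow> nabla (f \<odot> \<xi>) \<eta> = f \<odot> nabla \<xi> \<eta>"
  using levi_civita unfolding levi_civita_def fsc_def by blast

lemma nabla_fsc_right:
  assumes "f \<in> CM" "\<xi> \<in> XM" "\<eta> \<in> XM"
  shows "nabla \<xi> (f \<odot> \<eta>) = f \<odot> nabla \<xi> \<eta> + (\<lambda>p. \<xi> p f) \<odot> \<eta>"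
proof -
  have "nabla \<xi> (\<lambda>p. f p *\<^sub>R \<eta> p) = (\<lambda>p. f p *\<^sub>R nabla \<xi> \<eta> p + \<xi> p f *\<^sub>R \<eta> p)"
    using assms levi_civita unfolding levi_civita_def by blast
  then show ?thesis by (simp add: fsc_def plus_fun_def)
qed

lemma nabla_metric:
  assumes "\<xi> \<in> XM" "\<eta> \<in> XM" "\<zeta> \<in> XM"
  shows "(\<lambda>p. \<xi> p (gf \<eta> \<zeta>)) = gf (nabla \<xi> \<eta>) \<zeta> + gf \<eta> (nabla \<xi> \<zeta>)"
  using assms levi_civita unfolding levi_civita_def gf_def by (simp add: fun_eq_iff pw)

lemma nabla_torsion: "\<xi> \<in> XM \<Longrightarrow> \<eta> \<in> XM \<Longrightarrow> nabla \<xi> \<eta> - nabla \<eta> \<xi> = bracket \<xi> \<eta>"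
  using levi_civita unfolding levi_civita_def by blast

sublocale TMb: bundle_connection A "TM A" nabla
  by unfold_locales (auto simp: TM_def tangent_subspace XM_tangent nabla_add_left nabla_add_right nabla_fsc_left nabla_fsc_right)

lemma sections_TM [simp]: "sections (TM A) = XM" and fibre_TM [simp]: "fibre (TM A) = tangent_space A"
  by (simp_all add: TM_def)

lemmas nabla_diff_right = TMb.D_diff[unfolded sections_TM]

section \<open>The bundle o(TM) and its connection\<close>

abbreviation "OM \<equiv> sections (skewTM A g)"

lemma OM_iff: "\<Phi> \<in> OM \<longleftrightarrow> (\<forall>p. \<Phi> p \<in> skew_endos A g p) \<and> (\<forall>\<eta>\<in>XM. act \<Phi> \<eta> \<in> XM)"
  by (simp add: skewTM_def act_def)

lemma fibre_skewTM [simp]: "fibre (skewTM A g) = skew_endos A g"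
  by (simp add: skewTM_def)

lemma skew_endo_lin: "F \<in> skew_endos A g p \<Longrightarrow> v \<in> Tan p \<Longrightarrow> w \<in> Tan p \<Longrightarrow> F (a *\<^sub>R v + b *\<^sub>R w) = a *\<^sub>R F v + b *\<^sub>R F w"
  unfolding skew_endos_def lin_on_def by blast

lemma skew_endo_Tan: "F \<in> skew_endos A g p \<Longrightarrow> v \<in> Tan p \<Longrightarrow> F v \<in> Tan p"
  unfolding skew_endos_def by blast

lemma skew_endo_outside: "F \<in> skew_endos A g p \<Longrightarrow> v \<notin> Tan p \<Longrightarrow> F v = 0"
  unfolding skew_endos_def by blast

lemma skew_endo_skew: "F \<in> skew_endos A g p \<Longrightarrow> v \<in> Tan p \<Longrightarrow> w \<in> Tan p \<Longrightarrow> g p (F v) w = - g p v (F w)"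
  unfolding skew_endos_def by blast

lemma skew_endosI:
  assumes "\<And>v. v \<notin> Tan p \<Longrightarrow> F v = 0" "\<And>v. v \<in> Tan p \<Longrightarrow> F v \<in> Tan p"
    "\<And>v w a b. v \<in> Tan p \<Longrightarrow> w \<in> Tan p \<Longrightarrow> F (a *\<^sub>R v + b *\<^sub>R w) = a *\<^sub>R F v + b *\<^sub>R F w"
    "\<And>v w. v \<in> Tan p \<Longrightarrow> w \<in> Tan p \<Longrightarrow> g p (F v) w = - g p v (F w)"
  shows "F \<in> skew_endos A g p"
  unfolding skew_endos_def lin_on_def using assms by auto

lemma act_XM [simp, intro]: "\<Phi> \<in> OM \<Longrightarrow> \<eta> \<in> XM \<Longrightarrow> act \<Phi> \<eta> \<in> XM"
  by (simp add: OM_iff)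

lemma OM_skew: "\<Phi> \<in> OM \<Longrightarrow> \<Phi> p \<in> skew_endos A g p"
  by (simp add: OM_iff)

lemma skew_endos_subspace: "subspace (skew_endos A g p)"
  unfolding subspace_def
proof (intro conjI ballI allI)
  show "0 \<in> skew_endos A g p"
    by (rule skew_endosI) (auto simp: pw Tan_0 g_zero)
  show "F + G \<in> skew_endos A g p" if F: "F \<in> skew_endos A g p" and G: "G \<in> skew_endos A g p" for F G
    by (rule skew_endosI) (auto simp: pw skew_endo_outside[OF F] skew_endo_outside[OF G] Tan_add skew_endo_Tan[OF F] skew_endo_Tan[OF G]
        skew_endo_lin[OF F] skew_endo_lin[OF G] g_add_left g_add_right skew_endo_skew[OF F] skew_endo_skew[OF G] algebra_simps)
  show "c *\<^sub>R F \<in> skew_endos A g p" if F: "F \<in> skew_endos A g p" for F c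
    by (rule skew_endosI) (auto simp: pw skew_endo_outside[OF F] Tan_scaleR skew_endo_Tan[OF F]
        skew_endo_lin[OF F] g_scaleR_left g_scaleR_right skew_endo_skew[OF F] algebra_simps)
qed

lemma
  assumes P: "\<Phi> \<in> OM" and e: "\<eta> \<in> XM"
  shows act_add: "\<zeta> \<in> XM \<Longrightarrow> act \<Phi> (\<eta> + \<zeta>) = act \<Phi> \<eta> + act \<Phi> \<zeta>"
    and act_diff: "\<zeta> \<in> XM \<Longrightarrow> act \<Phi> (\<eta> - \<zeta>) = act \<Phi> \<eta> - act \<Phi> \<zeta>"
    and act_fsc: "act \<Phi> (f \<odot> \<eta>) = f \<odot> act \<Phi> \<eta>"
proof -
  note l = skew_endo_lin[OF OM_skew[OF P] XM_tangent[OF e] XM_tangent]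
  show "act \<Phi> (\<eta> + \<zeta>) = act \<Phi> \<eta> + act \<Phi> \<zeta>" if "\<zeta> \<in> XM"
    using l[OF that, where a = 1 and b = 1] by (simp add: fun_eq_iff act_def pw)
  show "act \<Phi> (\<eta> - \<zeta>) = act \<Phi> \<eta> - act \<Phi> \<zeta>" if "\<zeta> \<in> XM"
    using l[OF that, where a = 1 and b = "-1"] by (simp add: fun_eq_iff act_def pw)
  show "act \<Phi> (f \<odot> \<eta>) = f \<odot> act \<Phi> \<eta>"
    using l[OF e, where b = 0] by (simp add: fun_eq_iff act_def pw)
qed

lemma act_skew:
  assumes "\<Phi> \<in> OM" "\<eta> \<in> XM" "\<zeta> \<in> XM" shows "gf (act \<Phi> \<eta>) \<zeta> = - gf \<eta> (act \<Phi> \<zeta>)"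
  using skew_endo_skew[OF OM_skew[OF assms(1)] XM_tangent[OF assms(2)] XM_tangent[OF assms(3)]]
  by (simp add: fun_eq_iff gf_def act_def pw)

sublocale OMb: vector_bundle A "skewTM A g"
proof unfold_locales
  show z: "0 \<in> OM"
    unfolding OM_iff by (auto simp: act_0 pw subspace_0[OF skew_endos_subspace])
  show "\<Phi> + \<Psi> \<in> OM" if "\<Phi> \<in> OM" "\<Psi> \<in> OM" for \<Phi> \<Psi>
    using that unfolding OM_iff by (auto simp: act_plus pw intro: subspace_add[OF skew_endos_subspace])
  show "f \<odot> \<Phi> \<in> OM" if "f \<in> CM" "\<Phi> \<in> OM" for f \<Phi>
    using that unfolding OM_iff by (auto simp: act_fsc_left pw intro: subspace_scale[OF skew_endos_subspace])
qed (auto simp: skew_endos_subspace OM_skew)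

lemma OM_eqI:
  assumes "\<Phi> \<in> OM" "\<Psi> \<in> OM" "\<And>\<eta>. \<eta> \<in> XM \<Longrightarrow> act \<Phi> \<eta> = act \<Psi> \<eta>"
  shows "\<Phi> = \<Psi>"
proof (rule ext, rule ext)
  fix p v
  show "\<Phi> p v = \<Psi> p v"
  proof (cases "v \<in> Tan p")
    case True
    then obtain \<eta> where "\<eta> \<in> XM" "\<eta> p = v" by (rule vfield_through)
    then show ?thesis using fun_cong[OF assms(3), of \<eta> p] by (simp add: act_def)
  next
    case False
    then show ?thesis
      using skew_endo_outside[OF OM_skew[OF assms(1)] False] skew_endo_outside[OF OM_skew[OF assms(2)] False] by simp
  qed
qed

text \<open>An endomorphism of TM is a TM-valued 1-form, so the passage to points is the one for
  forms.\<close>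

lemma endo_of_fun_lin:
  assumes S: "fun_lin S" "\<And>\<eta>. \<eta> \<in> XM \<Longrightarrow> S \<eta> \<in> XM"
    and skew: "\<And>\<eta> \<zeta>. \<eta> \<in> XM \<Longrightarrow> \<zeta> \<in> XM \<Longrightarrow> gf (S \<eta>) \<zeta> = - gf \<eta> (S \<zeta>)"
  obtains \<Phi> where "\<Phi> \<in> OM" "\<And>\<eta>. \<eta> \<in> XM \<Longrightarrow> act \<Phi> \<eta> = S \<eta>"
proof -
  have "TMb.mform (Suc 0) (\<lambda>r. S (hd r))" using S by simp
  then obtain \<phi> where \<phi>: "\<phi> \<in> forms A (TM A) (Suc 0)" "\<And>r. r \<in> tuples (Suc 0) XM \<Longrightarrow> eval \<phi> r = S (hd r)"
    by (rule TMb.form_of_mform) (rule that)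
  define \<Phi> where "\<Phi> p v = \<phi> p [v]" for p v
  have ev: "act \<Phi> \<eta> = S \<eta>" if "\<eta> \<in> XM" for \<eta>
    using \<phi>(2)[of "[\<eta>]"] that by (simp add: fun_eq_iff act_def \<Phi>_def eval_def)
  have a: "\<phi> p \<in> alt_maps (Suc 0) (Tan p) (Tan p)" for p
    using \<phi>(1) unfolding forms_def by simp
  have "\<Phi> p \<in> skew_endos A g p" for p
  proof (rule skew_endosI)
    show "\<Phi> p v = 0" if "v \<notin> Tan p" for v
      using TMb.form_outside[OF \<phi>(1), of "[v]" p] that by (simp add: \<Phi>_def)
    show "\<Phi> p v \<in> Tan p" if "v \<in> Tan p" for v
      using a[of p] that unfolding alt_maps_def \<Phi>_def by simp
    show "\<Phi> p (c *\<^sub>R v + b *\<^sub>R w) = c *\<^sub>R \<Phi> p v + b *\<^sub>R \<Phi> p w" if vw: "v \<in> Tan p" "w \<in> Tan p" for v w c b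
    proof -
      have "\<forall>vs\<in>tuples (Suc 0) (Tan p). \<forall>i<Suc 0. lin_on (Tan p) (\<lambda>v. \<phi> p (vs[i := v]))"
        using a[of p] unfolding alt_maps_def by blast
      moreover have "[v] \<in> tuples (Suc 0) (Tan p)" using vw by simp
      ultimately have "lin_on (Tan p) (\<lambda>u. \<phi> p ([v][0 := u]))" by blast
      then show ?thesis using vw by (simp add: lin_on_def \<Phi>_def)
    qed
    show "g p (\<Phi> p v) w = - g p v (\<Phi> p w)" if vw: "v \<in> Tan p" "w \<in> Tan p" for v w
    proof -
      obtain \<eta> \<zeta> where e: "\<eta> \<in> XM" "\<eta> p = v" "\<zeta> \<in> XM" "\<zeta> p = w" using vw vfield_through by metis
      have "gf (act \<Phi> \<eta>) \<zeta> p = - gf \<eta> (act \<Phi> \<zeta>) p" using skew[OF e(1,3)] ev[OF e(1)] ev[OF e(3)] by (simp add: pw)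
      then show ?thesis using e by (simp add: gf_def act_def)
    qed
  qed
  then have "\<Phi> \<in> OM" using ev S(2) by (simp add: OM_iff)
  then show thesis using that ev by blast
qed

abbreviation "ns \<equiv> nabla_skew A g nabla"

lemma nabla_skew:
  assumes x: "\<xi> \<in> XM" and P: "\<Phi> \<in> OM"
  shows ns_OM: "ns \<xi> \<Phi> \<in> OM"
    and act_ns: "\<eta> \<in> XM \<Longrightarrow> act (ns \<xi> \<Phi>) \<eta> = nabla \<xi> (act \<Phi> \<eta>) - act \<Phi> (nabla \<xi> \<eta>)"
proof -
  let ?S = "\<lambda>\<eta>. nabla \<xi> (act \<Phi> \<eta>) - act \<Phi> (nabla \<xi> \<eta>)"
  have fl: "fun_lin ?S"
    by (rule fun_linI) (use x P in \<open>simp_all add: act_add act_fsc nabla_add_right nabla_fsc_right fsc_diff\<close>)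
  \<comment> \<open>Differentiate g(\<Phi> \<eta>, \<zeta>) = - g(\<eta>, \<Phi> \<zeta>) along
    \<xi>, using that the connection is metric on both sides.\<close>
  have sk: "gf (?S \<eta>) \<zeta> = - gf \<eta> (?S \<zeta>)" if e: "\<eta> \<in> XM" and z: "\<zeta> \<in> XM" for \<eta> \<zeta>
  proof -
    have "gf (act \<Phi> \<eta>) \<zeta> = (\<lambda>p. - gf \<eta> (act \<Phi> \<zeta>) p)" using act_skew[OF P e z] by (simp add: fun_eq_iff pw)
    then have "(\<lambda>p. \<xi> p (gf (act \<Phi> \<eta>) \<zeta>)) = - (\<lambda>p. \<xi> p (gf \<eta> (act \<Phi> \<zeta>)))"
      using tangent_diff[OF XM_tangent[OF x] smooth_const[of 0], of "gf \<eta> (act \<Phi> \<zeta>)"] tangent_const[OF XM_tangent[OF x]] e z P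
      by (simp add: fun_Compl_def)
    then show ?thesis
      using x e z P act_skew[OF P nabla_XM[OF x e] z] act_skew[OF P e nabla_XM[OF x z]]
      by (simp add: nabla_metric gf_diff_left gf_diff_right) (simp add: algebra_simps)
  qed
  obtain \<Theta> where T: "\<Theta> \<in> OM" "\<And>\<eta>. \<eta> \<in> XM \<Longrightarrow> act \<Theta> \<eta> = ?S \<eta>"
    by (rule endo_of_fun_lin[of ?S]) (use fl sk x P in auto)
  have e: "(\<forall>p. \<Psi> p (\<eta> p) = nabla \<xi> (\<lambda>q. \<Phi> q (\<eta> q)) p - \<Phi> p (nabla \<xi> \<eta> p)) \<longleftrightarrow> act \<Psi> \<eta> = ?S \<eta>" for \<Psi> \<eta>
    by (simp add: fun_eq_iff act_def pw)
  have "ns \<xi> \<Phi> = \<Theta>"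
    unfolding nabla_skew_def e
    by (rule the_equality) (use T OM_eqI in auto)
  then show "ns \<xi> \<Phi> \<in> OM" "\<eta> \<in> XM \<Longrightarrow> act (ns \<xi> \<Phi>) \<eta> = ?S \<eta>" using T by auto
qed

sublocale OMb: bundle_connection A "skewTM A g" ns
proof unfold_locales
  show "ns \<xi> \<Phi> \<in> OM" if "\<xi> \<in> XM" "\<Phi> \<in> OM" for \<xi> \<Phi> by (rule ns_OM[OF that])
  show "ns (\<xi> + \<eta>) \<Phi> = ns \<xi> \<Phi> + ns \<eta> \<Phi>" if "\<xi> \<in> XM" "\<eta> \<in> XM" "\<Phi> \<in> OM" for \<xi> \<eta> \<Phi>
    by (rule OM_eqI) (use that in \<open>auto simp: ns_OM OMb.section_add act_ns act_plus nabla_add_left act_add\<close>)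
  show "ns (f \<odot> \<xi>) \<Phi> = f \<odot> ns \<xi> \<Phi>" if "f \<in> CM" "\<xi> \<in> XM" "\<Phi> \<in> OM" for f \<xi> \<Phi>
    by (rule OM_eqI) (use that in \<open>auto simp: ns_OM OMb.section_fsc act_ns act_fsc_left nabla_fsc_left act_fsc fsc_diff\<close>)
  show "ns \<xi> (f \<odot> \<Phi>) = f \<odot> ns \<xi> \<Phi> + (\<lambda>p. \<xi> p f) \<odot> \<Phi>" if "f \<in> CM" "\<xi> \<in> XM" "\<Phi> \<in> OM" for f \<xi> \<Phi>
    by (rule OM_eqI) (use that in \<open>auto simp: ns_OM OMb.section_fsc OMb.section_add act_ns act_fsc_left act_plus nabla_fsc_right fsc_diff\<close>)
  show "ns \<xi> (\<Phi> + \<Psi>) = ns \<xi> \<Phi> + ns \<xi> \<Psi>" if "\<xi> \<in> XM" "\<Phi> \<in> OM" "\<Psi> \<in> OM" for \<xi> \<Phi> \<Psi>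
    by (rule OM_eqI) (use that in \<open>auto simp: ns_OM OMb.section_add act_ns act_plus nabla_add_right\<close>)
qed

section \<open>The Riemann curvature and its symmetries\<close>

definition Rv :: "'a vfield \<Rightarrow> 'a vfield \<Rightarrow> 'a vfield \<Rightarrow> 'a vfield" where
  "Rv \<xi> \<eta> \<zeta> = nabla \<xi> (nabla \<eta> \<zeta>) - nabla \<eta> (nabla \<xi> \<zeta>) - nabla (bracket \<xi> \<eta>) \<zeta>"

lemma Rv_XM [simp, intro]: "\<xi> \<in> XM \<Longrightarrow> \<eta> \<in> XM \<Longrightarrow> \<zeta> \<in> XM \<Longrightarrow> Rv \<xi> \<eta> \<zeta> \<in> XM"
  by (simp add: Rv_def)

lemma Rv_anti: assumes "\<xi> \<in> XM" "\<eta> \<in> XM" "\<zeta> \<in> XM" shows "Rv \<xi> \<eta> \<zeta> = - Rv \<eta> \<xi> \<zeta>"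
proof -
  have "nabla (bracket \<xi> \<eta>) \<zeta> + nabla (bracket \<eta> \<xi>) \<zeta> = nabla (bracket \<xi> \<eta> + bracket \<eta> \<xi>) \<zeta>"
    using assms by (simp add: nabla_add_left)
  also have "bracket \<xi> \<eta> + bracket \<eta> \<xi> = 0" using bracket_anti[of \<xi> \<eta>] by simp
  also have "nabla 0 \<zeta> = 0" using nabla_fsc_left[OF smooth_const[of 0] assms(1,3)] by (simp add: fsc_const)
  finally show ?thesis by (simp add: Rv_def algebra_simps)
qed

lemma Rv_fun_lin: "\<xi> \<in> XM \<Longrightarrow> \<eta> \<in> XM \<Longrightarrow> fun_lin (Rv \<xi> \<eta>)"
proof (rule fun_linI)
  assume x: "\<xi> \<in> XM" and e: "\<eta> \<in> XM"
  show "Rv \<xi> \<eta> (\<zeta> + \<zeta>') = Rv \<xi> \<eta> \<zeta> + Rv \<xi> \<eta> \<zeta>'" if "\<zeta> \<in> XM" "\<zeta>' \<in> XM" for \<zeta> \<zeta>'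
    using x e that by (simp add: Rv_def nabla_add_right)
  fix f \<zeta> assume f: "f \<in> CM" and z: "\<zeta> \<in> XM"
  have b: "(\<lambda>p. bracket \<xi> \<eta> p f) = (\<lambda>p. \<xi> p (\<lambda>q. \<eta> q f)) - (\<lambda>p. \<eta> p (\<lambda>q. \<xi> q f))"
    by (simp add: fun_eq_iff bracket_apply pw)
  have d: "(h - k) \<odot> \<zeta> = h \<odot> \<zeta> - k \<odot> \<zeta>" for h k
    by (simp add: fun_eq_iff pw algebra_simps)
  show "Rv \<xi> \<eta> (f \<odot> \<zeta>) = f \<odot> Rv \<xi> \<eta> \<zeta>"
    using x e f z by (simp add: Rv_def nabla_add_right nabla_fsc_right fsc_diff b d)
qed

lemma Rv_add_left: "\<xi> \<in> XM \<Longrightarrow> \<xi>' \<in> XM \<Longrightarrow> \<eta> \<in> XM \<Longrightarrow> \<zeta> \<in> XM \<Longrightarrow> Rv (\<xi> + \<xi>') \<eta> \<zeta> = Rv \<xi> \<eta> \<zeta> + Rv \<xi>' \<eta> \<zeta>"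
  by (simp add: Rv_def nabla_add_left nabla_add_right bracket_add_left)

lemma Rv_fsc_left:
  assumes "f \<in> CM" "\<xi> \<in> XM" "\<eta> \<in> XM" "\<zeta> \<in> XM" shows "Rv (f \<odot> \<xi>) \<eta> \<zeta> = f \<odot> Rv \<xi> \<eta> \<zeta>"
proof -
  have "bracket (f \<odot> \<xi>) \<eta> = f \<odot> bracket \<xi> \<eta> - (\<lambda>p. \<eta> p f) \<odot> \<xi>"
    using bracket_fsc_right[OF assms(3,2,2,1)] bracket_anti[of "f \<odot> \<xi>" \<eta>] bracket_anti[of \<xi> \<eta>]
    by (simp add: fun_eq_iff pw)
  moreover have "nabla (f \<odot> bracket \<xi> \<eta> - (\<lambda>p. \<eta> p f) \<odot> \<xi>) \<zeta> = f \<odot> nabla (bracket \<xi> \<eta>) \<zeta> - (\<lambda>p. \<eta> p f) \<odot> nabla \<xi> \<zeta>"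
    using nabla_add_left[of "f \<odot> bracket \<xi> \<eta> - (\<lambda>p. \<eta> p f) \<odot> \<xi>" "(\<lambda>p. \<eta> p f) \<odot> \<xi>" \<zeta>] assms by (simp add: nabla_fsc_left)
  ultimately show ?thesis
    using assms by (simp add: Rv_def nabla_fsc_left nabla_fsc_right fsc_diff)
qed

text \<open>Apply the operator \<xi> \<eta> - \<eta> \<xi> - [\<xi>, \<eta>], which is zero on
  functions, to g(\<zeta>, \<omega>). The terms in which both factors are differentiated are
  symmetric in \<xi> and \<eta> and drop out.\<close>

lemma Rv_skew:
  assumes x: "\<xi> \<in> XM" and e: "\<eta> \<in> XM" and z: "\<zeta> \<in> XM" and w: "\<omega> \<in> XM"
  shows "gf (Rv \<xi> \<eta> \<zeta>) \<omega> = - gf \<zeta> (Rv \<xi> \<eta> \<omega>)"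
proof -
  let ?h = "gf \<zeta> \<omega>"
  have h: "?h \<in> CM" using z w by simp
  have d: "(\<lambda>p. \<xi> p (\<lambda>q. \<eta> q ?h)) = gf (nabla \<xi> (nabla \<eta> \<zeta>)) \<omega> + gf (nabla \<eta> \<zeta>) (nabla \<xi> \<omega>)
      + (gf (nabla \<xi> \<zeta>) (nabla \<eta> \<omega>) + gf \<zeta> (nabla \<xi> (nabla \<eta> \<omega>)))"
    if x: "\<xi> \<in> XM" and e: "\<eta> \<in> XM" for \<xi> \<eta>
  proof -
    have "(\<lambda>p. \<xi> p (\<lambda>q. \<eta> q ?h)) = (\<lambda>p. \<xi> p (\<lambda>q. gf (nabla \<eta> \<zeta>) \<omega> q + gf \<zeta> (nabla \<eta> \<omega>) q))"
      by (simp add: nabla_metric[OF e z w] plus_fun_def)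
    also have "\<dots> = (\<lambda>p. \<xi> p (gf (nabla \<eta> \<zeta>) \<omega>)) + (\<lambda>p. \<xi> p (gf \<zeta> (nabla \<eta> \<omega>)))"
      using tangent_add[OF XM_tangent[OF x]] x e z w by (simp add: fun_eq_iff pw)
    finally show ?thesis using x e z w by (simp add: nabla_metric)
  qed
  have "(\<lambda>p. bracket \<xi> \<eta> p ?h) = (\<lambda>p. \<xi> p (\<lambda>q. \<eta> q ?h)) - (\<lambda>p. \<eta> p (\<lambda>q. \<xi> q ?h))"
    by (simp add: fun_eq_iff bracket_apply pw)
  then have "gf (nabla (bracket \<xi> \<eta>) \<zeta>) \<omega> + gf \<zeta> (nabla (bracket \<xi> \<eta>) \<omega>) =
      gf (nabla \<xi> (nabla \<eta> \<zeta>)) \<omega> + gf \<zeta> (nabla \<xi> (nabla \<eta> \<omega>)) -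
      gf (nabla \<eta> (nabla \<xi> \<zeta>)) \<omega> - gf \<zeta> (nabla \<eta> (nabla \<xi> \<omega>))"
    unfolding d[OF x e] d[OF e x] nabla_metric[OF bracket_XM[OF x e] z w] by (simp add: algebra_simps)
  moreover have "gf (Rv \<xi> \<eta> \<zeta>) \<omega> = gf (nabla \<xi> (nabla \<eta> \<zeta>)) \<omega> - gf (nabla \<eta> (nabla \<xi> \<zeta>)) \<omega> - gf (nabla (bracket \<xi> \<eta>) \<zeta>) \<omega>"
    "gf \<zeta> (Rv \<xi> \<eta> \<omega>) = gf \<zeta> (nabla \<xi> (nabla \<eta> \<omega>)) - gf \<zeta> (nabla \<eta> (nabla \<xi> \<omega>)) - gf \<zeta> (nabla (bracket \<xi> \<eta>) \<omega>)"
    using x e z w by (simp_all add: Rv_def gf_diff_left gf_diff_right)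
  ultimately have "gf (Rv \<xi> \<eta> \<zeta>) \<omega> + gf \<zeta> (Rv \<xi> \<eta> \<omega>) = 0" by (simp only: diff_eq_eq) (simp add: algebra_simps)
  then show ?thesis by (simp add: eq_neg_iff_add_eq_0)
qed

text \<open>As the torsion vanishes, the cyclic sum of second derivatives collapses to a cyclic sum
  of double brackets, which is zero by the Jacobi identity.\<close>

lemma bianchi:
  assumes x: "\<xi> \<in> XM" and e: "\<eta> \<in> XM" and z: "\<zeta> \<in> XM"
  shows "Rv \<xi> \<eta> \<zeta> + Rv \<eta> \<zeta> \<xi> + Rv \<zeta> \<xi> \<eta> = 0"
proof -
  have t: "nabla \<xi> (nabla \<eta> \<zeta>) - nabla \<xi> (nabla \<zeta> \<eta>) = nabla \<xi> (bracket \<eta> \<zeta>)"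
    if "\<xi> \<in> XM" "\<eta> \<in> XM" "\<zeta> \<in> XM" for \<xi> \<eta> \<zeta>
    using that by (simp add: nabla_diff_right[symmetric] nabla_torsion)
  have b: "nabla \<xi> (bracket \<eta> \<zeta>) = nabla (bracket \<eta> \<zeta>) \<xi> + bracket \<xi> (bracket \<eta> \<zeta>)"
    if "\<xi> \<in> XM" "\<eta> \<in> XM" "\<zeta> \<in> XM" for \<xi> \<eta> \<zeta>
    using nabla_torsion[of \<xi> "bracket \<eta> \<zeta>"] that by (simp add: algebra_simps)
  have j: "bracket \<xi> (bracket \<eta> \<zeta>) + bracket \<eta> (bracket \<zeta> \<xi>) + bracket \<zeta> (bracket \<xi> \<eta>) = 0"
  proof -
    have "bracket \<eta> (bracket \<zeta> \<xi>) = - bracket \<eta> (bracket \<xi> \<zeta>)"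
      unfolding bracket_anti[of \<zeta> \<xi>] by (rule bracket_minus_right) (use x e z in auto)
    then show ?thesis
      using bracket_jacobi[OF x e z] bracket_anti[of \<zeta> "bracket \<xi> \<eta>"] by (simp add: algebra_simps)
  qed
  show ?thesis
    using t[OF x e z] t[OF e z x] t[OF z x e] b[OF x e z] b[OF e z x] b[OF z x e] j
    unfolding Rv_def by (simp add: algebra_simps)
qed

end

text \<open>The algebraic fact that a curvature tensor is determined by the sectional curvatures,
  applied below to the difference of two such tensors. It is formulated with additivity alone, so
  that \<open>V\<close> can be the set of vector fields and \<open>K\<close> the value at a fixed
  point.\<close>

lemma curvature_tensor_zero:
  fixes K :: "'x::plus \<Rightarrow> 'x \<Rightarrow> 'x \<Rightarrow> 'x \<Rightarrow> real"
  assumes V: "\<And>x y. x \<in> V \<Longrightarrow> y \<in> V \<Longrightarrow> x + y \<in> V"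
    and add1: "\<And>x x' y z w. \<lbrakk>x \<in> V; x' \<in> V; y \<in> V; z \<in> V; w \<in> V\<rbrakk> \<Longrightarrow> K (x + x') y z w = K x y z w + K x' y z w"
    and add3: "\<And>x y z z' w. \<lbrakk>x \<in> V; y \<in> V; z \<in> V; z' \<in> V; w \<in> V\<rbrakk> \<Longrightarrow> K x y (z + z') w = K x y z w + K x y z' w"
    and a12: "\<And>x y z w. \<lbrakk>x \<in> V; y \<in> V; z \<in> V; w \<in> V\<rbrakk> \<Longrightarrow> K x y z w = - K y x z w"
    and a34: "\<And>x y z w. \<lbrakk>x \<in> V; y \<in> V; z \<in> V; w \<in> V\<rbrakk> \<Longrightarrow> K x y z w = - K x y w z"
    and bianchi: "\<And>x y z w. \<lbrakk>x \<in> V; y \<in> V; z \<in> V; w \<in> V\<rbrakk> \<Longrightarrow> K x y z w + K y z x w + K z x y w = 0"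
    and sect: "\<And>x y. \<lbrakk>x \<in> V; y \<in> V\<rbrakk> \<Longrightarrow> K x y y x = 0"
    and xyzw: "x \<in> V" "y \<in> V" "z \<in> V" "w \<in> V"
  shows "K x y z w = 0"
proof -
  \<comment> \<open>The octahedron argument: the Bianchi identities for the four rotations of the
    arguments are combined, and the skew symmetries cancel all other terms.\<close>
  have pair: "K x y z w = K z w x y" if "x \<in> V" "y \<in> V" "z \<in> V" "w \<in> V" for x y z w
    using bianchi[of x y z w] bianchi[of y z w x] bianchi[of z w x y] bianchi[of w x y z]
      a12[of z x y w] a34[of z x y w] a34[of x y z w] a12[of w y z x] a34[of w y z x] a34[of y z x w] a12[of x z w y] a12[of y w x z] a34[of y w x z]
      a34[of z w x y] a12[of w x y z] a34[of w x y z] a12[of y w z x] a12[of w x z y] a12[of x w z y]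
      a34[of x z w y] a34[of x w y z] a12[of z w x y] a12[of x y z w] a12[of y z x w] that
    by (smt (verit))
  have add2: "K x (y + y') z w = K x y z w + K x y' z w" if "x \<in> V" "y \<in> V" "y' \<in> V" "z \<in> V" "w \<in> V" for x y y' z w
    using a12[of x "y + y'" z w] a12[of x y z w] a12[of x y' z w] add1[of y y' x z w] that V by simp
  have add4: "K x y z (w + w') = K x y z w + K x y z w'" if "x \<in> V" "y \<in> V" "z \<in> V" "w \<in> V" "w' \<in> V" for x y z w w'
    using a34[of x y z "w + w'"] a34[of x y z w] a34[of x y z w'] add3[of x y w w' z] that V by simp
  \<comment> \<open>Polarization of \<open>sect\<close> gives that \<open>K x y z x\<close> and
    \<open>K x z y x\<close> have sum 0; the pair symmetry makes them equal.\<close>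
  have s: "K x y z x = 0" if "x \<in> V" "y \<in> V" "z \<in> V" for x y z
  proof -
    have "K x y z x + K x z y x = 0"
      using add2[of x y z "y + z" x] add3[of x y y z x] add3[of x z y z x]
        sect[of x y] sect[of x z] sect[of x "y + z"] that V by simp
    moreover have "K x y z x = K x z y x"
      using pair[of x y z x] a12[of z x x y] a34[of x z x y] that by simp
    ultimately show ?thesis by simp
  qed
  have a14: "K x y z w = - K w y z x" if "x \<in> V" "y \<in> V" "z \<in> V" "w \<in> V" for x y z w
    using add1[of x w y z "x + w"] add4[of x y z x w] add4[of w y z x w] s[of x y z] s[of w y z] s[of "x + w" y z] that V
    by simp
  \<comment> \<open>Now \<open>K\<close> is skew in the argument pairs (1, 2), (3, 4) and (1, 4),
    hence totally skew. Cyclic permutations of three arguments are even, so the Bianchi identity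
    reads 3 K = 0.\<close>
  have "K y z x w = K x y z w" "K z x y w = K x y z w"
    using a12[of y z x w] a14[of z y x w] a34[of w y x z] a14[of w y z x]
      a12[of z x y w] a14[of z x y w] a34[of w x y z] a14[of w x z y] a12[of y x z w] xyzw
    by (smt (verit))+
  then show ?thesis using bianchi[OF xyzw] by simp
qed

context riemannian
begin

lemma OM_endo_exists: "\<exists>\<Phi>. \<Phi> \<in> OM \<and> (\<forall>\<zeta>\<in>XM. act \<Phi> \<zeta> = Rv \<xi> \<eta> \<zeta>)" if xe: "\<xi> \<in> XM" "\<eta> \<in> XM"
proof -
  obtain \<Phi> where "\<Phi> \<in> OM" "\<And>\<zeta>. \<zeta> \<in> XM \<Longrightarrow> act \<Phi> \<zeta> = Rv \<xi> \<eta> \<zeta>"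
    by (rule endo_of_fun_lin[of "Rv \<xi> \<eta>"]) (use xe Rv_fun_lin Rv_skew in auto)
  then show ?thesis by blast
qed

abbreviation "CR \<equiv> curvature A g nabla"

definition Rc :: "'a vfield \<Rightarrow> 'a vfield \<Rightarrow> 'a \<Rightarrow> 'a endo" where
  "Rc \<xi> \<eta> = eval CR [\<xi>, \<eta>]"

lemma curvature:
  shows curvature_form: "CR \<in> forms A (skewTM A g) 2"
    and act_Rc: "\<xi> \<in> XM \<Longrightarrow> \<eta> \<in> XM \<Longrightarrow> \<zeta> \<in> XM \<Longrightarrow> act (Rc \<xi> \<eta>) \<zeta> = Rv \<xi> \<eta> \<zeta>"
proof -
  \<comment> \<open>The choice is unique by \<open>OM_eqI\<close>, and therefore all properties of
    \<open>Rv\<close> carry over to \<open>S\<close>.\<close>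
  define S where "S \<xi> \<eta> = (SOME \<Phi>. \<Phi> \<in> OM \<and> (\<forall>\<zeta>\<in>XM. act \<Phi> \<zeta> = Rv \<xi> \<eta> \<zeta>))" for \<xi> \<eta>
  have S: "S \<xi> \<eta> \<in> OM" "\<zeta> \<in> XM \<Longrightarrow> act (S \<xi> \<eta>) \<zeta> = Rv \<xi> \<eta> \<zeta>" if "\<xi> \<in> XM" "\<eta> \<in> XM" for \<xi> \<eta> \<zeta>
    using someI_ex[OF OM_endo_exists[OF that]] unfolding S_def by blast+
  have l1: "fun_lin (\<lambda>\<xi>. S \<xi> \<eta>)" if "\<eta> \<in> XM" for \<eta>
  proof (rule fun_linI)
    show "S (\<xi> + \<xi>') \<eta> = S \<xi> \<eta> + S \<xi>' \<eta>" if x: "\<xi> \<in> XM" "\<xi>' \<in> XM" for \<xi> \<xi>'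
      by (rule OM_eqI) (use x \<open>\<eta> \<in> XM\<close> in \<open>auto simp: S OMb.section_add act_plus Rv_add_left\<close>)
    show "S (f \<odot> \<xi>) \<eta> = f \<odot> S \<xi> \<eta>" if x: "f \<in> CM" "\<xi> \<in> XM" for f \<xi>
      by (rule OM_eqI) (use x \<open>\<eta> \<in> XM\<close> in \<open>auto simp: S OMb.section_fsc act_fsc_left Rv_fsc_left\<close>)
  qed
  have anti: "S \<xi> \<eta> = - S \<eta> \<xi>" if "\<xi> \<in> XM" "\<eta> \<in> XM" for \<xi> \<eta>
    by (rule OM_eqI) (use that Rv_anti[OF that] in \<open>auto simp: S OMb.section_uminus act_uminus\<close>)
  have l2: "fun_lin (S \<xi>)" if x: "\<xi> \<in> XM" for \<xi>
  proof (rule fun_linI)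
    show "S \<xi> (\<eta> + \<eta>') = S \<xi> \<eta> + S \<xi> \<eta>'" if "\<eta> \<in> XM" "\<eta>' \<in> XM" for \<eta> \<eta>'
      using fun_lin_add[OF l1[OF x] that] anti[OF x] that by simp
    show "S \<xi> (f \<odot> \<eta>) = f \<odot> S \<xi> \<eta>" if "f \<in> CM" "\<eta> \<in> XM" for f \<eta>
      using fun_lin_fsc[OF l1[OF x] that] anti[OF x] that by (simp add: fun_eq_iff pw)
  qed
  have self: "S \<xi> \<xi> = 0" if "\<xi> \<in> XM" for \<xi>
    using that Rv_anti[OF that that] by (intro OM_eqI) (auto simp: S OMb.section_0 act_0 fun_eq_iff pw)
  have "OMb.mform 2 (\<lambda>r. S (hd r) (hd (tl r)))"
    unfolding numeral_2_eq_2 by (auto simp: S l1 l2 self elim!: tuples_SucE)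
  then obtain \<phi> where \<phi>: "\<phi> \<in> forms A (skewTM A g) 2" "\<And>r. r \<in> tuples 2 XM \<Longrightarrow> eval \<phi> r = S (hd r) (hd (tl r))"
    by (rule OMb.form_of_mform) (rule that)
  have e: "(\<forall>p. R p [\<xi> p, \<eta> p] (\<zeta> p) = nabla \<xi> (nabla \<eta> \<zeta>) p - nabla \<eta> (nabla \<xi> \<zeta>) p - nabla (bracket \<xi> \<eta>) \<zeta> p) \<longleftrightarrow>
      act (eval R [\<xi>, \<eta>]) \<zeta> = Rv \<xi> \<eta> \<zeta>" for R \<xi> \<eta> \<zeta>
    unfolding fun_eq_iff[of "act _ _"] by (simp add: act_def eval_def Rv_def pw)
  have t2: "[\<xi>, \<eta>] \<in> tuples 2 XM \<longleftrightarrow> \<xi> \<in> XM \<and> \<eta> \<in> XM" for \<xi> \<eta>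
    by (simp add: numeral_2_eq_2)
  have "CR = \<phi>"
    unfolding curvature_def e
  proof (rule the_equality)
    show "\<phi> \<in> forms A (skewTM A g) 2 \<and> (\<forall>\<xi>\<in>XM. \<forall>\<eta>\<in>XM. \<forall>\<zeta>\<in>XM. act (eval \<phi> [\<xi>, \<eta>]) \<zeta> = Rv \<xi> \<eta> \<zeta>)"
      using \<phi> S t2 by simp
    fix R assume R: "R \<in> forms A (skewTM A g) 2 \<and> (\<forall>\<xi>\<in>XM. \<forall>\<eta>\<in>XM. \<forall>\<zeta>\<in>XM. act (eval R [\<xi>, \<eta>]) \<zeta> = Rv \<xi> \<eta> \<zeta>)"
    show "R = \<phi>"
    proof (rule OMb.form_eqI[OF _ \<phi>(1)])
      show "R \<in> forms A (skewTM A g) 2" using R by blast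
      fix r assume r: "r \<in> tuples 2 XM"
      then obtain \<xi> \<eta> where xe: "r = [\<xi>, \<eta>]" "\<xi> \<in> XM" "\<eta> \<in> XM"
        unfolding numeral_2_eq_2 by (auto elim!: tuples_SucE)
      have "eval R r \<in> OM" using R r unfolding forms_def by blast
      then show "eval R r = eval \<phi> r"
        using R S xe \<phi>(2)[OF r] by (intro OM_eqI) auto
    qed
  qed
  then show "CR \<in> forms A (skewTM A g) 2"
    and "\<xi> \<in> XM \<Longrightarrow> \<eta> \<in> XM \<Longrightarrow> \<zeta> \<in> XM \<Longrightarrow> act (Rc \<xi> \<eta>) \<zeta> = Rv \<xi> \<eta> \<zeta>"
    using \<phi> S t2 by (simp_all add: Rc_def)
qed

lemma Rc_OM [simp, intro]: "\<xi> \<in> XM \<Longrightarrow> \<eta> \<in> XM \<Longrightarrow> Rc \<xi> \<eta> \<in> OM"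
  using curvature_form by (simp add: Rc_def forms_def numeral_2_eq_2)

lemma
  assumes "\<xi> \<in> XM" "\<xi>' \<in> XM" "\<eta> \<in> XM"
  shows Rc_add_left: "Rc (\<xi> + \<xi>') \<eta> = Rc \<xi> \<eta> + Rc \<xi>' \<eta>"
    and Rc_fsc_left: "f \<in> CM \<Longrightarrow> Rc (f \<odot> \<xi>) \<eta> = f \<odot> Rc \<xi> \<eta>"
    and Rc_add_right: "Rc \<eta> (\<xi> + \<xi>') = Rc \<eta> \<xi> + Rc \<eta> \<xi>'"
    and Rc_fsc_right: "f \<in> CM \<Longrightarrow> Rc \<eta> (f \<odot> \<xi>) = f \<odot> Rc \<eta> \<xi>"
proof -
  have a: "Rc \<xi> \<eta> = - Rc \<eta> \<xi>" if "\<xi> \<in> XM" "\<eta> \<in> XM" for \<xi> \<eta>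
    by (rule OM_eqI) (use that Rv_anti[OF that] in \<open>auto simp: act_Rc OMb.section_uminus act_uminus\<close>)
  show l: "Rc (\<xi> + \<xi>') \<eta> = Rc \<xi> \<eta> + Rc \<xi>' \<eta>"
    by (rule OM_eqI) (use assms in \<open>auto simp: act_Rc OMb.section_add act_plus Rv_add_left\<close>)
  show f: "Rc (f \<odot> \<xi>) \<eta> = f \<odot> Rc \<xi> \<eta>" if "f \<in> CM"
    by (rule OM_eqI) (use assms that in \<open>auto simp: act_Rc OMb.section_fsc act_fsc_left Rv_fsc_left\<close>)
  show "Rc \<eta> (\<xi> + \<xi>') = Rc \<eta> \<xi> + Rc \<eta> \<xi>'"
    using l a[OF assms(3)] assms by simp
  show "Rc \<eta> (f \<odot> \<xi>) = f \<odot> Rc \<eta> \<xi>" if "f \<in> CM"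
    using f[OF that] a[OF assms(3)] assms that by (simp add: fun_eq_iff pw)
qed

section \<open>The deformation connection and its curvature\<close>

definition tp :: "('a \<Rightarrow> 'a adj) \<Rightarrow> 'a vfield" where "tp s = (\<lambda>p. fst (s p))"
definition bt :: "('a \<Rightarrow> 'a adj) \<Rightarrow> 'a \<Rightarrow> 'a endo" where "bt s = (\<lambda>p. snd (s p))"

lemma tp_bt_simps:
  "tp (s + t) = tp s + tp t" "bt (s + t) = bt s + bt t"
  "tp (s - t) = tp s - tp t" "bt (s - t) = bt s - bt t"
  "tp (f \<odot> s) = f \<odot> tp s" "bt (f \<odot> s) = f \<odot> bt s"
  "tp (c *\<^sub>R s) = c *\<^sub>R tp s" "bt (c *\<^sub>R s) = c *\<^sub>R bt s"
  "tp 0 = 0" "bt 0 = 0"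
  by (simp_all add: tp_def bt_def fun_eq_iff pw)

lemma adj_eqI: "tp s = tp t \<Longrightarrow> bt s = bt t \<Longrightarrow> s = t"
  by (rule ext) (simp add: tp_def bt_def fun_eq_iff[of "\<lambda>p. fst (s p)"] fun_eq_iff[of "\<lambda>p. snd (s p)"] prod_eq_iff)

lemma sections_AM: "s \<in> sections (AM A g) \<longleftrightarrow> tp s \<in> XM \<and> bt s \<in> OM"
  by (simp add: AM_def tp_def bt_def)

lemma fibre_AM: "fibre (AM A g) p = Tan p \<times> skew_endos A g p"
  by (simp add: AM_def)

abbreviation "DA \<equiv> deformation_connection A g nabla"

lemma tp_DA: "tp (DA \<xi> s) = nabla \<xi> (tp s) - act (bt s) \<xi>"
  by (simp add: deformation_connection_def Let_def tp_def bt_def act_def fun_diff_def)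

lemma bt_DA: "bt (DA \<xi> s) = ns \<xi> (bt s) - Rc \<xi> (tp s)"
  by (simp add: deformation_connection_def Let_def tp_def bt_def Rc_def eval_def fun_diff_def)

sublocale AMb: bundle_connection A "AM A g" DA
proof unfold_locales
  show "subspace (fibre (AM A g) p)" for p
    unfolding fibre_AM by (rule subspace_Times[OF tangent_subspace skew_endos_subspace])
  show "s p \<in> fibre (AM A g) p" if "s \<in> sections (AM A g)" for s p
    using that XM_tangent[of "tp s" p] OM_skew[of "bt s" p]
    by (simp add: sections_AM fibre_AM tp_def bt_def mem_Times_iff)
  fix \<xi> \<eta> f s t
  note simps = sections_AM tp_bt_simps OMb.section_0 OMb.section_add OMb.section_fsc OMb.section_diff tp_DA bt_DA ns_OM act_fsc act_add
    nabla_add_right nabla_add_left nabla_fsc_left nabla_fsc_right OMb.D_add OMb.D_fsc OMb.D_add_left OMb.D_fsc_left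
    Rc_add_left Rc_add_right Rc_fsc_left Rc_fsc_right act_plus act_fsc_left fsc_diff
  show "0 \<in> sections (AM A g)" by (simp add: simps)
  show "s + t \<in> sections (AM A g)" if "s \<in> sections (AM A g)" "t \<in> sections (AM A g)"
    using that by (simp add: simps)
  show "f \<odot> s \<in> sections (AM A g)" if "f \<in> CM" "s \<in> sections (AM A g)"
    using that by (simp add: simps)
  show "DA \<xi> s \<in> sections (AM A g)" if "\<xi> \<in> XM" "s \<in> sections (AM A g)"
    using that by (simp add: simps)
  show "DA \<xi> (s + t) = DA \<xi> s + DA \<xi> t" if "\<xi> \<in> XM" "s \<in> sections (AM A g)" "t \<in> sections (AM A g)"
    using that by (intro adj_eqI) (simp_all add: simps)
  show "DA \<xi> (f \<odot> s) = f \<odot> DA \<xi> s + (\<lambda>p. \<xi> p f) \<odot> s" if "f \<in> CM" "\<xi> \<in> XM" "s \<in> sections (AM A g)"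
    using that by (intro adj_eqI) (simp_all add: simps)
  show "DA (\<xi> + \<eta>) s = DA \<xi> s + DA \<eta> s" if "\<xi> \<in> XM" "\<eta> \<in> XM" "s \<in> sections (AM A g)"
    using that by (intro adj_eqI) (simp_all add: simps)
  show "DA (f \<odot> \<xi>) s = f \<odot> DA \<xi> s" if "f \<in> CM" "\<xi> \<in> XM" "s \<in> sections (AM A g)"
    using that by (intro adj_eqI) (simp_all add: simps)
qed

lemma act_torsion:
  "\<Phi> \<in> OM \<Longrightarrow> \<xi> \<in> XM \<Longrightarrow> \<eta> \<in> XM \<Longrightarrow> act \<Phi> (bracket \<xi> \<eta>) = act \<Phi> (nabla \<xi> \<eta>) - act \<Phi> (nabla \<eta> \<xi>)"
  by (simp add: nabla_torsion[symmetric] act_diff)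

text \<open>The terms with \<Phi> cancel because the torsion is zero. With \<theta> the top
  component of \<open>s\<close>, there remains R(\<xi>, \<eta>) \<theta> + R(\<eta>, \<theta>) \<xi>
  - R(\<xi>, \<theta>) \<eta>, a Bianchi sum.\<close>

lemma DA_curvature_top:
  assumes x: "\<xi> \<in> XM" and e: "\<eta> \<in> XM" and s: "s \<in> sections (AM A g)"
  shows "tp (DA \<xi> (DA \<eta> s) - DA \<eta> (DA \<xi> s) - DA (bracket \<xi> \<eta>) s) = 0"
proof -
  have s': "tp s \<in> XM" "bt s \<in> OM" using s by (simp_all add: sections_AM)
  let ?\<theta> = "tp s" and ?\<Phi> = "bt s"
  have t: "tp (DA \<xi> (DA \<eta> s)) = nabla \<xi> (nabla \<eta> ?\<theta>) - nabla \<xi> (act ?\<Phi> \<eta>) -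
      (nabla \<eta> (act ?\<Phi> \<xi>) - act ?\<Phi> (nabla \<eta> \<xi>)) + Rv \<eta> ?\<theta> \<xi>"
    if "\<xi> \<in> XM" "\<eta> \<in> XM" for \<xi> \<eta>
    using that s' by (simp add: tp_DA bt_DA nabla_diff_right act_minus act_ns act_Rc)
  have "Rv \<xi> \<eta> ?\<theta> + Rv \<eta> ?\<theta> \<xi> - Rv \<xi> ?\<theta> \<eta> = 0"
    using bianchi[OF x e s'(1)] Rv_anti[OF x s'(1) e] by simp
  then show ?thesis
    unfolding tp_bt_simps t[OF x e] t[OF e x] tp_DA[of "bracket \<xi> \<eta>" s] act_torsion[OF s'(2) x e] Rv_def[of \<xi> \<eta>]
    by (simp add: algebra_simps)
qed

lemma act_commutator:
  assumes x: "\<xi> \<in> XM" and e: "\<eta> \<in> XM" and P: "\<Phi> \<in> OM" and z: "\<zeta> \<in> XM"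
  shows "act (ns \<xi> (ns \<eta> \<Phi>) - ns \<eta> (ns \<xi> \<Phi>) - ns (bracket \<xi> \<eta>) \<Phi>) \<zeta> = Rv \<xi> \<eta> (act \<Phi> \<zeta>) - act \<Phi> (Rv \<xi> \<eta> \<zeta>)"
  using assms by (simp add: act_minus act_ns ns_OM nabla_diff_right Rv_def act_diff)

definition constant_curvature :: "real \<Rightarrow> bool" where
  "constant_curvature c \<longleftrightarrow> (\<forall>\<xi>\<in>XM. \<forall>\<eta>\<in>XM. \<forall>\<zeta>\<in>XM. Rv \<xi> \<eta> \<zeta> = c *\<^sub>R (gf \<eta> \<zeta> \<odot> \<xi> - gf \<xi> \<zeta> \<odot> \<eta>))"

text \<open>The bottom component of the curvature consists of a derivative of \<open>R\<close> and
  of the action of \<Phi> on \<open>R\<close>. Now \<open>R\<close> is built from \<open>g\<close>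
  alone: it is parallel because \<open>g\<close> is (\<open>par\<close>), and it is annihilated by
  \<Phi> because skew endomorphisms preserve \<open>g\<close> infinitesimally
  (\<open>inv\<close>).\<close>

lemma DA_flat:
  assumes cc: "constant_curvature c" and x: "\<xi> \<in> XM" and e: "\<eta> \<in> XM" and s: "s \<in> sections (AM A g)"
  shows "DA \<xi> (DA \<eta> s) - DA \<eta> (DA \<xi> s) - DA (bracket \<xi> \<eta>) s = 0"
proof (rule adj_eqI)
  show "tp (DA \<xi> (DA \<eta> s) - DA \<eta> (DA \<xi> s) - DA (bracket \<xi> \<eta>) s) = tp 0"
    using DA_curvature_top[OF x e s] by (simp add: tp_bt_simps)
  have R: "Rv \<xi> \<eta> \<zeta> = c *\<^sub>R (gf \<eta> \<zeta> \<odot> \<xi> - gf \<xi> \<zeta> \<odot> \<eta>)" if "\<xi> \<in> XM" "\<eta> \<in> XM" "\<zeta> \<in> XM" for \<xi> \<eta> \<zeta>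
    using cc that unfolding constant_curvature_def by blast
  have s': "tp s \<in> XM" "bt s \<in> OM" using s by (simp_all add: sections_AM)
  let ?\<theta> = "tp s" and ?\<Phi> = "bt s"
  have par: "nabla \<xi> (Rv \<eta> \<theta> \<zeta>) = Rv (nabla \<xi> \<eta>) \<theta> \<zeta> + Rv \<eta> (nabla \<xi> \<theta>) \<zeta> + Rv \<eta> \<theta> (nabla \<xi> \<zeta>)"
    if x: "\<xi> \<in> XM" and e: "\<eta> \<in> XM" and t: "\<theta> \<in> XM" and z: "\<zeta> \<in> XM" for \<xi> \<eta> \<theta> \<zeta>
  proof -
    have m: "(\<lambda>p. \<xi> p (gf \<mu> \<nu>)) \<odot> \<sigma> = gf (nabla \<xi> \<mu>) \<nu> \<odot> \<sigma> + gf \<mu> (nabla \<xi> \<nu>) \<odot> \<sigma>" if "\<mu> \<in> XM" "\<nu> \<in> XM" for \<mu> \<nu> and \<sigma> :: "'a vfield"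
      unfolding nabla_metric[OF x that] by (simp add: fun_eq_iff pw algebra_simps)
    show ?thesis
      using x e t z TMb.D_scaleR[OF x, of "gf \<theta> \<zeta> \<odot> \<eta> - gf \<eta> \<zeta> \<odot> \<theta>" c]
      by (simp add: R nabla_diff_right nabla_fsc_right m) (simp add: fun_eq_iff pw algebra_simps)
  qed
  have inv: "Rv \<xi> \<eta> (act ?\<Phi> \<zeta>) - act ?\<Phi> (Rv \<xi> \<eta> \<zeta>) + Rv \<xi> (act ?\<Phi> \<eta>) \<zeta> - Rv \<eta> (act ?\<Phi> \<xi>) \<zeta> = 0"
    if z: "\<zeta> \<in> XM" for \<zeta>
  proof -
    have a: "act ?\<Phi> (Rv \<xi> \<eta> \<zeta>) = c *\<^sub>R (gf \<eta> \<zeta> \<odot> act ?\<Phi> \<xi> - gf \<xi> \<zeta> \<odot> act ?\<Phi> \<eta>)"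
      using act_fsc[OF s'(2), of "gf \<eta> \<zeta> \<odot> \<xi> - gf \<xi> \<zeta> \<odot> \<eta>" "\<lambda>p. c"] x e z s'
      by (simp add: R fsc_const act_diff act_fsc)
    have k: "gf \<eta> (act ?\<Phi> \<zeta>) = - gf (act ?\<Phi> \<eta>) \<zeta>" "gf \<xi> (act ?\<Phi> \<zeta>) = - gf (act ?\<Phi> \<xi>) \<zeta>"
      using act_skew[OF s'(2) e z] act_skew[OF s'(2) x z] by simp_all
    show ?thesis
      unfolding a using x e z s' by (simp add: R k) (simp add: fun_eq_iff pw algebra_simps)
  qed
  show "bt (DA \<xi> (DA \<eta> s) - DA \<eta> (DA \<xi> s) - DA (bracket \<xi> \<eta>) s) = bt 0"
  proof (rule OM_eqI)
    show "bt (DA \<xi> (DA \<eta> s) - DA \<eta> (DA \<xi> s) - DA (bracket \<xi> \<eta>) s) \<in> OM"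
      using AMb.section_diff[OF AMb.section_diff[OF AMb.D_section[OF x AMb.D_section[OF e s]] AMb.D_section[OF e AMb.D_section[OF x s]]]
          AMb.D_section[OF bracket_XM[OF x e] s]] by (simp add: sections_AM)
    show "bt 0 \<in> OM" by (simp add: tp_bt_simps OMb.section_0)
    fix \<zeta> assume z: "\<zeta> \<in> XM"
    have b: "act (bt (DA \<xi> (DA \<eta> s))) \<zeta> = act (ns \<xi> (ns \<eta> ?\<Phi>)) \<zeta> - Rv (nabla \<xi> \<eta>) ?\<theta> \<zeta> - Rv \<eta> (nabla \<xi> ?\<theta>) \<zeta>
        - Rv \<xi> (nabla \<eta> ?\<theta>) \<zeta> + Rv \<xi> (act ?\<Phi> \<eta>) \<zeta>" if "\<xi> \<in> XM" "\<eta> \<in> XM" for \<xi> \<eta>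
    proof -
      have rd: "Rc \<xi> (nabla \<eta> ?\<theta> - act ?\<Phi> \<eta>) = Rc \<xi> (nabla \<eta> ?\<theta>) - Rc \<xi> (act ?\<Phi> \<eta>)"
        using Rc_add_right[of "nabla \<eta> ?\<theta> - act ?\<Phi> \<eta>" "act ?\<Phi> \<eta>" \<xi>] that s' by simp
      show ?thesis
        using that s' z by (simp add: tp_DA bt_DA OMb.D_diff ns_OM rd act_minus act_ns[OF _ Rc_OM] act_Rc par)
    qed
    have t: "Rv (bracket \<xi> \<eta>) ?\<theta> \<zeta> = Rv (nabla \<xi> \<eta>) ?\<theta> \<zeta> - Rv (nabla \<eta> \<xi>) ?\<theta> \<zeta>"
      using Rv_add_left[of "bracket \<xi> \<eta>" "nabla \<eta> \<xi>" ?\<theta> \<zeta>] nabla_torsion[OF x e, symmetric] x e z s' by simp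
    have "act (bt (DA \<xi> (DA \<eta> s) - DA \<eta> (DA \<xi> s) - DA (bracket \<xi> \<eta>) s)) \<zeta> =
        act (ns \<xi> (ns \<eta> ?\<Phi>) - ns \<eta> (ns \<xi> ?\<Phi>) - ns (bracket \<xi> \<eta>) ?\<Phi>) \<zeta> + Rv \<xi> (act ?\<Phi> \<eta>) \<zeta> - Rv \<eta> (act ?\<Phi> \<xi>) \<zeta>"
      unfolding tp_bt_simps act_minus b[OF x e] b[OF e x] unfolding bt_DA act_minus
      using act_Rc[OF bracket_XM[OF x e] s'(1) z] t by (simp add: algebra_simps)
    then show "act (bt (DA \<xi> (DA \<eta> s) - DA \<eta> (DA \<xi> s) - DA (bracket \<xi> \<eta>) s)) \<zeta> = act (bt 0) \<zeta>"
      unfolding act_commutator[OF x e s'(2) z] using inv[OF z] by (simp add: tp_bt_simps act_0)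
  qed
qed

section \<open>From sectional curvature to the curvature tensor\<close>

lemma cauchy_schwarz_strict:
  assumes v: "v \<in> Tan p" and w: "w \<in> Tan p" and ind: "v \<noteq> w" "independent {v, w}"
  shows "g p v v * g p w w - (g p v w)\<^sup>2 > 0"
proof -
  have wn: "w \<noteq> 0" using ind(2) dependent_zero[of "{v, w}"] by auto
  then have gw: "g p w w > 0" using g_pos[OF w] by simp
  \<comment> \<open>The coefficient of the orthogonal projection of \<open>v\<close> to
    \<open>w\<close>; the length of the remaining component gives the inequality.\<close>
  define k where "k = g p v w / g p w w"
  have "v \<notin> span {w}" using ind by (auto simp: independent_insert)
  then have "v - k *\<^sub>R w \<noteq> 0" by (auto simp: span_singleton)
  then have "0 < g p (v - k *\<^sub>R w) (v - k *\<^sub>R w)" using g_pos[OF Tan_diff[OF v Tan_scaleR[OF w]]] by simp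
  also have "\<dots> = g p v v - 2 * k * g p v w + k * k * g p w w"
    using v w g_sym[OF v w] by (simp add: g_diff_left g_diff_right Tan_diff Tan_scaleR g_scaleR_left g_scaleR_right algebra_simps)
  also have "\<dots> = g p v v - (g p v w)\<^sup>2 / g p w w"
    using gw by (simp add: k_def field_simps power2_eq_square)
  finally have "0 * g p w w < (g p v v - (g p v w)\<^sup>2 / g p w w) * g p w w"
    using gw by (intro mult_strict_right_mono)
  then show ?thesis using gw by (simp add: field_simps)
qed

text \<open>\<open>curvature_tensor_zero\<close> is applied to the difference \<open>K\<close> of
  the curvature and its model with constant c, both paired with a fourth vector field.\<close>

lemma constant_sectional_curvature_imp:
  assumes "constant_sectional_curvature A g nabla"
  obtains c where "constant_curvature c"
proof -
  obtain c where c: "\<And>p v w. v \<in> Tan p \<Longrightarrow> w \<in> Tan p \<Longrightarrow> v \<noteq> w \<Longrightarrow> independent {v, w} \<Longrightarrow>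
      sectional_curvature A g nabla p v w = c"
    using assms unfolding constant_sectional_curvature_def by blast
  define K where "K p \<xi> \<eta> \<zeta> \<omega> = gf (Rv \<xi> \<eta> \<zeta>) \<omega> p - c * (gf \<eta> \<zeta> p * gf \<xi> \<omega> p - gf \<xi> \<zeta> p * gf \<eta> \<omega> p)" for p \<xi> \<eta> \<zeta> \<omega>
  \<comment> \<open>The assumption speaks only of independent pairs. For dependent ones both parts
    of \<open>K\<close> vanish separately; as the dependence holds only at \<open>p\<close>, the
    fields are replaced there by tensoriality.\<close>
  have sect: "K p \<xi> \<eta> \<eta> \<xi> = 0" if x: "\<xi> \<in> XM" and e: "\<eta> \<in> XM" for p \<xi> \<eta>
  proof -
    note t = XM_tangent[OF x, of p] XM_tangent[OF e, of p]
    consider "\<eta> p = 0" | k where "\<xi> p = k *\<^sub>R \<eta> p" | "\<xi> p \<noteq> \<eta> p" "independent {\<xi> p, \<eta> p}"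
    proof (cases "\<xi> p = \<eta> p")
      case True
      then have "\<xi> p = 1 *\<^sub>R \<eta> p" by simp
      then show thesis using that(2) by blast
    next
      case False
      show thesis
      proof (cases "independent {\<xi> p, \<eta> p}")
        case True
        then show thesis using that(3) False by blast
      next
        case dep: False
        show thesis
        proof (cases "\<eta> p = 0")
          case nz: False
          then have "\<xi> p \<in> span {\<eta> p}" using dep False by (simp add: independent_insert)
          then show thesis using that(2) by (auto simp: span_singleton)
        qed (use that(1) in blast)
      qed
    qed
    then show ?thesis
    proof cases
      case 1
      have "Rv \<xi> \<eta> \<eta> p = Rv \<xi> \<eta> 0 p"
        by (rule fun_lin_tensorial[OF Rv_fun_lin[OF x e] e XM_0]) (simp add: 1 pw)
      also have "\<dots> = 0" using fun_lin_zero[OF Rv_fun_lin[OF x e]] by (simp add: pw)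
      finally show ?thesis using t 1 by (simp add: K_def gf_def g_zero)
    next
      case 2
      have fl: "fun_lin (\<lambda>\<xi>. Rv \<xi> \<eta> \<eta>)"
        by (rule fun_linI) (use e in \<open>simp_all add: Rv_add_left Rv_fsc_left\<close>)
      have z: "Rv \<eta> \<eta> \<eta> p = 0" using fun_cong[OF Rv_anti[OF e e e], of p] by (simp add: pw fun_eq_iff)
      have "Rv \<xi> \<eta> \<eta> p = Rv (k *\<^sub>R \<eta>) \<eta> \<eta> p"
        by (rule fun_lin_tensorial[OF fl x XM_scaleR[OF e]]) (simp add: 2 pw)
      also have "\<dots> = 0" using fun_lin_scaleR[OF fl e] z by (simp add: pw)
      finally show ?thesis using t by (simp add: K_def gf_def g_zero 2 g_scaleR_left g_scaleR_right Tan_scaleR)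
    next
      case 3
      have "act (Rc \<xi> \<eta>) \<eta> p = CR p [\<xi> p, \<eta> p] (\<eta> p)" by (simp add: act_def Rc_def eval_def)
      then have "g p (Rv \<xi> \<eta> \<eta> p) (\<xi> p) / (g p (\<xi> p) (\<xi> p) * g p (\<eta> p) (\<eta> p) - (g p (\<xi> p) (\<eta> p))\<^sup>2) = c"
        using c[OF t 3] act_Rc[OF x e e] by (simp add: sectional_curvature_def)
      then have "g p (Rv \<xi> \<eta> \<eta> p) (\<xi> p) = c * (g p (\<xi> p) (\<xi> p) * g p (\<eta> p) (\<eta> p) - (g p (\<xi> p) (\<eta> p))\<^sup>2)"
        using cauchy_schwarz_strict[OF t 3] by (simp add: field_simps)
      then show ?thesis using g_sym[OF t] by (simp add: K_def gf_def power2_eq_square mult.commute)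
    qed
  qed
  have Rz: "Rv \<xi> \<eta> (\<zeta> + \<zeta>') = Rv \<xi> \<eta> \<zeta> + Rv \<xi> \<eta> \<zeta>'" if "\<xi> \<in> XM" "\<eta> \<in> XM" "\<zeta> \<in> XM" "\<zeta>' \<in> XM" for \<xi> \<eta> \<zeta> \<zeta>'
    by (rule fun_lin_add[OF Rv_fun_lin]) (use that in auto)
  have K0: "K p \<xi> \<eta> \<zeta> \<omega> = 0" if "\<xi> \<in> XM" "\<eta> \<in> XM" "\<zeta> \<in> XM" "\<omega> \<in> XM" for p \<xi> \<eta> \<zeta> \<omega>
  proof (rule curvature_tensor_zero[where V = XM and K = "K p"])
    fix x x' y z w assume m: "x \<in> XM" "x' \<in> XM" "y \<in> XM" "z \<in> XM" "w \<in> XM"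
    show "K p (x + x') y z w = K p x y z w + K p x' y z w"
      using m by (simp add: K_def Rv_add_left gf_add_left pw algebra_simps)
    show "K p y z (x + x') w = K p y z x w + K p y z x' w"
      using m by (simp add: K_def Rz gf_add_left gf_add_right pw algebra_simps)
    show "K p x y z w = - K p y x z w"
      unfolding K_def Rv_anti[OF m(1,3,4)] using m by (simp add: gf_minus_left pw algebra_simps)
    show "K p x y z w = - K p x y w z"
      unfolding K_def Rv_skew[OF m(1,3,4,5)] using m gf_sym[of z "Rv x y w"] by (simp add: pw algebra_simps)
    have "gf (Rv x y z + Rv y z x + Rv z x y) w = gf 0 w" using bianchi[OF m(1,3,4)] by simp
    then have "gf (Rv x y z) w p + gf (Rv y z x) w p + gf (Rv z x y) w p = 0"
      using m g_zero[OF XM_tangent[OF m(5)]] by (simp add: gf_add_left fun_eq_iff pw gf_def[of 0])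
    then show "K p x y z w + K p y z x w + K p z x y w = 0"
      using gf_sym[OF m(1,3)] gf_sym[OF m(1,4)] gf_sym[OF m(3,4)] by (simp add: K_def algebra_simps)
  qed (use that sect in auto)
  have "Rv \<xi> \<eta> \<zeta> = c *\<^sub>R (gf \<eta> \<zeta> \<odot> \<xi> - gf \<xi> \<zeta> \<odot> \<eta>)" if m: "\<xi> \<in> XM" "\<eta> \<in> XM" "\<zeta> \<in> XM" for \<xi> \<eta> \<zeta>
  proof (rule XM_eqI)
    fix \<omega> assume w: "\<omega> \<in> XM"
    have "gf (c *\<^sub>R (gf \<eta> \<zeta> \<odot> \<xi> - gf \<xi> \<zeta> \<odot> \<eta>)) \<omega> = (\<lambda>p. c) * (gf \<eta> \<zeta> * gf \<xi> \<omega> - gf \<xi> \<zeta> * gf \<eta> \<omega>)"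
      using m w gf_fsc_left[of \<omega> "gf \<eta> \<zeta> \<odot> \<xi> - gf \<xi> \<zeta> \<odot> \<eta>" "\<lambda>p. c"]
      by (simp add: fsc_const gf_diff_left gf_fsc_left)
    then show "gf (Rv \<xi> \<eta> \<zeta>) \<omega> = gf (c *\<^sub>R (gf \<eta> \<zeta> \<odot> \<xi> - gf \<xi> \<zeta> \<odot> \<eta>)) \<omega>"
      using K0[OF m w] by (simp add: K_def fun_eq_iff pw)
  qed (use m in auto)
  then show thesis using that unfolding constant_curvature_def by blast
qed

end

section \<open>Raising an index\<close>

context atlas
begin

text \<open>Gaussian elimination without division: the pivot \<open>G d d\<close> is positive at \<open>p\<close>, and the Schur
  complement, multiplied with the pivot, is again positive definite there.\<close>

lemma elimination:
  fixes G :: "'b \<Rightarrow> 'b \<Rightarrow> 'a \<Rightarrow> real"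
  assumes "finite B" "\<And>b c. b \<in> B \<Longrightarrow> c \<in> B \<Longrightarrow> G b c \<in> CM" "\<And>c. c \<in> B \<Longrightarrow> r c \<in> CM"
    and "\<And>a. \<exists>b\<in>B. a b \<noteq> 0 \<Longrightarrow> (\<Sum>b\<in>B. \<Sum>c\<in>B. a b * a c * G b c p) > 0"
  shows "\<exists>u w. u \<in> CM \<and> u p \<noteq> 0 \<and> (\<forall>b\<in>B. w b \<in> CM) \<and> (\<forall>c\<in>B. \<forall>q. (\<Sum>b\<in>B. w b q * G b c q) = u q * r c q)"
  using assms
proof (induction B arbitrary: G r rule: finite_induct)
  case empty
  then show ?case by (intro exI[of _ "\<lambda>p. 1"]) simp
next
  case (insert d B)
  let ?G = "\<lambda>b c q. G d d q * G b c q - G b d q * G d c q" and ?r = "\<lambda>c q. G d d q * r c q - r d q * G d c q"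
  let ?Q = "\<lambda>a. \<Sum>b\<in>insert d B. \<Sum>c\<in>insert d B. a b * a c * G b c p"
  have exp: "?Q a = a d * a d * G d d p + a d * (\<Sum>c\<in>B. a c * G d c p) + a d * (\<Sum>b\<in>B. a b * G b d p) +
      (\<Sum>b\<in>B. \<Sum>c\<in>B. a b * a c * G b c p)" for a
    using insert.hyps by (simp add: sum.distrib sum_distrib_left mult_ac)
  have pd: "?Q a > 0" if "\<exists>b\<in>insert d B. a b \<noteq> 0" for a using insert.prems(3) that .
  have piv: "G d d p > 0"
  proof -
    have "a = (\<lambda>b. if b = d then 1 else 0) \<Longrightarrow> ?Q a = G d d p" for a :: "'b \<Rightarrow> real"
    proof -
      assume a: "a = (\<lambda>b. if b = d then 1 else 0)"
      have "a b = 0" if "b \<in> B" for b using that insert.hyps by (auto simp: a)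
      then show "?Q a = G d d p" unfolding exp by (simp add: a cong: sum.cong)
    qed
    then show ?thesis using pd[of "\<lambda>b. if b = d then 1 else 0"] by simp
  qed
  have "\<exists>u w. u \<in> CM \<and> u p \<noteq> 0 \<and> (\<forall>b\<in>B. w b \<in> CM) \<and> (\<forall>c\<in>B. \<forall>q. (\<Sum>b\<in>B. w b q * ?G b c q) = u q * ?r c q)"
  proof (rule insert.IH)
    fix a :: "'b \<Rightarrow> real" assume "\<exists>b\<in>B. a b \<noteq> 0"
    define x y where "x = (\<Sum>b\<in>B. a b * G b d p)" and "y = (\<Sum>c\<in>B. a c * G d c p)"
    \<comment> \<open>The entry at \<open>d\<close> that completes the square: at \<open>a'\<close>
      the form of \<open>G\<close> equals, up to the positive factor \<open>G d d p\<close>, the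
      form of the matrix \<open>?G\<close> at \<open>a\<close>.\<close>
    define a' where "a' = a(d := - x / G d d p)"
    have a': "a' b = a b" if "b \<in> B" for b using that insert.hyps by (auto simp: a'_def)
    have "\<exists>b\<in>insert d B. a' b \<noteq> 0" using \<open>\<exists>b\<in>B. a b \<noteq> 0\<close> a' by auto
    then have "0 < ?Q a'" by (rule pd)
    also have "?Q a' = a' d * a' d * G d d p + a' d * y + a' d * x + (\<Sum>b\<in>B. \<Sum>c\<in>B. a b * a c * G b c p)"
      unfolding exp x_def y_def using a' by simp
    also have "\<dots> = (\<Sum>b\<in>B. \<Sum>c\<in>B. a b * a c * G b c p) - x * y / G d d p"
      using piv by (simp add: a'_def field_simps)
    finally have "0 * G d d p < ((\<Sum>b\<in>B. \<Sum>c\<in>B. a b * a c * G b c p) - x * y / G d d p) * G d d p"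
      using piv by (intro mult_strict_right_mono)
    then have "0 < G d d p * (\<Sum>b\<in>B. \<Sum>c\<in>B. a b * a c * G b c p) - x * y"
      using piv by (simp add: field_simps)
    also have "\<dots> = (\<Sum>b\<in>B. \<Sum>c\<in>B. a b * a c * ?G b c p)"
      unfolding x_def y_def sum_product by (simp add: sum_distrib_left sum_subtractf[symmetric] algebra_simps)
    finally show "0 < (\<Sum>b\<in>B. \<Sum>c\<in>B. a b * a c * ?G b c p)" .
  qed (use insert.prems in auto)
  then obtain u w where u: "u \<in> CM" "u p \<noteq> 0" and w: "\<And>b. b \<in> B \<Longrightarrow> w b \<in> CM"
    and eq: "\<And>c q. c \<in> B \<Longrightarrow> (\<Sum>b\<in>B. w b q * ?G b c q) = u q * ?r c q" by blast
  \<comment> \<open>Back substitution: the entry of \<open>w'\<close> at \<open>d\<close> is chosen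
    to satisfy the equation for \<open>d\<close>, and everything is multiplied by the pivot in place
    of dividing.\<close>
  define u' where "u' = (\<lambda>q. u q * G d d q)"
  define w' where "w' b = (if b = d then (\<lambda>q. u q * r d q - (\<Sum>b\<in>B. w b q * G b d q)) else (\<lambda>q. G d d q * w b q))" for b
  have s: "(\<Sum>b\<in>insert d B. w' b q * G b c q) =
      (u q * r d q - (\<Sum>b\<in>B. w b q * G b d q)) * G d c q + G d d q * (\<Sum>b\<in>B. w b q * G b c q)" for c q
  proof -
    have "(\<Sum>b\<in>B. w' b q * G b c q) = G d d q * (\<Sum>b\<in>B. w b q * G b c q)"
      unfolding sum_distrib_left by (rule sum.cong) (use insert.hyps in \<open>auto simp: w'_def mult_ac\<close>)
    then show ?thesis using insert.hyps by (simp add: w'_def)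
  qed
  have "(\<Sum>b\<in>insert d B. w' b q * G b c q) = u' q * r c q" if c: "c \<in> insert d B" for c q
  proof (cases "c = d")
    case True
    then show ?thesis unfolding s u'_def by (simp add: algebra_simps)
  next
    case False
    have "(\<Sum>b\<in>B. w b q * ?G b c q) = G d d q * (\<Sum>b\<in>B. w b q * G b c q) - (\<Sum>b\<in>B. w b q * G b d q) * G d c q"
      by (simp add: sum_distrib_left sum_distrib_right sum_subtractf[symmetric] algebra_simps)
    then show ?thesis using eq[of c q] False c unfolding s u'_def by (simp add: algebra_simps)
  qed
  moreover have "u' \<in> CM" "u' p \<noteq> 0" using u piv insert.prems(1) by (auto simp: u'_def)
  moreover have "w' b \<in> CM" if "b \<in> insert d B" for b
    using that u w insert.prems by (auto simp: w'_def)
  ultimately show ?case by blast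
qed

end

context riemannian
begin

text \<open>In a local frame, Y solves a linear system with the matrix g(E b, E c). This is positive
  definite at \<open>p\<close>, where the frame is independent because it is dual to the functions
  \<open>h c\<close>. The factor \<open>u\<close> collects the cleared denominators and the cut-off
  of the frame.\<close>

lemma sharp_local:
  assumes o: "fun_lin \<omega>" and smooth: "\<And>\<zeta>. \<zeta> \<in> XM \<Longrightarrow> \<omega> \<zeta> \<in> CM"
  obtains Y u where "Y \<in> XM" "u \<in> CM" "u p \<noteq> (0::real)" "\<And>\<zeta>. \<zeta> \<in> XM \<Longrightarrow> gf Y \<zeta> = u * \<omega> \<zeta>"
proof -
  obtain \<kappa> h and E :: "'e \<Rightarrow> _" where k: "\<kappa> \<in> CM" "\<kappa> p = 1" and h: "\<And>b. h b \<in> CM" and E: "\<And>b. E b \<in> XM"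
    and dual: "\<And>b c. b \<in> Basis \<Longrightarrow> c \<in> Basis \<Longrightarrow> E b p (h (c::'e)) = (if b = c then 1 else 0)"
    and fr: "\<And>q v. v \<in> Tan q \<Longrightarrow> \<kappa> q *\<^sub>R v = (\<Sum>b\<in>Basis. v (h b) *\<^sub>R E b q)"
    by (rule local_frame[of p]) blast
  have s: "(\<Sum>i\<in>I. F i) q = (\<Sum>i\<in>I. F i q)" for F :: "'e \<Rightarrow> 'x \<Rightarrow> 'w::real_vector" and I q
    by (induction I rule: infinite_finite_induct) (auto simp: pw)
  have Tsum: "(\<Sum>b\<in>I. a b *\<^sub>R E b q) \<in> Tan q" for a I q
    by (intro subspace_sum[OF tangent_subspace] Tan_scaleR XM_tangent E)
  have gl: "g q (\<Sum>b\<in>I. a b *\<^sub>R E b q) v = (\<Sum>b\<in>I. a b * g q (E b q) v)" if "v \<in> Tan q" for a I q v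
    using that by (induction I rule: infinite_finite_induct)
      (auto simp: g_zero g_add_left Tan_scaleR XM_tangent[OF E] Tsum g_scaleR_left)
  have "\<exists>u w. u \<in> CM \<and> u p \<noteq> 0 \<and> (\<forall>b\<in>Basis. w b \<in> CM) \<and>
      (\<forall>c\<in>Basis. \<forall>q. (\<Sum>b\<in>Basis. w b q * gf (E b) (E c) q) = u q * \<omega> (E c) q)"
  proof (rule elimination)
    fix a :: "'e \<Rightarrow> real" assume a: "\<exists>b\<in>Basis. a b \<noteq> 0"
    let ?Z = "\<Sum>b\<in>Basis. a b *\<^sub>R E b p"
    obtain c where c: "c \<in> Basis" "a c \<noteq> 0" using a by blast
    have "?Z (h c) = (\<Sum>b\<in>Basis. a b * E b p (h c))"
      by (simp add: s pw)
    also have "\<dots> = a c" using c by (simp add: dual if_distrib[of "\<lambda>x. _ * x"] cong: if_cong)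
    finally have "?Z \<noteq> 0" using c by (auto simp: pw)
    then have "0 < g p ?Z ?Z" using g_pos[OF Tsum] by blast
    also have "\<dots> = (\<Sum>b\<in>Basis. a b * g p (E b p) ?Z)" by (rule gl[OF Tsum])
    also have "\<dots> = (\<Sum>b\<in>Basis. \<Sum>c\<in>Basis. a b * a c * gf (E b) (E c) p)"
    proof (rule sum.cong[OF refl])
      fix b
      have "g p (E b p) ?Z = (\<Sum>c\<in>Basis. a c * g p (E c p) (E b p))"
        using g_sym[OF XM_tangent[OF E] Tsum] gl[OF XM_tangent[OF E]] by simp
      then show "a b * g p (E b p) ?Z = (\<Sum>c\<in>Basis. a b * a c * gf (E b) (E c) p)"
        by (simp add: gf_def sum_distrib_left mult.assoc g_sym[OF XM_tangent[OF E] XM_tangent[OF E], of p _ b])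
    qed
    finally show "0 < (\<Sum>b\<in>Basis. \<Sum>c\<in>Basis. a b * a c * gf (E b) (E c) p)" .
  qed (use E smooth in auto)
  then obtain u w where u: "u \<in> CM" "u p \<noteq> 0" and w: "\<And>b. b \<in> Basis \<Longrightarrow> w b \<in> CM"
    and eq: "\<And>c q. c \<in> Basis \<Longrightarrow> (\<Sum>b\<in>Basis. w b q * gf (E b) (E c) q) = u q * \<omega> (E c) q" by blast
  define Y where "Y = (\<Sum>b\<in>Basis. w b \<odot> E b)"
  have Y: "Y \<in> XM" unfolding Y_def by (intro XM_sum XM_fsc w E)
  have YE: "gf Y (E c) q = u q * \<omega> (E c) q" if "c \<in> Basis" for c q
    using eq[OF that, of q] gl[OF XM_tangent[OF E]] by (simp add: Y_def gf_def s pw)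
  \<comment> \<open>The equation is known on the frame only; the factor \<kappa> makes the frame
    expansion of \<zeta> valid everywhere.\<close>
  have "gf (\<kappa> \<odot> Y) \<zeta> = (\<lambda>q. \<kappa> q * u q) * \<omega> \<zeta>" if z: "\<zeta> \<in> XM" for \<zeta>
  proof -
    have kz: "\<kappa> \<odot> \<zeta> = (\<Sum>b\<in>Basis. (\<lambda>q. \<zeta> q (h b)) \<odot> E b)"
      by (rule ext) (simp add: s pw fr[OF XM_tangent[OF z]])
    have "gf (\<kappa> \<odot> Y) \<zeta> q = \<kappa> q * u q * \<omega> \<zeta> q" for q
    proof -
      have "gf (\<kappa> \<odot> Y) \<zeta> q = gf (\<kappa> \<odot> \<zeta>) Y q"
        using Y z g_sym[OF XM_tangent[OF z] XM_tangent[OF Y]]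
        by (simp add: gf_def pw g_scaleR_left XM_tangent)
      also have "\<dots> = (\<Sum>b\<in>Basis. \<zeta> q (h b) * gf Y (E b) q)"
        using gl[OF XM_tangent[OF Y]] by (simp add: kz gf_def s pw g_sym[OF XM_tangent[OF Y] XM_tangent[OF E]])
      also have "\<dots> = (\<Sum>b\<in>Basis. \<zeta> q (h b) * (u q * \<omega> (E b) q))"
        by (rule sum.cong) (simp_all add: YE)
      also have "\<dots> = u q * (\<Sum>b\<in>Basis. (\<lambda>q. \<zeta> q (h b)) \<odot> \<omega> (E b)) q"
        by (simp add: s pw sum_distrib_left mult_ac)
      also have "(\<Sum>b\<in>Basis. (\<lambda>q. \<zeta> q (h b)) \<odot> \<omega> (E b)) = \<omega> (\<kappa> \<odot> \<zeta>)"
        unfolding kz using z E by (simp add: fun_lin_sum[OF o] fun_lin_fsc[OF o])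
      also have "\<dots> = \<kappa> \<odot> \<omega> \<zeta>" by (rule fun_lin_fsc[OF o k(1) z])
      finally show ?thesis by (simp add: fsc_apply[of \<kappa> "\<omega> \<zeta>" q])
    qed
    then show ?thesis by (simp add: fun_eq_iff)
  qed
  then show thesis
    by (intro that[of "\<kappa> \<odot> Y" "\<lambda>q. \<kappa> q * u q"]) (use Y k u in auto)
qed

text \<open>Pointwise, W is a local solution divided by its factor. Nondegeneracy of
  \<open>g\<close> makes all local solutions compatible, so that \<open>u p\<close> times W equals
  \<open>Y p\<close> on the whole manifold, which is what \<open>smooth_local_quotient\<close> asks
  for.\<close>

lemma sharp:
  assumes o: "fun_lin \<omega>" and smooth: "\<And>\<zeta>. \<zeta> \<in> XM \<Longrightarrow> \<omega> \<zeta> \<in> CM"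
  obtains W where "W \<in> XM" "\<And>\<zeta>. \<zeta> \<in> XM \<Longrightarrow> gf W \<zeta> = \<omega> \<zeta>"
proof -
  have "\<forall>p. \<exists>Y u. Y \<in> XM \<and> u \<in> CM \<and> u p \<noteq> 0 \<and> (\<forall>\<zeta>\<in>XM. gf Y \<zeta> = u * \<omega> \<zeta>)"
    using sharp_local[OF o smooth] by metis
  then obtain Y u where Yu: "\<And>p. Y p \<in> XM" "\<And>p. u p \<in> CM" "\<And>p. u p p \<noteq> 0"
    "\<And>p \<zeta>. \<zeta> \<in> XM \<Longrightarrow> gf (Y p) \<zeta> = u p * \<omega> \<zeta>" by metis
  define W where "W p = (1 / u p p) *\<^sub>R Y p p" for p
  have WT: "W p \<in> Tan p" for p unfolding W_def by (intro Tan_scaleR XM_tangent Yu)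
  have W: "g p (W p) (\<zeta> p) = \<omega> \<zeta> p" if "\<zeta> \<in> XM" for \<zeta> p
    using fun_cong[OF Yu(4)[OF that, of p], of p] Yu(3)[of p]
    by (simp add: W_def g_scaleR_left XM_tangent[OF that] XM_tangent[OF Yu(1)] gf_def)
  have loc: "u p q *\<^sub>R W q = Y p q" for p q
  proof (rule g_nondegenerate[OF Tan_scaleR[OF WT] XM_tangent[OF Yu(1)]])
    fix v assume v: "v \<in> Tan q"
    then obtain \<zeta> where z: "\<zeta> \<in> XM" "\<zeta> q = v" by (rule vfield_through)
    show "g q (u p q *\<^sub>R W q) v = g q (Y p q) v"
      using fun_cong[OF Yu(4)[OF z(1), of p], of q] W[OF z(1), of q] z(2)
      by (simp add: g_scaleR_left[OF v WT] gf_def)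
  qed
  have "W \<in> XM"
  proof (rule XM_I[OF WT])
    fix f assume "f \<in> CM"
    show "(\<lambda>p. W p f) \<in> CM"
    proof (rule smooth_local_quotient)
      fix p
      have "u p q * W q f = Y p q f" for q using fun_cong[OF loc, of p q f] by (simp add: pw)
      then show "\<exists>k\<in>CM. \<exists>w\<in>CM. k p \<noteq> 0 \<and> (\<forall>q. k q * W q f = w q)"
        using Yu(3)[of p] XM_smooth[OF Yu(1)[of p], of f] Yu(2)[of p]
        by (intro bexI[of _ "u p"] bexI[of _ "\<lambda>q. Y p q f"]) auto
    qed
  qed
  moreover have "gf W \<zeta> = \<omega> \<zeta>" if "\<zeta> \<in> XM" for \<zeta>
    using W[OF that] by (simp add: gf_def)
  ultimately show thesis using that by blast
qed

end

section \<open>Cohomology of complexes with splitting operators\<close>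

lemma coboundaries_subspace:
  assumes "cochain_complex C d" shows "subspace (coboundaries C d k)"
proof (cases k)
  case 0
  then show ?thesis by (simp add: coboundaries_def subspace_def)
next
  case (Suc l)
  have C: "subspace (C l)" and d: "lin_on (C l) (d l)"
    using assms unfolding cochain_complex_def by auto
  have l: "d l (a *\<^sub>R x + b *\<^sub>R y) = a *\<^sub>R d l x + b *\<^sub>R d l y" if "x \<in> C l" "y \<in> C l" for a b x y
    using d that unfolding lin_on_def by blast
  have "0 = d l 0" using l[OF subspace_0[OF C] subspace_0[OF C], of 0 0] by simp
  moreover have "\<exists>z\<in>C l. d l x + d l y = d l z" if "x \<in> C l" "y \<in> C l" for x y
    using l[OF that, of 1 1] subspace_add[OF C that] by (intro bexI[of _ "x + y"]) simp_all
  moreover have "\<exists>z\<in>C l. c *\<^sub>R d l x = d l z" if "x \<in> C l" for x c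
    using l[OF that that, of c 0] subspace_scale[OF C that] by (intro bexI[of _ "c *\<^sub>R x"]) simp_all
  ultimately show ?thesis
    using subspace_0[OF C] unfolding Suc subspace_def coboundaries_def by (auto simp: image_iff)
qed

lemma coset_eq_iff:
  assumes B: "subspace B" shows "(\<lambda>b. x + b) ` B = (\<lambda>b. y + b) ` B \<longleftrightarrow> x - y \<in> B"
proof
  assume "(\<lambda>b. x + b) ` B = (\<lambda>b. y + b) ` B"
  then have "x + 0 \<in> (\<lambda>b. y + b) ` B" using subspace_0[OF B] by blast
  then show "x - y \<in> B" by auto
next
  assume d: "x - y \<in> B"
  have "x + b \<in> (\<lambda>b. y + b) ` B" if "b \<in> B" for b
    by (rule image_eqI[of _ _ "(x - y) + b"]) (use subspace_add[OF B d that] in auto)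
  moreover have "y + b \<in> (\<lambda>b. x + b) ` B" if "b \<in> B" for b
    by (rule image_eqI[of _ _ "b - (x - y)"]) (use subspace_diff[OF B that d] in auto)
  ultimately show "(\<lambda>b. x + b) ` B = (\<lambda>b. y + b) ` B" by blast
qed

lemma cohomology_isoI:
  assumes C: "cochain_complex C d" and C': "cochain_complex C' d'" and f: "chain_map C d C' d' f"
    and surj: "\<And>z. z \<in> cocycles C' d' k \<Longrightarrow> \<exists>x\<in>cocycles C d k. z - f k x \<in> coboundaries C' d' k"
    and inj: "\<And>x. x \<in> cocycles C d k \<Longrightarrow> f k x \<in> coboundaries C' d' k \<Longrightarrow> x \<in> coboundaries C d k"
  shows "cohomology_iso C d C' d' f k"
proof -
  let ?B = "coboundaries C d k" and ?B' = "coboundaries C' d' k"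
  let ?cl = "cohomology_class C d k" and ?cl' = "cohomology_class C' d' k"
  note B = coboundaries_subspace[OF C, of k] and B' = coboundaries_subspace[OF C', of k]
  have Ck: "subspace (C k)" and dl: "lin_on (C k) (d k)" using C unfolding cochain_complex_def by auto
  have fl: "lin_on (C k) (f k)" using f unfolding chain_map_def by blast
  have fe: "f k (a *\<^sub>R x + b *\<^sub>R y) = a *\<^sub>R f k x + b *\<^sub>R f k y" if "x \<in> C k" "y \<in> C k" for a b x y
    using fl that unfolding lin_on_def by blast
  have fdiff: "f k (x - y) = f k x - f k y" if "x \<in> C k" "y \<in> C k" for x y
    using fe[OF that, of 1 "-1"] by simp
  have BC: "b \<in> C k \<and> f k b \<in> ?B'" if bB: "b \<in> ?B" for b
  proof (cases k)
    case 0
    then have "b = 0" using bB by (simp add: coboundaries_def)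
    moreover have "f k 0 = 0" using fe[OF subspace_0[OF Ck] subspace_0[OF Ck], of 0 0] by simp
    ultimately show ?thesis using subspace_0[OF Ck] subspace_0[OF B'] by simp
  next
    case (Suc l)
    then obtain a where a: "a \<in> C l" "b = d l a" using bB by (auto simp: coboundaries_def)
    have "f l a \<in> C' l" "d' l (f l a) = f (Suc l) (d l a)"
      using f a unfolding chain_map_def by (blast, metis)
    moreover have "b \<in> C k" using C a Suc unfolding cochain_complex_def by blast
    ultimately show ?thesis using Suc a by (auto simp: coboundaries_def image_iff intro: bexI[of _ "f l a"])
  qed
  have cl: "?cl x = ?cl y \<longleftrightarrow> x - y \<in> ?B" for x y
    unfolding cohomology_class_def by (rule coset_eq_iff[OF B])
  have cl': "?cl' x = ?cl' y \<longleftrightarrow> x - y \<in> ?B'" for x y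
    unfolding cohomology_class_def by (rule coset_eq_iff[OF B'])
  have mem: "x \<in> ?cl x" for x unfolding cohomology_class_def using subspace_0[OF B] by force
  have mem': "x \<in> ?cl' x" for x unfolding cohomology_class_def using subspace_0[OF B'] by force
  have clD: "y \<in> ?cl x \<Longrightarrow> y - x \<in> ?B" for x y unfolding cohomology_class_def by auto
  have clD': "y \<in> ?cl' x \<Longrightarrow> y - x \<in> ?B'" for x y unfolding cohomology_class_def by auto
  have cocC: "x \<in> C k" if "x \<in> cocycles C d k" for x using that by (simp add: cocycles_def)
  have ind: "induced_map C' d' f k (?cl x) = ?cl' (f k x)" if x: "x \<in> C k" for x
  proof -
    have "?cl' (f k y) = ?cl' (f k x)" if "y \<in> ?cl x" for y
    proof -
      have yx: "y - x \<in> C k" "f k (y - x) \<in> ?B'" using BC[OF clD[OF that]] by auto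
      have "y \<in> C k" using subspace_add[OF Ck yx(1) x] by simp
      then show ?thesis using yx(2) fdiff[OF _ x] cl' by simp
    qed
    then show ?thesis unfolding induced_map_def using mem by blast
  qed
  have lin: "class_lincomb C d k a (?cl x) b (?cl y) = ?cl (a *\<^sub>R x + b *\<^sub>R y)" for a b x y
  proof -
    have "?cl (a *\<^sub>R x' + b *\<^sub>R y') = ?cl (a *\<^sub>R x + b *\<^sub>R y)" if "x' \<in> ?cl x" "y' \<in> ?cl y" for x' y'
    proof -
      have "a *\<^sub>R (x' - x) + b *\<^sub>R (y' - y) \<in> ?B"
        by (intro subspace_add[OF B] subspace_scale[OF B] clD that)
      then show ?thesis unfolding cl by (simp add: algebra_simps)
    qed
    then show ?thesis unfolding class_lincomb_def using mem by blast
  qed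
  have lin': "class_lincomb C' d' k a (?cl' x) b (?cl' y) = ?cl' (a *\<^sub>R x + b *\<^sub>R y)" for a b x y
  proof -
    have "?cl' (a *\<^sub>R x' + b *\<^sub>R y') = ?cl' (a *\<^sub>R x + b *\<^sub>R y)" if "x' \<in> ?cl' x" "y' \<in> ?cl' y" for x' y'
    proof -
      have "a *\<^sub>R (x' - x) + b *\<^sub>R (y' - y) \<in> ?B'"
        by (intro subspace_add[OF B'] subspace_scale[OF B'] clD' that)
      then show ?thesis unfolding cl' by (simp add: algebra_simps)
    qed
    then show ?thesis unfolding class_lincomb_def using mem' by blast
  qed
  have coc': "f k x \<in> cocycles C' d' k" if "x \<in> cocycles C d k" for x
  proof -
    have x: "x \<in> C k" "d k x = 0" using that by (auto simp: cocycles_def)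
    have C2: "subspace (C (Suc k))" using C unfolding cochain_complex_def by blast
    have "lin_on (C (Suc k)) (f (Suc k))" using f unfolding chain_map_def by blast
    then have "f (Suc k) (0 *\<^sub>R 0 + 0 *\<^sub>R 0) = 0 *\<^sub>R f (Suc k) 0 + 0 *\<^sub>R f (Suc k) 0"
      using subspace_0[OF C2] unfolding lin_on_def by blast
    then have "f (Suc k) 0 = 0" by simp
    moreover have "f k x \<in> C' k" "d' k (f k x) = f (Suc k) (d k x)"
      using f x(1) unfolding chain_map_def by (blast, metis)
    ultimately show ?thesis using x by (simp add: cocycles_def)
  qed
  have "bij_betw (induced_map C' d' f k) (cohomology C d k) (cohomology C' d' k)"
    unfolding bij_betw_def
  proof
    show "inj_on (induced_map C' d' f k) (cohomology C d k)"
    proof (rule inj_onI)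
      fix X Y assume "X \<in> cohomology C d k" "Y \<in> cohomology C d k"
        and eq: "induced_map C' d' f k X = induced_map C' d' f k Y"
      then obtain x y where xy: "X = ?cl x" "x \<in> cocycles C d k" "Y = ?cl y" "y \<in> cocycles C d k"
        unfolding cohomology_def by blast
      have "x - y \<in> cocycles C d k"
      proof -
        have "d k (1 *\<^sub>R x + (-1) *\<^sub>R y) = 1 *\<^sub>R d k x + (-1) *\<^sub>R d k y"
          using dl cocC[OF xy(2)] cocC[OF xy(4)] unfolding lin_on_def by blast
        then show ?thesis using xy subspace_diff[OF Ck] by (simp add: cocycles_def)
      qed
      moreover have "f k (x - y) \<in> ?B'"
        using eq xy ind[OF cocC[OF xy(2)]] ind[OF cocC[OF xy(4)]] cl' fdiff[OF cocC[OF xy(2)] cocC[OF xy(4)]] by simp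
      ultimately have "x - y \<in> ?B" by (rule inj)
      then show "X = Y" using xy cl by simp
    qed
    have "?cl' z \<in> induced_map C' d' f k ` cohomology C d k" if z: "z \<in> cocycles C' d' k" for z
    proof -
      obtain x where x: "x \<in> cocycles C d k" "z - f k x \<in> ?B'" using surj[OF z] by blast
      then have "?cl' z = induced_map C' d' f k (?cl x)" using ind[OF cocC[OF x(1)]] cl' by simp
      then show ?thesis using x(1) unfolding cohomology_def by blast
    qed
    moreover have "induced_map C' d' f k (?cl x) \<in> cohomology C' d' k" if "x \<in> cocycles C d k" for x
      using ind[OF cocC[OF that]] coc'[OF that] unfolding cohomology_def by simp
    ultimately show "induced_map C' d' f k ` cohomology C d k = cohomology C' d' k"
      unfolding cohomology_def by blast
  qed
  moreover have "induced_map C' d' f k (class_lincomb C d k a X b Y) =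
      class_lincomb C' d' k a (induced_map C' d' f k X) b (induced_map C' d' f k Y)"
    if XY: "X \<in> cohomology C d k" "Y \<in> cohomology C d k" for X Y a b
  proof -
    obtain x y where xy: "X = ?cl x" "x \<in> C k" "Y = ?cl y" "y \<in> C k"
      using XY cocC unfolding cohomology_def by blast
    have "a *\<^sub>R x + b *\<^sub>R y \<in> C k" by (intro subspace_add[OF Ck] subspace_scale[OF Ck] xy)
    then show ?thesis using xy by (simp add: lin lin' ind fe)
  qed
  ultimately show ?thesis unfolding cohomology_iso_def by blast
qed

text \<open>Normality is a condition that every form satisfies after an exact form has been subtracted; the
  operators \<open>L\<close> parametrize the normal forms with normal derivative, with inverse \<open>\<pi>\<close>.\<close>

locale bgg_frame =
  fixes \<Omega> H :: "nat \<Rightarrow> 'v::real_vector set" and d L D \<pi> :: "nat \<Rightarrow> 'v \<Rightarrow> 'v" and normal :: "nat \<Rightarrow> 'v \<Rightarrow> bool"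
  assumes \<Omega>_subspace: "subspace (\<Omega> k)"
    and d_lin: "lin_on (\<Omega> k) (d k)" and d_in: "\<phi> \<in> \<Omega> k \<Longrightarrow> d k \<phi> \<in> \<Omega> (Suc k)"
    and normal_0: "normal k 0"
    and normal_lincomb: "\<phi> \<in> \<Omega> k \<Longrightarrow> \<psi> \<in> \<Omega> k \<Longrightarrow> normal k \<phi> \<Longrightarrow> normal k \<psi> \<Longrightarrow> normal k (a *\<^sub>R \<phi> + b *\<^sub>R \<psi>)"
    and L_in: "\<alpha> \<in> H k \<Longrightarrow> L k \<alpha> \<in> \<Omega> k" and L_normal: "\<alpha> \<in> H k \<Longrightarrow> normal k (L k \<alpha>)"
    and dL_normal: "\<alpha> \<in> H k \<Longrightarrow> normal (Suc k) (d k (L k \<alpha>))" and \<pi>_L: "\<alpha> \<in> H k \<Longrightarrow> \<pi> k (L k \<alpha>) = \<alpha>"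
    and \<pi>_in: "\<phi> \<in> \<Omega> k \<Longrightarrow> normal k \<phi> \<Longrightarrow> normal (Suc k) (d k \<phi>) \<Longrightarrow> \<pi> k \<phi> \<in> H k"
    and L_\<pi>: "\<phi> \<in> \<Omega> k \<Longrightarrow> normal k \<phi> \<Longrightarrow> normal (Suc k) (d k \<phi>) \<Longrightarrow> L k (\<pi> k \<phi>) = \<phi>"
    and \<pi>_lin: "\<pi> k (a *\<^sub>R \<phi> + b *\<^sub>R \<psi>) = a *\<^sub>R \<pi> k \<phi> + b *\<^sub>R \<pi> k \<psi>"
    and dd_normal: "\<phi> \<in> \<Omega> k \<Longrightarrow> normal (Suc (Suc k)) (d (Suc k) (d k \<phi>))"
    and normalize: "\<phi> \<in> \<Omega> (Suc k) \<Longrightarrow> \<exists>\<beta>\<in>\<Omega> k. normal (Suc k) (\<phi> - d k \<beta>)"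
    and normalize_0: "\<phi> \<in> \<Omega> 0 \<Longrightarrow> normal 0 \<phi>"
    and D_eq: "\<alpha> \<in> H k \<Longrightarrow> D k \<alpha> = \<pi> (Suc k) (d k (L k \<alpha>))"
begin

lemma d_lincomb: "\<phi> \<in> \<Omega> k \<Longrightarrow> \<psi> \<in> \<Omega> k \<Longrightarrow> d k (a *\<^sub>R \<phi> + b *\<^sub>R \<psi>) = a *\<^sub>R d k \<phi> + b *\<^sub>R d k \<psi>"
  using d_lin unfolding lin_on_def by blast

lemma \<Omega>_lincomb: "\<phi> \<in> \<Omega> k \<Longrightarrow> \<psi> \<in> \<Omega> k \<Longrightarrow> a *\<^sub>R \<phi> + b *\<^sub>R \<psi> \<in> \<Omega> k"
  by (intro subspace_add[OF \<Omega>_subspace] subspace_scale[OF \<Omega>_subspace])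

lemma d_0: "d k 0 = 0"
  using d_lincomb[OF subspace_0[OF \<Omega>_subspace] subspace_0[OF \<Omega>_subspace], of k 0 0] by simp

lemma \<pi>_0: "\<pi> k 0 = 0"
  using \<pi>_lin[of k 0 0 0 0] by simp

lemma D_in: "\<alpha> \<in> H k \<Longrightarrow> D k \<alpha> \<in> H (Suc k)"
  unfolding D_eq by (intro \<pi>_in d_in L_in dL_normal dd_normal)

text \<open>The derivative of \<open>L k \<alpha>\<close> is normal by \<open>dL_normal\<close> and
  has normal derivative by \<open>dd_normal\<close>. So it lies in the image of L, and its preimage
  \<pi> is D \<alpha> by \<open>D_eq\<close>.\<close>

lemma dL_eq_LD: "\<alpha> \<in> H k \<Longrightarrow> d k (L k \<alpha>) = L (Suc k) (D k \<alpha>)"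
  unfolding D_eq by (intro L_\<pi>[symmetric] d_in L_in dL_normal dd_normal)

text \<open>Linearity of L is not among the assumptions, as L comes from a definite description. A
  combination of values of L is a normal form with normal derivative, hence itself a value of L, and
  \<pi>, which is linear, tells of which argument.\<close>

lemma lincomb_facts:
  assumes "\<alpha> \<in> H k" "\<beta> \<in> H k"
  shows H_lincomb: "a *\<^sub>R \<alpha> + b *\<^sub>R \<beta> \<in> H k"
    and L_lincomb: "L k (a *\<^sub>R \<alpha> + b *\<^sub>R \<beta>) = a *\<^sub>R L k \<alpha> + b *\<^sub>R L k \<beta>"
    and D_lincomb: "D k (a *\<^sub>R \<alpha> + b *\<^sub>R \<beta>) = a *\<^sub>R D k \<alpha> + b *\<^sub>R D k \<beta>"
proof -
  let ?\<phi> = "a *\<^sub>R L k \<alpha> + b *\<^sub>R L k \<beta>"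
  have \<phi>: "?\<phi> \<in> \<Omega> k" by (intro \<Omega>_lincomb L_in assms)
  have n: "normal k ?\<phi>" by (intro normal_lincomb L_in L_normal assms)
  have de: "d k ?\<phi> = a *\<^sub>R d k (L k \<alpha>) + b *\<^sub>R d k (L k \<beta>)" by (intro d_lincomb L_in assms)
  have n': "normal (Suc k) (d k ?\<phi>)"
    unfolding de by (intro normal_lincomb d_in L_in dL_normal assms)
  have p: "\<pi> k ?\<phi> = a *\<^sub>R \<alpha> + b *\<^sub>R \<beta>" by (simp add: \<pi>_lin \<pi>_L assms)
  show h: "a *\<^sub>R \<alpha> + b *\<^sub>R \<beta> \<in> H k" using \<pi>_in[OF \<phi> n n'] p by simp
  show l: "L k (a *\<^sub>R \<alpha> + b *\<^sub>R \<beta>) = ?\<phi>" using L_\<pi>[OF \<phi> n n'] p by simp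
  show "D k (a *\<^sub>R \<alpha> + b *\<^sub>R \<beta>) = a *\<^sub>R D k \<alpha> + b *\<^sub>R D k \<beta>"
    by (simp add: D_eq h assms l de \<pi>_lin)
qed

lemma zero_facts: "0 \<in> H k" "L k 0 = 0"
proof -
  have "0 \<in> \<Omega> k" by (rule subspace_0[OF \<Omega>_subspace])
  then show "0 \<in> H k" "L k 0 = 0"
    using \<pi>_in[of 0 k] L_\<pi>[of 0 k] by (simp_all add: d_0 normal_0 \<pi>_0)
qed

lemma H_subspace: "subspace (H k)"
proof -
  have "c *\<^sub>R x \<in> H k" if "x \<in> H k" for c x using H_lincomb[OF that that, of c 0] by simp
  moreover have "x + y \<in> H k" if "x \<in> H k" "y \<in> H k" for x y using H_lincomb[OF that, of 1 1] by simp
  ultimately show ?thesis using zero_facts(1) by (simp add: subspace_def)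
qed

context
  assumes flat: "\<phi> \<in> \<Omega> k \<Longrightarrow> d (Suc k) (d k \<phi>) = 0"
begin

lemma D_D: assumes "\<alpha> \<in> H k" shows "D (Suc k) (D k \<alpha>) = 0"
proof -
  have "L (Suc (Suc k)) (D (Suc k) (D k \<alpha>)) = 0"
    by (simp add: dL_eq_LD[OF D_in[OF assms], symmetric] dL_eq_LD[OF assms, symmetric] flat[OF L_in[OF assms]])
  then show ?thesis using \<pi>_L[OF D_in[OF D_in[OF assms]]] \<pi>_0 by metis
qed

lemma \<Omega>_complex: "cochain_complex \<Omega> d"
  unfolding cochain_complex_def using \<Omega>_subspace d_lin d_in flat by blast

lemma H_complex: "cochain_complex H D"
  unfolding cochain_complex_def lin_on_def using H_subspace D_lincomb D_in D_D by blast

lemma L_chain_map: "chain_map H D \<Omega> d L"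
  unfolding chain_map_def lin_on_def using L_lincomb L_in dL_eq_LD by blast

text \<open>Surjectivity: normalize a cocycle; its derivative 0 is normal, so it has become a value
  of L. Injectivity: if \<open>L k x\<close> is the derivative of \<beta>, normalize \<beta>; its
  derivative is still \<open>L k x\<close>, which is normal, so \<beta> has become L y with D y =
  x.\<close>

lemma L_cohomology_iso: "cohomology_iso H D \<Omega> d L k"
proof (rule cohomology_isoI[OF H_complex \<Omega>_complex L_chain_map])
  have norm: "\<exists>\<beta>\<in>coboundaries \<Omega> d k. \<phi> - \<beta> \<in> \<Omega> k \<and> normal k (\<phi> - \<beta>) \<and> d k (\<phi> - \<beta>) = d k \<phi>" if p: "\<phi> \<in> \<Omega> k" for \<phi> k
  proof (cases k)
    case 0
    then show ?thesis using p normalize_0 by (simp add: coboundaries_def)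
  next
    case (Suc l)
    then obtain \<beta> where b: "\<beta> \<in> \<Omega> l" "normal k (\<phi> - d l \<beta>)" using normalize p by blast
    have db: "d l \<beta> \<in> \<Omega> k" using d_in b Suc by simp
    have "d k (\<phi> - d l \<beta>) = d k \<phi>"
      using d_lincomb[OF p db, of 1 "-1"] flat[OF b(1)] Suc by simp
    then show ?thesis
      using b db p Suc subspace_diff[OF \<Omega>_subspace p db] by (auto simp: coboundaries_def)
  qed
  show "\<exists>x\<in>cocycles H D k. z - L k x \<in> coboundaries \<Omega> d k" if "z \<in> cocycles \<Omega> d k" for z
  proof -
    have z: "z \<in> \<Omega> k" "d k z = 0" using that by (auto simp: cocycles_def)
    obtain \<beta> where b: "\<beta> \<in> coboundaries \<Omega> d k" "z - \<beta> \<in> \<Omega> k" "normal k (z - \<beta>)" "d k (z - \<beta>) = d k z"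
      using norm[OF z(1)] by blast
    have n: "normal (Suc k) (d k (z - \<beta>))" using b z normal_0 by simp
    let ?x = "\<pi> k (z - \<beta>)"
    have x: "?x \<in> H k" "L k ?x = z - \<beta>" using \<pi>_in[OF b(2,3) n] L_\<pi>[OF b(2,3) n] .
    have "D k ?x = 0" using D_eq[OF x(1)] x(2) b(4) z(2) \<pi>_0 by simp
    then show ?thesis using x b(1) by (intro bexI[of _ ?x]) (simp_all add: cocycles_def)
  qed
  show "x \<in> coboundaries H D k" if x: "x \<in> cocycles H D k" and Lx: "L k x \<in> coboundaries \<Omega> d k" for x
  proof -
    have xH: "x \<in> H k" using x by (simp add: cocycles_def)
    show ?thesis
    proof (cases k)
      case 0
      then have "L k x = 0" using Lx by (simp add: coboundaries_def)
      then have "x = 0" using \<pi>_L[OF xH] \<pi>_0 by metis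
      then show ?thesis using 0 by (simp add: coboundaries_def)
    next
      case (Suc l)
      then obtain \<beta> where b: "\<beta> \<in> \<Omega> l" "L k x = d l \<beta>" using Lx by (auto simp: coboundaries_def)
      obtain \<gamma> where c: "\<beta> - \<gamma> \<in> \<Omega> l" "normal l (\<beta> - \<gamma>)" "d l (\<beta> - \<gamma>) = d l \<beta>"
        using norm[OF b(1)] by blast
      have n: "normal (Suc l) (d l (\<beta> - \<gamma>))" using c(3) b(2) L_normal[OF xH] Suc by simp
      have y: "\<pi> l (\<beta> - \<gamma>) \<in> H l" "L l (\<pi> l (\<beta> - \<gamma>)) = \<beta> - \<gamma>"
        using \<pi>_in[OF c(1,2) n] L_\<pi>[OF c(1,2) n] .
      have "D l (\<pi> l (\<beta> - \<gamma>)) = x"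
        using D_eq[OF y(1)] y(2) c(3) b(2) \<pi>_L[OF xH] Suc by simp
      then show ?thesis using y(1) Suc by (auto simp: coboundaries_def)
    qed
  qed
qed

end

end

section \<open>The map Alt\<close>

text \<open>The alternating sum over the ways to take one entry out of a list, as in Alt. The
  recursion runs parallel to that of \<open>ed\<close>, so that the two can be compared by
  induction.\<close>

primrec shuf :: "('x \<Rightarrow> 'x list \<Rightarrow> 's::ab_group_add) \<Rightarrow> 'x list \<Rightarrow> 's" where
  "shuf f [] = 0"
| "shuf f (x # xs) = f x xs - shuf (\<lambda>y r. f y (x # r)) xs"

lemma shuf_cong:
  "xs \<in> tuples (Suc k) V \<Longrightarrow> (\<And>y r. y \<in> V \<Longrightarrow> r \<in> tuples k V \<Longrightarrow> f y r = f' y r) \<Longrightarrow> shuf f xs = shuf f' xs"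
proof (induction k arbitrary: xs f f')
  case 0
  then show ?case by (auto elim!: tuples_SucE)
next
  case (Suc k)
  obtain x r where x: "xs = x # r" "x \<in> V" "r \<in> tuples (Suc k) V" using Suc.prems(1) by (rule tuples_SucE)
  have "shuf (\<lambda>y r. f y (x # r)) r = shuf (\<lambda>y r. f' y (x # r)) r"
    by (rule Suc.IH[OF x(3)]) (use Suc.prems(2) x in auto)
  then show ?case using Suc.prems(2)[OF x(2,3)] x by simp
qed

lemma shuf_0: "shuf (\<lambda>y r. 0) xs = 0"
  by (induction xs) simp_all

lemma shuf_add: "shuf (\<lambda>y r. f y r + f' y r) xs = shuf f xs + shuf f' xs"
  by (induction xs arbitrary: f f') simp_all

lemma shuf_diff: "shuf (\<lambda>y r. f y r - f' y r) xs = shuf f xs - shuf f' xs"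
  by (induction xs arbitrary: f f') simp_all

lemma shuf_minus: "shuf (\<lambda>y r. - f y r) xs = - shuf f xs"
  by (induction xs arbitrary: f) simp_all

text \<open>The subgroup \<open>S\<close> is there because maps such as the metric are additive on
  vector fields, not on the whole type.\<close>

lemma shuf_additive:
  fixes F :: "'s::ab_group_add \<Rightarrow> 't::ab_group_add"
  assumes V: "0 \<in> S" "\<And>s t. s \<in> S \<Longrightarrow> t \<in> S \<Longrightarrow> s - t \<in> S"
    and F: "\<And>s t. s \<in> S \<Longrightarrow> t \<in> S \<Longrightarrow> F (s - t) = F s - F t"
  shows "xs \<in> tuples (Suc k) V \<Longrightarrow> (\<And>y r. y \<in> V \<Longrightarrow> r \<in> tuples k V \<Longrightarrow> f y r \<in> S) \<Longrightarrow>
    shuf f xs \<in> S \<and> F (shuf f xs) = shuf (\<lambda>y r. F (f y r)) xs"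
proof (induction k arbitrary: xs f)
  case 0
  moreover have "F 0 = 0" using F[OF V(1,1)] by simp
  ultimately show ?case by (auto elim!: tuples_SucE)
next
  case (Suc k)
  obtain x r where x: "xs = x # r" "x \<in> V" "r \<in> tuples (Suc k) V" using Suc.prems(1) by (rule tuples_SucE)
  have "shuf (\<lambda>y r. f y (x # r)) r \<in> S \<and> F (shuf (\<lambda>y r. f y (x # r)) r) = shuf (\<lambda>y r. F (f y (x # r))) r"
    by (rule Suc.IH[OF x(3)]) (use Suc.prems(2) x in auto)
  then show ?case using Suc.prems(2)[OF x(2,3)] x V F by simp
qed

text \<open>Of two entries that are taken out in turn, the order determines whether the position of
  the later one in the list is shifted by one; this is the sign.\<close>

lemma shuf_swap: "shuf (\<lambda>y r. shuf (F y) r) xs = - shuf (\<lambda>z r. shuf (\<lambda>y r'. F y z r') r) xs"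
proof (induction xs arbitrary: F)
  case (Cons x xs)
  show ?case
    using Cons.IH[of "\<lambda>y z r. F y z (x # r)"] by (simp add: shuf_diff)
qed simp

lemma shuf_sum: "shuf f xs = (\<Sum>i<length xs. (-1) ^ i *\<^sub>R f (xs ! i) (omit i xs) :: 's::real_vector)"
proof (induction xs arbitrary: f)
  case (Cons x xs)
  show ?case
    by (simp add: Cons.IH sum.lessThan_Suc_shift sum_negf del: sum.lessThan_Suc)
qed simp

lemma Alt_eq_shuf:
  assumes "vs \<in> tuples (Suc k) V"
  shows "Alt V k \<Psi> vs = (-1) ^ k *\<^sub>R shuf (\<lambda>v r. \<Psi> r v) vs"
proof -
  have "(-1::real) ^ (k - i) = (-1) ^ k * (-1) ^ i" if "i \<le> k" for i
  proof -
    have "(-1::real) ^ (k - i) * ((-1) ^ i * (-1) ^ i) = (-1) ^ k * (-1) ^ i"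
      using that by (metis le_add_diff_inverse2 mult.assoc power_add)
    then show ?thesis by (simp add: power_mult_distrib[symmetric])
  qed
  moreover have "{..<length vs} = {..k}" using tuples_length[OF assms] by auto
  ultimately show ?thesis
    using assms by (simp add: Alt_def shuf_sum scaleR_sum_right)
qed

context vector_bundle
begin

text \<open>Putting an entry back in its place costs the sign with which it was taken out, so all
  \<open>k\<close> terms are equal.\<close>

lemma shuf_alternating:
  "mform k h \<Longrightarrow> xs \<in> tuples k XM \<Longrightarrow> shuf (\<lambda>y r. h (y # r)) xs = of_nat k *\<^sub>R h xs"
proof (induction k arbitrary: xs h)
  case (Suc k)
  obtain x r where x: "xs = x # r" "x \<in> XM" "r \<in> tuples k XM" using Suc.prems(2) by (rule tuples_SucE)
  have "shuf (\<lambda>y r. h (y # x # r)) r = - shuf (\<lambda>y r. h (x # y # r)) r"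
  proof (cases k)
    case 0
    then show ?thesis using x by simp
  next
    case (Suc j)
    show ?thesis unfolding shuf_minus[symmetric]
    proof (rule shuf_cong[of _ j XM])
      show "r \<in> tuples (Suc j) XM" using x Suc by simp
      show "h (y # x # r') = - h (x # y # r')" if "y \<in> XM" "r' \<in> tuples j XM" for y r'
        by (rule mform_swap[OF Suc.prems(1)[unfolded Suc] that(1) x(2) that(2)])
    qed
  qed
  also have "shuf (\<lambda>y r. h (x # y # r)) r = of_nat k *\<^sub>R h xs"
    using Suc.IH[OF mform_Cons[OF Suc.prems(1) x(2)] x(3)] x(1) by simp
  finally show ?case unfolding x(1) by (simp add: algebra_simps)
qed simp

lemma shuf_mform:
  "(\<And>y. y \<in> XM \<Longrightarrow> mform k (f y)) \<Longrightarrow> (\<And>r. r \<in> tuples k XM \<Longrightarrow> fun_lin (\<lambda>y. f y r)) \<Longrightarrow> mform (Suc k) (shuf f)"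
proof (induction k arbitrary: f)
  case 0
  then show ?case by simp
next
  case (Suc k)
  have 1: "mform (Suc k) (\<lambda>r. f x r - shuf (\<lambda>y r. f y (x # r)) r)" if x: "x \<in> XM" for x
    by (rule mform_diff[OF Suc.prems(1)[OF x] Suc.IH]) (use Suc.prems x in auto)
  have 2: "fun_lin (\<lambda>x. f x r - shuf (\<lambda>y r. f y (x # r)) r)" if r: "r \<in> tuples (Suc k) XM" for r
  proof (rule fun_lin_minus_fun[OF Suc.prems(2)[OF r]], rule fun_linI)
    fix x x' assume x: "x \<in> XM" "x' \<in> XM"
    show "shuf (\<lambda>y r. f y ((x + x') # r)) r = shuf (\<lambda>y r. f y (x # r)) r + shuf (\<lambda>y r. f y (x' # r)) r"
      unfolding shuf_add[symmetric]
      by (rule shuf_cong[OF r]) (use fun_lin_add[OF mform_head[OF Suc.prems(1)]] x in auto)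
  next
    fix h x assume x: "h \<in> CM" "x \<in> XM"
    have "shuf (\<lambda>y r. f y (h \<odot> x # r)) r = shuf (\<lambda>y r. h \<odot> f y (x # r)) r"
      by (rule shuf_cong[OF r]) (use fun_lin_fsc[OF mform_head[OF Suc.prems(1)]] x in auto)
    also have "\<dots> = h \<odot> shuf (\<lambda>y r. f y (x # r)) r"
      using shuf_additive[of UNIV "\<lambda>s. h \<odot> s", OF _ _ _ r, of "\<lambda>y r. f y (x # r)"] by (simp add: fsc_diff)
    finally show "shuf (\<lambda>y r. f y (h \<odot> x # r)) r = h \<odot> shuf (\<lambda>y r. f y (x # r)) r" .
  qed
  have 3: "shuf f (x # x # r) = 0" if xr: "x # r \<in> tuples (Suc k) XM" for x r
  proof -
    have x: "x \<in> XM" "r \<in> tuples k XM" using xr by auto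
    have "shuf (\<lambda>y r. f y (x # x # r)) r = 0"
    proof (cases k)
      case (Suc j)
      have "shuf (\<lambda>y r. f y (x # x # r)) r = shuf (\<lambda>y r. 0) r"
        by (rule shuf_cong[of _ j XM]) (use x Suc Suc.prems(1) in auto)
      then show ?thesis by (simp only: shuf_0)
    qed (use x in simp)
    then show ?thesis by simp
  qed
  show ?case unfolding alt_rec.simps(2)[of _ _ _ "Suc k"] using 1 2 3 by simp
qed

end

context riemannian
begin

text \<open>The trivial line bundle: real-valued maps such as g(T r, \<zeta>) are then covered by
  the lemmas on forms.\<close>

sublocale CMb: vector_bundle A "\<lparr>fibre = \<lambda>p. UNIV :: real set, sections = CM\<rparr>"
proof unfold_locales
  show "(0 :: 'a \<Rightarrow> real) \<in> sections \<lparr>fibre = \<lambda>p. UNIV, sections = CM\<rparr>"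
    using smooth_const[of 0] by (simp add: zero_fun_def)
qed (auto simp: plus_fun_def fsc_def)

lemma gf_fun_lin_right: "\<zeta> \<in> XM \<Longrightarrow> fun_lin (gf \<zeta>)"
  by (rule fun_linI) (simp_all add: gf_add_right gf_fsc_right fun_eq_iff pw)

lemma gf_fun_lin_compose:
  assumes "fun_lin G" "\<And>\<xi>. \<xi> \<in> XM \<Longrightarrow> G \<xi> \<in> XM" "\<zeta> \<in> XM" shows "fun_lin (\<lambda>\<xi>. gf (G \<xi>) \<zeta>)"
  by (rule fun_linI) (use assms in \<open>simp_all add: fun_lin_add[OF assms(1)] fun_lin_fsc[OF assms(1)] gf_add_left gf_fsc_left fun_eq_iff pw\<close>)

lemma gf_0_left: "\<zeta> \<in> XM \<Longrightarrow> gf 0 \<zeta> = 0"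
  using g_zero[OF XM_tangent] by (simp add: gf_def fun_eq_iff pw)

lemma gf_mform: "TMb.mform k T \<Longrightarrow> \<zeta> \<in> XM \<Longrightarrow> CMb.mform k (\<lambda>r. gf (T r) \<zeta>)"
proof (induction k arbitrary: T)
  case (Suc k)
  have 1: "CMb.mform k (\<lambda>r. gf (T (x # r)) \<zeta>)" if "x \<in> XM" for x
    using Suc.IH[OF TMb.mform_Cons[OF Suc.prems(1) that] Suc.prems(2)] .
  have 2: "fun_lin (\<lambda>x. gf (T (x # r)) \<zeta>)" if r: "r \<in> tuples k XM" for r
    by (rule gf_fun_lin_compose[OF TMb.mform_head[OF Suc.prems(1) r] _ Suc.prems(2)])
      (use TMb.mform_section[OF Suc.prems(1)] r in auto)
  have 3: "gf (T (x # x # r)) \<zeta> = 0" if "x # r \<in> tuples k XM" for x r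
  proof -
    have "T (x # x # r) = 0" using Suc.prems(1) that by simp
    then show ?thesis by (simp only: gf_0_left[OF Suc.prems(2)])
  qed
  show ?case using 1 2 3 by simp
qed simp

text \<open>\<open>sharp\<close> raises the second index for each \<eta>. By nondegeneracy the
  result is unique, hence linear over \<open>CM\<close> in \<eta>, and so it comes from a smooth
  endomorphism.\<close>

lemma OM_of_bilinear:
  assumes lin: "\<And>\<eta>. \<eta> \<in> XM \<Longrightarrow> fun_lin (B \<eta>)" and smooth: "\<And>\<eta> \<zeta>. \<eta> \<in> XM \<Longrightarrow> \<zeta> \<in> XM \<Longrightarrow> B \<eta> \<zeta> \<in> CM"
    and skew: "\<And>\<eta> \<zeta>. \<eta> \<in> XM \<Longrightarrow> \<zeta> \<in> XM \<Longrightarrow> B \<eta> \<zeta> = - B \<zeta> \<eta>"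
  shows "\<exists>\<Phi>\<in>OM. \<forall>\<eta>\<in>XM. \<forall>\<zeta>\<in>XM. gf (act \<Phi> \<eta>) \<zeta> = B \<eta> \<zeta>"
proof -
  have "\<exists>W. W \<in> XM \<and> (\<forall>\<zeta>\<in>XM. gf W \<zeta> = B \<eta> \<zeta>)" if "\<eta> \<in> XM" for \<eta>
    using sharp[OF lin[OF that] smooth[OF that]] by metis
  then obtain S where S: "\<And>\<eta>. \<eta> \<in> XM \<Longrightarrow> S \<eta> \<in> XM" "\<And>\<eta> \<zeta>. \<eta> \<in> XM \<Longrightarrow> \<zeta> \<in> XM \<Longrightarrow> gf (S \<eta>) \<zeta> = B \<eta> \<zeta>"
    by metis
  have lin': "B (\<eta> + \<eta>') \<zeta> = B \<eta> \<zeta> + B \<eta>' \<zeta>" if "\<eta> \<in> XM" "\<eta>' \<in> XM" "\<zeta> \<in> XM" for \<eta> \<eta>' \<zeta>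
    using skew[OF XM_add[OF that(1,2)] that(3)] skew[OF that(1,3)] skew[OF that(2,3)] fun_lin_add[OF lin[OF that(3)] that(1,2)] by simp
  have lin'': "B (f \<odot> \<eta>) \<zeta> = f \<odot> B \<eta> \<zeta>" if "f \<in> CM" "\<eta> \<in> XM" "\<zeta> \<in> XM" for f \<eta> \<zeta>
    using skew[OF XM_fsc[OF that(1,2)] that(3)] skew[OF that(2,3)] fun_lin_fsc[OF lin[OF that(3)] that(1,2)] by (simp add: fun_eq_iff pw)
  have fl: "fun_lin S"
  proof (rule fun_linI)
    show "S (\<eta> + \<eta>') = S \<eta> + S \<eta>'" if "\<eta> \<in> XM" "\<eta>' \<in> XM" for \<eta> \<eta>'
      by (rule XM_eqI) (use that S lin' in \<open>auto simp: gf_add_left\<close>)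
    show "S (f \<odot> \<eta>) = f \<odot> S \<eta>" if "f \<in> CM" "\<eta> \<in> XM" for f \<eta>
      by (rule XM_eqI) (use that S lin'' in \<open>auto simp: gf_fsc_left fun_eq_iff pw\<close>)
  qed
  have sk: "gf (S \<eta>) \<zeta> = - gf \<eta> (S \<zeta>)" if "\<eta> \<in> XM" "\<zeta> \<in> XM" for \<eta> \<zeta>
    using S(2)[OF that] S(2)[OF that(2,1)] skew[OF that] gf_sym[OF that(1) S(1)[OF that(2)]] by simp
  obtain \<Phi> where "\<Phi> \<in> OM" "\<And>\<eta>. \<eta> \<in> XM \<Longrightarrow> act \<Phi> \<eta> = S \<eta>"
    by (rule endo_of_fun_lin[OF fl S(1) sk]) (assumption, assumption, assumption, rule that)
  then show ?thesis using S by (intro bexI[of _ \<Phi>] ballI) simp_all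
qed

lemma OM_eqI_gf:
  assumes "\<Phi> \<in> OM" "\<Psi> \<in> OM" "\<And>\<eta> \<zeta>. \<eta> \<in> XM \<Longrightarrow> \<zeta> \<in> XM \<Longrightarrow> gf (act \<Phi> \<eta>) \<zeta> = gf (act \<Psi> \<eta>) \<zeta>"
  shows "\<Phi> = \<Psi>"
  by (rule OM_eqI[OF assms(1,2)], rule XM_eqI) (use assms in auto)

lemma OM_form_of_trilinear:
  assumes lin: "\<And>r \<eta>. r \<in> tuples k XM \<Longrightarrow> \<eta> \<in> XM \<Longrightarrow> fun_lin (B r \<eta>)"
    and skew: "\<And>r \<eta> \<zeta>. r \<in> tuples k XM \<Longrightarrow> \<eta> \<in> XM \<Longrightarrow> \<zeta> \<in> XM \<Longrightarrow> B r \<eta> \<zeta> = - B r \<zeta> \<eta>"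
    and alt: "\<And>\<eta> \<zeta>. \<eta> \<in> XM \<Longrightarrow> \<zeta> \<in> XM \<Longrightarrow> CMb.mform k (\<lambda>r. B r \<eta> \<zeta>)"
  obtains \<Psi> where "\<Psi> \<in> forms A (skewTM A g) k"
    "\<And>r \<eta> \<zeta>. r \<in> tuples k XM \<Longrightarrow> \<eta> \<in> XM \<Longrightarrow> \<zeta> \<in> XM \<Longrightarrow> gf (act (eval \<Psi> r) \<eta>) \<zeta> = B r \<eta> \<zeta>"
proof -
  have sm: "B r \<eta> \<zeta> \<in> CM" if "r \<in> tuples k XM" "\<eta> \<in> XM" "\<zeta> \<in> XM" for r \<eta> \<zeta>
    using CMb.mform_section[OF alt[OF that(2,3)] that(1)] by simp
  have "\<exists>\<Phi>. \<Phi> \<in> OM \<and> (\<forall>\<eta>\<in>XM. \<forall>\<zeta>\<in>XM. gf (act \<Phi> \<eta>) \<zeta> = B r \<eta> \<zeta>)" if "r \<in> tuples k XM" for r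
    using OM_of_bilinear[of "B r", OF lin[OF that] sm[OF that] skew[OF that]] by blast
  then obtain \<Theta> where T: "\<And>r. r \<in> tuples k XM \<Longrightarrow> \<Theta> r \<in> OM"
    "\<And>r \<eta> \<zeta>. r \<in> tuples k XM \<Longrightarrow> \<eta> \<in> XM \<Longrightarrow> \<zeta> \<in> XM \<Longrightarrow> gf (act (\<Theta> r) \<eta>) \<zeta> = B r \<eta> \<zeta>"
    by metis
  have "(\<forall>r\<in>tuples k XM. \<Theta> r \<in> OM) \<and> (\<forall>r\<in>tuples k XM. \<forall>i<k. fun_lin (\<lambda>\<xi>. \<Theta> (r[i := \<xi>]))) \<and>
    (\<forall>r\<in>tuples k XM. \<not> distinct r \<longrightarrow> \<Theta> r = 0)"
  proof (intro conjI ballI allI impI)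
    show "\<Theta> r \<in> OM" if "r \<in> tuples k XM" for r by (rule T(1)[OF that])
    show "\<Theta> r = 0" if r: "r \<in> tuples k XM" "\<not> distinct r" for r
    proof (rule OM_eqI_gf[OF T(1)[OF r(1)] OMb.section_0])
      fix \<eta> \<zeta> assume e: "\<eta> \<in> XM" "\<zeta> \<in> XM"
      show "gf (act (\<Theta> r) \<eta>) \<zeta> = gf (act 0 \<eta>) \<zeta>"
        using T(2)[OF r(1) e] CMb.mform_not_distinct[OF alt[OF e] r] g_zero[OF XM_tangent[OF e(2)]]
        by (simp add: act_0 gf_def fun_eq_iff pw)
    qed
    fix r i assume r: "r \<in> tuples k XM" and i: "i < k"
    note m = CMb.mform_slot[OF alt r i]
    show "fun_lin (\<lambda>\<xi>. \<Theta> (r[i := \<xi>]))"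
    proof (rule fun_linI)
      fix \<xi> \<xi>' assume x: "\<xi> \<in> XM" "\<xi>' \<in> XM"
      show "\<Theta> (r[i := \<xi> + \<xi>']) = \<Theta> (r[i := \<xi>]) + \<Theta> (r[i := \<xi>'])"
        by (rule OM_eqI_gf) (use x r T fun_lin_add[OF m] in \<open>auto simp: OMb.section_add act_plus gf_add_left\<close>)
    next
      fix f \<xi> assume x: "f \<in> CM" "\<xi> \<in> XM"
      show "\<Theta> (r[i := f \<odot> \<xi>]) = f \<odot> \<Theta> (r[i := \<xi>])"
        by (rule OM_eqI_gf) (use x r T fun_lin_fsc[OF m] in \<open>auto simp: OMb.section_fsc act_fsc_left gf_fsc_left fun_eq_iff pw\<close>)
    qed
  qed
  then have "OMb.mform k \<Theta>" by (simp only: OMb.mform_iff)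
  then obtain \<Psi> where "\<Psi> \<in> forms A (skewTM A g) k" "\<And>r. r \<in> tuples k XM \<Longrightarrow> eval \<Psi> r = \<Theta> r"
    by (rule OMb.form_of_mform) (rule that)
  then show thesis using that T(2) by simp
qed

text \<open>Up to sign, \<open>Alt\<close> in terms of vector fields.\<close>

definition SA :: "('a \<Rightarrow> 'a tvec list \<Rightarrow> 'a endo) \<Rightarrow> 'a vfield list \<Rightarrow> 'a vfield" where
  "SA \<Psi> = shuf (\<lambda>\<eta> r. act (eval \<Psi> r) \<eta>)"

lemma eval_skew_OM: "\<Psi> \<in> forms A (skewTM A g) k \<Longrightarrow> r \<in> tuples k XM \<Longrightarrow> eval \<Psi> r \<in> OM"
  unfolding forms_def by blast

lemma gf_SA:
  assumes "\<Psi> \<in> forms A (skewTM A g) k" "xs \<in> tuples (Suc k) XM" "\<zeta> \<in> XM"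
  shows "SA \<Psi> xs \<in> XM" "gf (SA \<Psi> xs) \<zeta> = shuf (\<lambda>\<eta> r. gf (act (eval \<Psi> r) \<eta>) \<zeta>) xs"
  using shuf_additive[of XM "\<lambda>\<xi>. gf \<xi> \<zeta>" xs k XM "\<lambda>\<eta> r. act (eval \<Psi> r) \<eta>"] assms eval_skew_OM[OF assms(1)]
  by (auto simp: SA_def gf_diff_left)

text \<open>A right inverse of \<open>Alt\<close> that generalizes the formula for the contorsion of a connection. With
  \<open>P \<phi>(x\<^sub>0, \<dots>, x\<^sub>k; \<zeta>) = \<Sum>\<^sub>i (-1)\<^sup>i \<phi>(\<zeta>, x\<^sub>0, \<dots>, x\<^sub>k; x\<^sub>i)\<close>, the argument \<open>x\<^sub>i\<close> being omitted on the
  left of the semicolon, the two terms are mapped to \<open>(k + 1) \<phi> - P \<phi>\<close> and \<open>k P \<phi>\<close>.\<close>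

lemma Alt_surjective:
  assumes k: "k \<ge> 1" and t: "\<tau> \<in> forms A (TM A) (Suc k)"
  obtains \<Psi> where "\<Psi> \<in> forms A (skewTM A g) k" "\<And>xs. xs \<in> tuples (Suc k) XM \<Longrightarrow> SA \<Psi> xs = eval \<tau> xs"
proof -
  obtain j where j: "k = Suc j" using k by (cases k) auto
  define T where "T = eval \<tau>"
  have T: "TMb.mform (Suc k) T" unfolding T_def by (rule TMb.eval_mform[OF t])
  have TX: "T r \<in> XM" if "r \<in> tuples (Suc k) XM" for r using TMb.mform_section[OF T that] by simp
  note TC = TMb.mform_Cons[OF T]
  \<comment> \<open>They solve c1 (k + 1) = 1 and c2 k = c1: the coefficient of \<phi> has to be 1,
    and the multiples of P have to cancel.\<close>
  define c1 c2 :: real where "c1 = 1 / real (Suc k)" and "c2 = 1 / (real k * real (Suc k))"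
  \<comment> \<open>Both this term and the difference in \<open>B\<close> are skew in \<eta> and
    \<zeta>, as the values of an o(TM)-valued form must be. For k = 1 the two coefficients are 1/2
    and \<open>B\<close> is the contorsion formula.\<close>
  define Q where "Q r \<eta> \<zeta> = shuf (\<lambda>z r'. gf (T (\<eta> # \<zeta> # r')) z) r" for r \<eta> \<zeta>
  define B where "B r \<eta> \<zeta> = c1 *\<^sub>R (gf (T (\<eta> # r)) \<zeta> - gf (T (\<zeta> # r)) \<eta>) + c2 *\<^sub>R Q r \<eta> \<zeta>" for r \<eta> \<zeta>
  have Tsw: "T (\<eta> # \<zeta> # r) = - T (\<zeta> # \<eta> # r)" if "\<eta> \<in> XM" "\<zeta> \<in> XM" "r \<in> tuples j XM" for \<eta> \<zeta> r
    by (rule TMb.mform_swap[of _ j]) (use T j that in auto)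
  have Qm: "CMb.mform k (\<lambda>r. Q r \<eta> \<zeta>)" if "\<eta> \<in> XM" "\<zeta> \<in> XM" for \<eta> \<zeta>
    unfolding Q_def j
  proof (rule CMb.shuf_mform)
    show "CMb.mform j (\<lambda>r'. gf (T (\<eta> # \<zeta> # r')) y)" if "y \<in> XM" for y
      by (rule gf_mform[OF _ that]) (use TC \<open>\<eta> \<in> XM\<close> \<open>\<zeta> \<in> XM\<close> j in auto)
    show "fun_lin (gf (T (\<eta> # \<zeta> # r)))" if "r \<in> tuples j XM" for r
      by (rule gf_fun_lin_right, rule TX) (use that \<open>\<eta> \<in> XM\<close> \<open>\<zeta> \<in> XM\<close> j in auto)
  qed
  have Qsk: "Q r \<eta> \<zeta> = - Q r \<zeta> \<eta>" if "r \<in> tuples k XM" "\<eta> \<in> XM" "\<zeta> \<in> XM" for r \<eta> \<zeta>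
    unfolding Q_def shuf_minus[symmetric]
  proof (rule shuf_cong[of _ j XM])
    show "r \<in> tuples (Suc j) XM" using that j by simp
    show "gf (T (\<eta> # \<zeta> # r')) y = - gf (T (\<zeta> # \<eta> # r')) y" if y: "y \<in> XM" "r' \<in> tuples j XM" for y r'
      unfolding Tsw[OF \<open>\<eta> \<in> XM\<close> \<open>\<zeta> \<in> XM\<close> y(2)] by (rule gf_minus_left[OF y(1)], rule TX) (use that y \<open>\<eta> \<in> XM\<close> \<open>\<zeta> \<in> XM\<close> j in auto)
  qed
  have Ql: "fun_lin (Q r \<eta>)" if "r \<in> tuples k XM" "\<eta> \<in> XM" for r \<eta>
  proof (rule fun_linI)
    have r: "r \<in> tuples (Suc j) XM" using that j by simp
    note h = TMb.mform_head[OF TC[OF \<open>\<eta> \<in> XM\<close>, unfolded j]]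
    have TX': "T (\<eta> # \<zeta> # r') \<in> XM" if "\<zeta> \<in> XM" "r' \<in> tuples j XM" for \<zeta> r'
      by (rule TX) (use that \<open>\<eta> \<in> XM\<close> j in auto)
    show "Q r \<eta> (\<zeta> + \<zeta>') = Q r \<eta> \<zeta> + Q r \<eta> \<zeta>'" if "\<zeta> \<in> XM" "\<zeta>' \<in> XM" for \<zeta> \<zeta>'
      unfolding Q_def shuf_add[symmetric]
      by (rule shuf_cong[OF r]) (simp add: fun_lin_add[OF h] gf_add_left TX' that)
    fix f \<zeta> assume f: "f \<in> CM" "\<zeta> \<in> XM"
    have "Q r \<eta> (f \<odot> \<zeta>) = shuf (\<lambda>z r'. f \<odot> gf (T (\<eta> # \<zeta> # r')) z) r"
      unfolding Q_def
    proof (rule shuf_cong[OF r])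
      fix y r' assume y: "y \<in> XM" "r' \<in> tuples j XM"
      show "gf (T (\<eta> # f \<odot> \<zeta> # r')) y = f \<odot> gf (T (\<eta> # \<zeta> # r')) y"
        unfolding fun_lin_fsc[OF h[OF y(2)] f] gf_fsc_left[OF y(1) TX'[OF f(2) y(2)]] by (simp add: fun_eq_iff pw)
    qed
    also have "\<dots> = f \<odot> Q r \<eta> \<zeta>"
      using shuf_additive[of UNIV "\<lambda>s. f \<odot> s", OF _ _ _ r, of "\<lambda>z r'. gf (T (\<eta> # \<zeta> # r')) z"] by (simp add: fsc_diff Q_def)
    finally show "Q r \<eta> (f \<odot> \<zeta>) = f \<odot> Q r \<eta> \<zeta>" .
  qed
  have gT: "CMb.mform k (\<lambda>r. gf (T (\<eta> # r)) \<zeta>)" if "\<eta> \<in> XM" "\<zeta> \<in> XM" for \<eta> \<zeta>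
    by (rule gf_mform[OF TC[OF that(1)] that(2)])
  obtain \<Psi> where P: "\<Psi> \<in> forms A (skewTM A g) k"
    "\<And>r \<eta> \<zeta>. r \<in> tuples k XM \<Longrightarrow> \<eta> \<in> XM \<Longrightarrow> \<zeta> \<in> XM \<Longrightarrow> gf (act (eval \<Psi> r) \<eta>) \<zeta> = B r \<eta> \<zeta>"
  proof (rule OM_form_of_trilinear[of k B])
    fix r \<eta> assume r: "r \<in> tuples k XM" and e: "\<eta> \<in> XM"
    have 1: "fun_lin (gf (T (\<eta> # r)))" by (rule gf_fun_lin_right[OF TX]) (use r e in auto)
    have 2: "fun_lin (\<lambda>\<zeta>. gf (T (\<zeta> # r)) \<eta>)"
      by (rule gf_fun_lin_compose[OF TMb.mform_head[OF T r] _ e], rule TX) (use r in auto)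
    show "fun_lin (B r \<eta>)"
      unfolding B_def fsc_const[symmetric]
      by (intro CMb.fun_lin_plus CMb.fun_lin_fsc_fun CMb.fun_lin_minus_fun 1 2 Ql r e)
    show "B r \<eta> \<zeta> = - B r \<zeta> \<eta>" if "\<zeta> \<in> XM" for \<zeta>
      unfolding B_def Qsk[OF r e that] by (simp add: algebra_simps)
  next
    fix \<eta> \<zeta> assume "\<eta> \<in> XM" "\<zeta> \<in> XM"
    then show "CMb.mform k (\<lambda>r. B r \<eta> \<zeta>)"
      unfolding B_def fsc_const[symmetric] by (intro CMb.mform_add CMb.mform_diff CMb.mform_fsc gT Qm smooth_const)
  qed (rule that)
  have "SA \<Psi> xs = eval \<tau> xs" if xs: "xs \<in> tuples (Suc k) XM" for xs
  proof (rule XM_eqI)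
    show "eval \<tau> xs \<in> XM" using TX[OF xs] by (simp add: T_def)
    show "SA \<Psi> xs \<in> XM" by (rule gf_SA(1)[OF P(1) xs XM_0])
    fix \<zeta> assume z: "\<zeta> \<in> XM"
    let ?P = "shuf (\<lambda>\<eta> r. gf (T (\<zeta> # r)) \<eta>) xs"
    have sc: "shuf (\<lambda>\<eta> r. c *\<^sub>R f \<eta> r) xs = c *\<^sub>R shuf f xs" for c and f :: "'a vfield \<Rightarrow> 'a vfield list \<Rightarrow> 'a \<Rightarrow> real"
      using shuf_additive[of UNIV "\<lambda>s. c *\<^sub>R s", OF _ _ _ xs, of f] by (simp add: scaleR_diff_right)
    have s1: "shuf (\<lambda>\<eta> r. gf (T (\<eta> # r)) \<zeta>) xs = real (Suc k) *\<^sub>R gf (T xs) \<zeta>"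
      using CMb.shuf_alternating[OF gf_mform[OF T z] xs] by simp
    \<comment> \<open>Taking out first the entry that is paired with the value, the inner sum runs
      over an alternating map of the other entries, and \<open>shuf_alternating\<close> counts
      it.\<close>
    have "shuf (\<lambda>\<eta> r. Q r \<eta> \<zeta>) xs = - shuf (\<lambda>z r. shuf (\<lambda>\<eta> r'. gf (T (\<eta> # \<zeta> # r')) z) r) xs"
      unfolding Q_def by (rule shuf_swap)
    also have "- shuf (\<lambda>z r. shuf (\<lambda>\<eta> r'. gf (T (\<eta> # \<zeta> # r')) z) r) xs =
        shuf (\<lambda>z r. - shuf (\<lambda>\<eta> r'. gf (T (\<eta> # \<zeta> # r')) z) r) xs"
      by (rule shuf_minus[symmetric])
    also have "\<dots> = shuf (\<lambda>z r. real k *\<^sub>R gf (T (\<zeta> # r)) z) xs"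
    proof (rule shuf_cong[OF xs])
      fix y r assume y: "y \<in> XM" and r: "r \<in> tuples k XM"
      have "- shuf (\<lambda>\<eta> r'. gf (T (\<eta> # \<zeta> # r')) y) r = shuf (\<lambda>\<eta> r'. gf (T (\<zeta> # \<eta> # r')) y) r"
        unfolding shuf_minus[symmetric]
      proof (rule shuf_cong[of _ j XM])
        show "r \<in> tuples (Suc j) XM" using r j by simp
        fix \<eta> r' assume e: "\<eta> \<in> XM" "r' \<in> tuples j XM"
        have "gf (T (\<eta> # \<zeta> # r')) y = - gf (T (\<zeta> # \<eta> # r')) y"
          unfolding Tsw[OF e(1) z e(2)] by (rule gf_minus_left[OF y], rule TX) (use e z j in auto)
        then show "- gf (T (\<eta> # \<zeta> # r')) y = gf (T (\<zeta> # \<eta> # r')) y" by simp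
      qed
      also have "\<dots> = real k *\<^sub>R gf (T (\<zeta> # r)) y"
        using CMb.shuf_alternating[OF gT[OF z y] r] by simp
      finally show "- shuf (\<lambda>\<eta> r'. gf (T (\<eta> # \<zeta> # r')) y) r = real k *\<^sub>R gf (T (\<zeta> # r)) y" .
    qed
    finally have s2: "shuf (\<lambda>\<eta> r. Q r \<eta> \<zeta>) xs = real k *\<^sub>R ?P" unfolding sc .
    have "gf (SA \<Psi> xs) \<zeta> = shuf (\<lambda>\<eta> r. B r \<eta> \<zeta>) xs"
      unfolding gf_SA(2)[OF P(1) xs z] by (rule shuf_cong[OF xs]) (use P z in auto)
    also have "\<dots> = c1 *\<^sub>R (real (Suc k) *\<^sub>R gf (T xs) \<zeta> - ?P) + (c2 * real k) *\<^sub>R ?P"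
      unfolding B_def shuf_add sc shuf_diff s1 s2 by simp
    also have "c2 * real k = c1" using k by (simp add: c1_def c2_def)
    also have "c1 *\<^sub>R (real (Suc k) *\<^sub>R gf (T xs) \<zeta> - ?P) + c1 *\<^sub>R ?P = (c1 * real (Suc k)) *\<^sub>R gf (T xs) \<zeta>"
      by (simp add: scaleR_diff_right)
    also have "c1 * real (Suc k) = 1" by (simp add: c1_def)
    finally show "gf (SA \<Psi> xs) \<zeta> = gf (eval \<tau> xs) \<zeta>" by (simp add: T_def)
  qed
  then show thesis using that P(1) by blast
qed

text \<open>The uniqueness of the Levi-Civita connection in another guise: g(\<Psi>(\<xi>) \<eta>,
  \<zeta>) is symmetric in \<xi>, \<eta> and skew in \<eta>, \<zeta>. Three transpositions of each
  kind, applied alternately, lead back to the start with the opposite sign.\<close>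

lemma Alt_injective_1:
  assumes P: "\<Psi> \<in> forms A (skewTM A g) 1" and z: "\<And>xs. xs \<in> tuples 2 XM \<Longrightarrow> SA \<Psi> xs = 0"
  shows "\<Psi> = 0"
proof (rule OMb.form_eqI[OF P subspace_0[OF OMb.forms_subspace]])
  fix r assume "r \<in> tuples 1 XM"
  then obtain \<xi> where x: "r = [\<xi>]" "\<xi> \<in> XM" by (auto elim!: tuples_SucE)
  let ?B = "\<lambda>\<xi> \<eta> \<zeta>. gf (act (eval \<Psi> [\<xi>]) \<eta>) \<zeta>"
  have OM: "eval \<Psi> [\<xi>] \<in> OM" if "\<xi> \<in> XM" for \<xi> by (rule eval_skew_OM[OF P]) (use that in auto)
  have s: "?B \<xi> \<eta> \<zeta> = ?B \<eta> \<xi> \<zeta>" if "\<xi> \<in> XM" "\<eta> \<in> XM" for \<xi> \<eta> \<zeta>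
    using z[of "[\<eta>, \<xi>]"] that by (simp add: SA_def numeral_2_eq_2)
  have k: "?B \<xi> \<eta> \<zeta> = - ?B \<xi> \<zeta> \<eta>" if "\<xi> \<in> XM" "\<eta> \<in> XM" "\<zeta> \<in> XM" for \<xi> \<eta> \<zeta>
    using act_skew[OF OM that(2,3)] gf_sym[OF that(2), of "act (eval \<Psi> [\<xi>]) \<zeta>"] OM that by simp
  have "eval \<Psi> [\<xi>] = 0"
  proof (rule OM_eqI_gf[OF OM[OF x(2)] OMb.section_0])
    fix \<eta> \<zeta> assume e: "\<eta> \<in> XM" "\<zeta> \<in> XM"
    have "?B \<xi> \<eta> \<zeta> = - ?B \<xi> \<eta> \<zeta>"
      using s[OF x(2) e(1)] k[OF e(1) x(2) e(2)] s[OF e(1,2)] k[OF e(2,1) x(2)] s[OF e(2) x(2)] k[OF x(2) e(2,1)] by simp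
    then have "?B \<xi> \<eta> \<zeta> = 0" by (simp add: fun_eq_iff pw)
    then show "?B \<xi> \<eta> \<zeta> = gf (act 0 \<eta>) \<zeta>"
      using g_zero[OF XM_tangent[OF e(2)]] by (simp add: act_0 gf_def fun_eq_iff pw)
  qed
  then show "eval \<Psi> r = eval 0 r" using x by (simp add: eval_def fun_eq_iff pw)
qed

end

section \<open>Splitting operators\<close>

lemma alt_maps_prod:
  "F \<in> alt_maps k V (W \<times> W') \<longleftrightarrow> (\<lambda>vs. fst (F vs)) \<in> alt_maps k V W \<and> (\<lambda>vs. snd (F vs)) \<in> alt_maps k V W'"
  unfolding alt_maps_def lin_on_def by (auto simp: prod_eq_iff mem_Times_iff)

lemma parts_col [simp]: "top_part (col \<psi> \<Psi>) = \<psi>" "bottom_part (col \<psi> \<Psi>) = \<Psi>"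
  by (simp_all add: top_part_def bottom_part_def col_def)

lemma col_parts: "col (top_part \<phi>) (bottom_part \<phi>) = \<phi>"
  by (simp add: top_part_def bottom_part_def col_def)

lemma col_lincomb: "col (a *\<^sub>R \<psi> + b *\<^sub>R \<psi>') (a *\<^sub>R \<Psi> + b *\<^sub>R \<Psi>') = a *\<^sub>R col \<psi> \<Psi> + b *\<^sub>R col \<psi>' \<Psi>'"
  by (rule ext, rule ext) (simp add: col_def pw)

lemma col_add: "col (\<psi> + \<psi>') (\<Psi> + \<Psi>') = col \<psi> \<Psi> + col \<psi>' \<Psi>'"
  using col_lincomb[of 1 \<psi> 1 \<psi>' \<Psi> \<Psi>'] by simp

lemma parts_lincomb:
  "top_part (a *\<^sub>R \<phi> + b *\<^sub>R \<psi>) = a *\<^sub>R top_part \<phi> + b *\<^sub>R top_part \<psi>"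
  "bottom_part (a *\<^sub>R \<phi> + b *\<^sub>R \<psi>) = a *\<^sub>R bottom_part \<phi> + b *\<^sub>R bottom_part \<psi>"
  by (rule ext, rule ext, simp add: top_part_def bottom_part_def pw)+

lemma parts_0 [simp]: "top_part 0 = 0" "bottom_part 0 = 0" "col 0 0 = 0"
  by (rule ext, rule ext, simp add: top_part_def bottom_part_def col_def pw zero_prod_def)+

lemma shuf_point:
  "(\<And>\<eta> r. F \<eta> r p = f (\<eta> p) (map (\<lambda>\<xi>. \<xi> p) r)) \<Longrightarrow> shuf F xs p = shuf f (map (\<lambda>\<xi>. \<xi> p) xs)"
  by (induction xs arbitrary: F f) (simp_all add: pw)

context riemannian
begin

abbreviation "\<Omega> \<equiv> forms A (AM A g)"
abbreviation "\<Omega>o \<equiv> forms A (skewTM A g)"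
abbreviation "dd \<equiv> dA A g nabla"
abbreviation "HS \<equiv> harmonic_sections A g"

lemma eval_top: "eval (top_part \<phi>) r = tp (eval \<phi> r)" and eval_bottom: "eval (bottom_part \<phi>) r = bt (eval \<phi> r)"
  by (simp_all add: eval_def top_part_def bottom_part_def tp_def bt_def)

lemma AM_form_iff: "\<phi> \<in> \<Omega> k \<longleftrightarrow> top_part \<phi> \<in> forms A (TM A) k \<and> bottom_part \<phi> \<in> \<Omega>o k"
proof -
  have "\<phi> p \<in> alt_maps k (Tan p) (fibre (AM A g) p) \<longleftrightarrow>
      top_part \<phi> p \<in> alt_maps k (Tan p) (Tan p) \<and> bottom_part \<phi> p \<in> alt_maps k (Tan p) (skew_endos A g p)" for p
    unfolding fibre_AM alt_maps_prod by (simp add: top_part_def bottom_part_def)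
  then show ?thesis
    unfolding forms_def by (auto simp: sections_AM eval_top eval_bottom)
qed

lemma col_bottom_form: "\<Psi> \<in> \<Omega>o k \<Longrightarrow> col 0 \<Psi> \<in> \<Omega> k"
  using subspace_0[OF TMb.forms_subspace] by (simp add: AM_form_iff)

lemma dd_form: "\<phi> \<in> \<Omega> k \<Longrightarrow> dd k \<phi> \<in> \<Omega> (Suc k)"
  unfolding dA_def by (rule AMb.cov_ext_deriv_form)

lemma eval_dd: "\<phi> \<in> \<Omega> k \<Longrightarrow> r \<in> tuples (Suc k) XM \<Longrightarrow> eval (dd k \<phi>) r = AMb.d r (eval \<phi>)"
  unfolding dA_def by (rule AMb.eval_cov_ext_deriv)

lemma dd_lin_on: "lin_on (\<Omega> k) (dd k)"
  unfolding dA_def by (rule AMb.cov_ext_deriv_lin_on)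

lemma dd_add: "\<phi> \<in> \<Omega> k \<Longrightarrow> \<psi> \<in> \<Omega> k \<Longrightarrow> dd k (\<phi> + \<psi>) = dd k \<phi> + dd k \<psi>"
  using dd_lin_on[of k, unfolded lin_on_def, rule_format, of \<phi> \<psi> 1 1] by simp

lemma eval_dd_dd:
  assumes "\<phi> \<in> \<Omega> k" "r \<in> tuples (Suc (Suc k)) XM"
  shows "eval (dd (Suc k) (dd k \<phi>)) r = AMb.d r (\<lambda>r. AMb.d r (eval \<phi>))"
  unfolding eval_dd[OF dd_form[OF assms(1)] assms(2)]
  by (rule AMb.ed_cong[OF assms(2) eval_dd[OF assms(1)]])

lemma form_top_0_iff: "\<phi> \<in> \<Omega> k \<Longrightarrow> top_part \<phi> = 0 \<longleftrightarrow> (\<forall>r\<in>tuples k XM. tp (eval \<phi> r) = 0)"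
proof
  assume "top_part \<phi> = 0"
  then show "\<forall>r\<in>tuples k XM. tp (eval \<phi> r) = 0"
    unfolding eval_top[symmetric] by (simp add: eval_def fun_eq_iff pw)
next
  assume p: "\<phi> \<in> \<Omega> k" and z: "\<forall>r\<in>tuples k XM. tp (eval \<phi> r) = 0"
  show "top_part \<phi> = 0"
  proof (rule TMb.form_eqI[OF _ subspace_0[OF TMb.forms_subspace]])
    show "top_part \<phi> \<in> forms A (TM A) k" using p by (simp add: AM_form_iff)
    show "eval (top_part \<phi>) r = eval 0 r" if "r \<in> tuples k XM" for r
      using z that by (simp add: eval_top) (simp add: eval_def fun_eq_iff pw)
  qed
qed

lemma dd_dd_top: assumes "\<phi> \<in> \<Omega> k" shows "top_part (dd (Suc k) (dd k \<phi>)) = 0"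
  unfolding form_top_0_iff[OF dd_form[OF dd_form[OF assms]]]
proof
  fix r assume r: "r \<in> tuples (Suc (Suc k)) XM"
  have "AMb.d r (\<lambda>r. AMb.d r (eval \<phi>)) \<in> {s. tp s = 0}"
    by (rule AMb.ed_ed[OF _ _ _ _ r AMb.eval_mform[OF assms]]) (auto simp: tp_bt_simps DA_curvature_top[unfolded tp_bt_simps])
  then show "tp (eval (dd (Suc k) (dd k \<phi>)) r) = 0" unfolding eval_dd_dd[OF assms r] by simp
qed

lemma dd_dd_flat: assumes "constant_curvature c" "\<phi> \<in> \<Omega> k" shows "dd (Suc k) (dd k \<phi>) = 0"
proof (rule AMb.form_eqI[OF dd_form[OF dd_form[OF assms(2)]] subspace_0[OF AMb.forms_subspace]])
  fix r assume r: "r \<in> tuples (Suc (Suc k)) XM"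
  have "AMb.d r (\<lambda>r. AMb.d r (eval \<phi>)) \<in> {0}"
    by (rule AMb.ed_ed[OF _ _ _ _ r AMb.eval_mform[OF assms(2)]]) (auto simp: DA_flat[OF assms(1)])
  then show "eval (dd (Suc k) (dd k \<phi>)) r = eval 0 r"
    unfolding eval_dd_dd[OF assms(2) r] by (simp add: eval_def fun_eq_iff pw)
qed

text \<open>If the top component vanishes, the part of the deformation connection that
  differentiates it contributes nothing, and neither do the bracket terms; only the algebraic term -
  \<Phi>(\<xi>) survives.\<close>

lemma tp_lie:
  "\<xi> \<in> XM \<Longrightarrow> r \<in> tuples k XM \<Longrightarrow> (\<And>r. r \<in> tuples k XM \<Longrightarrow> tp (T r) = 0) \<Longrightarrow>
    tp (AMb.L \<xi> r T) = - act (bt (T r)) \<xi>"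
proof (induction k arbitrary: r T)
  case 0
  then show ?case using TMb.D_0 by (simp add: tp_DA)
next
  case (Suc k)
  obtain \<zeta> s where r: "r = \<zeta> # s" "\<zeta> \<in> XM" "s \<in> tuples k XM" using Suc.prems(2) by (rule tuples_SucE)
  have "tp (AMb.L \<xi> s (\<lambda>r. T (\<zeta> # r))) = - act (bt (T (\<zeta> # s))) \<xi>"
    by (rule Suc.IH[OF Suc.prems(1) r(3)]) (use Suc.prems(3) r in auto)
  moreover have "tp (T (bracket \<xi> \<zeta> # s)) = 0" by (rule Suc.prems(3)) (use r Suc.prems(1) in auto)
  ultimately show ?case by (simp add: r(1) tp_bt_simps)
qed

lemma tp_ed:
  "r \<in> tuples (Suc k) XM \<Longrightarrow> (\<And>r. r \<in> tuples k XM \<Longrightarrow> tp (T r) = 0) \<Longrightarrow>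
    tp (AMb.d r T) = - shuf (\<lambda>\<eta> r. act (bt (T r)) \<eta>) r"
proof (induction k arbitrary: r T)
  case 0
  then obtain \<zeta> where r: "r = [\<zeta>]" "\<zeta> \<in> XM" by (auto elim!: tuples_SucE)
  show ?case using tp_lie[of \<zeta> "[]" 0 T] 0 r by (simp add: tp_bt_simps)
next
  case (Suc k)
  obtain \<zeta> s where r: "r = \<zeta> # s" "\<zeta> \<in> XM" "s \<in> tuples (Suc k) XM" using Suc.prems(1) by (rule tuples_SucE)
  have "tp (AMb.d s (\<lambda>r. T (\<zeta> # r))) = - shuf (\<lambda>\<eta> r. act (bt (T (\<zeta> # r))) \<eta>) s"
    by (rule Suc.IH[OF r(3)]) (use Suc.prems(2) r in auto)
  moreover have "tp (AMb.L \<zeta> s T) = - act (bt (T s)) \<zeta>" by (rule tp_lie[OF r(2,3) Suc.prems(2)])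
  ultimately show ?case by (simp add: r(1) tp_bt_simps)
qed

lemma top_dd_col:
  assumes P: "\<Psi> \<in> \<Omega>o k" and r: "r \<in> tuples (Suc k) XM"
  shows "tp (eval (dd k (col 0 \<Psi>)) r) = - SA \<Psi> r"
proof -
  have "tp (eval (col 0 \<Psi>) r) = 0" "bt (eval (col 0 \<Psi>) r) = eval \<Psi> r" for r
    unfolding eval_top[symmetric] eval_bottom[symmetric] parts_col by (simp_all add: eval_def fun_eq_iff pw)
  then show ?thesis
    unfolding eval_dd[OF col_bottom_form[OF P] r] SA_def by (simp add: tp_ed[OF r])
qed

section \<open>Normal forms and their existence and uniqueness\<close>

definition symtop :: "'a aform \<Rightarrow> bool" where
  "symtop \<phi> \<longleftrightarrow> (\<forall>p. \<forall>v\<in>Tan p. \<forall>w\<in>Tan p. g p (fst (\<phi> p [v])) w = g p v (fst (\<phi> p [w])))"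

lemma symtop_iff:
  "symtop \<phi> \<longleftrightarrow> (\<forall>\<xi>\<in>XM. \<forall>\<eta>\<in>XM. gf (tp (eval \<phi> [\<xi>])) \<eta> = gf \<xi> (tp (eval \<phi> [\<eta>])))"
proof
  show "symtop \<phi> \<Longrightarrow> \<forall>\<xi>\<in>XM. \<forall>\<eta>\<in>XM. gf (tp (eval \<phi> [\<xi>])) \<eta> = gf \<xi> (tp (eval \<phi> [\<eta>]))"
    unfolding symtop_def by (simp add: gf_def tp_def eval_def XM_tangent)
  assume s: "\<forall>\<xi>\<in>XM. \<forall>\<eta>\<in>XM. gf (tp (eval \<phi> [\<xi>])) \<eta> = gf \<xi> (tp (eval \<phi> [\<eta>]))"
  show "symtop \<phi>"
    unfolding symtop_def
  proof (intro allI ballI)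
    fix p v w assume "v \<in> Tan p" "w \<in> Tan p"
    then obtain \<xi> \<eta> where x: "\<xi> \<in> XM" "\<xi> p = v" "\<eta> \<in> XM" "\<eta> p = w" using vfield_through by metis
    have "gf (tp (eval \<phi> [\<xi>])) \<eta> p = gf \<xi> (tp (eval \<phi> [\<eta>])) p" using s x by simp
    then show "g p (fst (\<phi> p [v])) w = g p v (fst (\<phi> p [w]))" using x by (simp add: gf_def tp_def eval_def)
  qed
qed

definition normal :: "nat \<Rightarrow> 'a aform \<Rightarrow> bool" where
  "normal k \<phi> \<longleftrightarrow> (k = 1 \<longrightarrow> symtop \<phi>) \<and> (k \<ge> 2 \<longrightarrow> top_part \<phi> = 0)"

lemma form_eval_top_XM: "\<phi> \<in> \<Omega> k \<Longrightarrow> r \<in> tuples k XM \<Longrightarrow> tp (eval \<phi> r) \<in> XM"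
  unfolding forms_def sections_AM by blast

lemma tp_eval_lincomb: "tp (eval (a *\<^sub>R \<phi> + b *\<^sub>R \<psi>) r) = a *\<^sub>R tp (eval \<phi> r) + b *\<^sub>R tp (eval \<psi> r)"
  unfolding AMb.eval_lincomb by (simp add: tp_bt_simps fsc_const)

lemma tp_eval_add: "tp (eval (\<phi> + \<psi>) r) = tp (eval \<phi> r) + tp (eval \<psi> r)"
  using tp_eval_lincomb[of 1 \<phi> 1 \<psi> r] by simp

lemma normal_0: "normal k 0"
  by (auto simp: normal_def symtop_def pw g_zero)

lemma normal_lincomb:
  assumes "\<phi> \<in> \<Omega> k" "\<psi> \<in> \<Omega> k" "normal k \<phi>" "normal k \<psi>"
  shows "normal k (a *\<^sub>R \<phi> + b *\<^sub>R \<psi>)"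
proof -
  have "symtop (a *\<^sub>R \<phi> + b *\<^sub>R \<psi>)" if k: "k = 1"
    unfolding symtop_iff
  proof (intro ballI)
    fix \<xi> \<eta> assume x: "\<xi> \<in> XM" "\<eta> \<in> XM"
    have X: "tp (eval \<phi> [\<zeta>]) \<in> XM" "tp (eval \<psi> [\<zeta>]) \<in> XM" if "\<zeta> \<in> XM" for \<zeta>
      using assms(1,2) k that form_eval_top_XM[of _ 1 "[\<zeta>]"] by auto
    have s: "gf (tp (eval \<phi> [\<xi>])) \<eta> = gf \<xi> (tp (eval \<phi> [\<eta>]))" "gf (tp (eval \<psi> [\<xi>])) \<eta> = gf \<xi> (tp (eval \<psi> [\<eta>]))"
      using assms(3,4) k x unfolding normal_def symtop_iff by auto
    show "gf (tp (eval (a *\<^sub>R \<phi> + b *\<^sub>R \<psi>) [\<xi>])) \<eta> = gf \<xi> (tp (eval (a *\<^sub>R \<phi> + b *\<^sub>R \<psi>) [\<eta>]))"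
      unfolding tp_eval_lincomb unfolding fsc_const[symmetric] using x X by (simp add: gf_add_left gf_add_right gf_fsc_left gf_fsc_right s)
  qed
  then show ?thesis using assms(3,4) by (auto simp: normal_def parts_lincomb)
qed

lemma SA_1: "SA \<Psi> [\<eta>] = act (eval \<Psi> []) \<eta>"
  by (simp add: SA_def)

text \<open>The derivative of a form with vanishing top component changes the top component of
  \<omega> algebraically, by \<open>top_dd_col\<close>: in degree 1 its skew part is removed, in
  higher degrees Alt reaches all of it. This serves twice, for the normalization by exact forms and
  for the existence of the splitting operators.\<close>

lemma normalizing_bottom:
  assumes w: "\<omega> \<in> \<Omega> (Suc k)"
  obtains \<Psi> where "\<Psi> \<in> \<Omega>o k" "normal (Suc k) (\<omega> + dd k (col 0 \<Psi>))"
proof (cases "k = 0")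
  case True
  let ?t = "\<lambda>\<eta>. tp (eval \<omega> [\<eta>])"
  have t: "?t \<eta> \<in> XM" if "\<eta> \<in> XM" for \<eta> by (rule form_eval_top_XM[OF w]) (use that True in simp)
  have tl: "fun_lin ?t"
  proof -
    have "fun_lin (\<lambda>\<eta>. eval \<omega> [\<eta>])"
      using AMb.mform_head[OF AMb.eval_mform[OF w], of "[]"] True by simp
    then show ?thesis by (simp add: fun_lin_def tp_bt_simps)
  qed
  \<comment> \<open>The skew part of the endomorphism \<open>?t\<close>.\<close>
  define B where "B r \<eta> \<zeta> = (1/2::real) *\<^sub>R (gf (?t \<eta>) \<zeta> - gf (?t \<zeta>) \<eta>)" for r :: "'a vfield list" and \<eta> \<zeta>
  obtain \<Psi> where P: "\<Psi> \<in> \<Omega>o 0"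
    "\<And>r \<eta> \<zeta>. r \<in> tuples 0 XM \<Longrightarrow> \<eta> \<in> XM \<Longrightarrow> \<zeta> \<in> XM \<Longrightarrow> gf (act (eval \<Psi> r) \<eta>) \<zeta> = B r \<eta> \<zeta>"
  proof (rule OM_form_of_trilinear[of 0 B])
    show "fun_lin (B r \<eta>)" if "\<eta> \<in> XM" for r \<eta>
      unfolding B_def fsc_const[symmetric]
      by (intro CMb.fun_lin_fsc_fun CMb.fun_lin_minus_fun gf_fun_lin_right gf_fun_lin_compose tl t that)
    show "B r \<eta> \<zeta> = - B r \<zeta> \<eta>" for r \<eta> \<zeta> by (simp add: B_def algebra_simps)
    show "CMb.mform 0 (\<lambda>r. B r \<eta> \<zeta>)" if "\<eta> \<in> XM" "\<zeta> \<in> XM" for \<eta> \<zeta>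
      unfolding B_def fsc_const[symmetric] using CMb.section_fsc CMb.section_diff t that by simp
  qed (rule that)
  have "symtop (\<omega> + dd 0 (col 0 \<Psi>))"
    unfolding symtop_iff
  proof (intro ballI)
    fix \<xi> \<eta> assume x: "\<xi> \<in> XM" "\<eta> \<in> XM"
    have e: "tp (eval (\<omega> + dd 0 (col 0 \<Psi>)) [\<zeta>]) = ?t \<zeta> - act (eval \<Psi> []) \<zeta>" if "\<zeta> \<in> XM" for \<zeta>
      using top_dd_col[OF P(1), of "[\<zeta>]"] that by (simp add: tp_eval_add SA_1)
    have OM: "eval \<Psi> [] \<in> OM" by (rule eval_skew_OM[OF P(1)]) simp
    have 1: "gf (?t \<xi> - act (eval \<Psi> []) \<xi>) \<eta> = gf (?t \<xi>) \<eta> - B [] \<xi> \<eta>"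
      using P(2)[of "[]" \<xi> \<eta>] x t OM by (simp add: gf_diff_left)
    have 2: "gf \<xi> (?t \<eta> - act (eval \<Psi> []) \<eta>) = gf (?t \<eta>) \<xi> - B [] \<eta> \<xi>"
      using P(2)[of "[]" \<eta> \<xi>] x t OM gf_sym[OF x(1), of "?t \<eta>"] gf_sym[OF x(1), of "act (eval \<Psi> []) \<eta>"]
      by (simp add: gf_diff_right)
    show "gf (tp (eval (\<omega> + dd 0 (col 0 \<Psi>)) [\<xi>])) \<eta> = gf \<xi> (tp (eval (\<omega> + dd 0 (col 0 \<Psi>)) [\<eta>]))"
      unfolding e[OF x(1)] e[OF x(2)] 1 2 B_def by (simp add: fun_eq_iff pw field_simps)
  qed
  then show thesis using that P(1) True by (simp add: normal_def)
next
  case False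
  then have k: "k \<ge> 1" by simp
  have "top_part \<omega> \<in> forms A (TM A) (Suc k)" using w by (simp add: AM_form_iff)
  then obtain \<Psi> where P: "\<Psi> \<in> \<Omega>o k" "\<And>xs. xs \<in> tuples (Suc k) XM \<Longrightarrow> SA \<Psi> xs = eval (top_part \<omega>) xs"
    by (rule Alt_surjective[OF k]) (rule that)
  have s: "\<omega> + dd k (col 0 \<Psi>) \<in> \<Omega> (Suc k)"
    by (rule subspace_add[OF AMb.forms_subspace w dd_form[OF col_bottom_form[OF P(1)]]])
  have "top_part (\<omega> + dd k (col 0 \<Psi>)) = 0"
    unfolding form_top_0_iff[OF s] using top_dd_col[OF P(1)] P(2) by (simp add: tp_eval_add eval_top)
  then show thesis using that P(1) k by (simp add: normal_def)
qed

text \<open>Two choices differ by an endomorphism that is both skew and symmetric if k = 0, and by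
  an element of the kernel of Alt on 1-forms if k = 1. From degree 2 on that kernel is the harmonic
  bundle itself, hence the bound on \<open>k\<close>.\<close>

lemma normalizing_bottom_unique:
  assumes k: "k \<le> 1" and w: "\<omega> \<in> \<Omega> (Suc k)" and P: "\<Psi> \<in> \<Omega>o k" "\<Psi>' \<in> \<Omega>o k"
    and n: "normal (Suc k) (\<omega> + dd k (col 0 \<Psi>))" "normal (Suc k) (\<omega> + dd k (col 0 \<Psi>'))"
  shows "\<Psi> = \<Psi>'"
proof (cases "k = 0")
  case True
  have OM: "eval \<Psi> [] \<in> OM" "eval \<Psi>' [] \<in> OM" using eval_skew_OM P True by simp_all
  let ?\<Delta> = "eval \<Psi> [] - eval \<Psi>' []"
  have D: "?\<Delta> \<in> OM" by (rule OMb.section_diff[OF OM])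
  have t: "tp (eval \<omega> [\<eta>]) \<in> XM" if "\<eta> \<in> XM" for \<eta> by (rule form_eval_top_XM[OF w]) (use that True in simp)
  have s: "gf (act \<Phi> \<xi>) \<eta> - gf \<xi> (act \<Phi> \<eta>) = gf (tp (eval \<omega> [\<xi>])) \<eta> - gf \<xi> (tp (eval \<omega> [\<eta>]))"
    if \<Psi>: "\<Psi> \<in> \<Omega>o k" "normal (Suc k) (\<omega> + dd k (col 0 \<Psi>))" "\<Phi> = eval \<Psi> []" and x: "\<xi> \<in> XM" "\<eta> \<in> XM" for \<Psi> \<Phi> \<xi> \<eta>
  proof -
    have O: "\<Phi> \<in> OM" using eval_skew_OM \<Psi> True by simp
    have e: "tp (eval (\<omega> + dd k (col 0 \<Psi>)) [\<zeta>]) = tp (eval \<omega> [\<zeta>]) - act \<Phi> \<zeta>" if "\<zeta> \<in> XM" for \<zeta>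
      using top_dd_col[OF \<Psi>(1), of "[\<zeta>]"] that True \<Psi>(3) by (simp add: tp_eval_add SA_1)
    have "gf (tp (eval \<omega> [\<xi>]) - act \<Phi> \<xi>) \<eta> = gf \<xi> (tp (eval \<omega> [\<eta>]) - act \<Phi> \<eta>)"
      using \<Psi>(2) True x unfolding normal_def symtop_iff by (simp add: e[unfolded True])
    then show ?thesis using x t O by (simp add: gf_diff_left gf_diff_right) (simp add: algebra_simps)
  qed
  have "?\<Delta> = 0"
  proof (rule OM_eqI_gf[OF D OMb.section_0])
    fix \<xi> \<eta> assume x: "\<xi> \<in> XM" "\<eta> \<in> XM"
    have "gf (act ?\<Delta> \<xi>) \<eta> - gf \<xi> (act ?\<Delta> \<eta>) = 0"
    proof -
      have "gf (act ?\<Delta> \<xi>) \<eta> - gf \<xi> (act ?\<Delta> \<eta>) =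
          (gf (act (eval \<Psi> []) \<xi>) \<eta> - gf \<xi> (act (eval \<Psi> []) \<eta>)) - (gf (act (eval \<Psi>' []) \<xi>) \<eta> - gf \<xi> (act (eval \<Psi>' []) \<eta>))"
        using x OM by (simp add: act_minus gf_diff_left gf_diff_right)
      then show ?thesis unfolding s[OF P(1) n(1) refl x] s[OF P(2) n(2) refl x] by simp
    qed
    then have "gf (act ?\<Delta> \<xi>) \<eta> = 0"
      using act_skew[OF D x] by (simp add: fun_eq_iff pw)
    then show "gf (act ?\<Delta> \<xi>) \<eta> = gf (act 0 \<xi>) \<eta>"
      using x by (simp add: act_0 gf_0_left)
  qed
  then show ?thesis
    using OMb.form_eqI[OF P] True by simp
next
  case False
  then have k1: "k = 1" using k by simp
  have "\<Psi> - \<Psi>' = 0"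
  proof (rule Alt_injective_1)
    show "\<Psi> - \<Psi>' \<in> \<Omega>o 1" using subspace_diff[OF OMb.forms_subspace P] k1 by simp
    fix xs assume xs: "xs \<in> tuples 2 XM"
    then have xs': "xs \<in> tuples (Suc k) XM" using k1 by (simp add: numeral_2_eq_2)
    have t: "tp (eval \<omega> xs) = SA \<Psi> xs" if \<Psi>: "\<Psi> \<in> \<Omega>o k" "normal (Suc k) (\<omega> + dd k (col 0 \<Psi>))" for \<Psi>
    proof -
      have s: "\<omega> + dd k (col 0 \<Psi>) \<in> \<Omega> (Suc k)"
        by (rule subspace_add[OF AMb.forms_subspace w dd_form[OF col_bottom_form[OF \<Psi>(1)]]])
      have "tp (eval (\<omega> + dd k (col 0 \<Psi>)) xs) = 0"
        using \<Psi>(2) k1 form_top_0_iff[OF s] xs' by (simp add: normal_def)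
      then show ?thesis using top_dd_col[OF \<Psi>(1) xs'] by (simp add: tp_eval_add)
    qed
    have "eval (\<Psi> - \<Psi>') r = eval \<Psi> r - eval \<Psi>' r" for r by (simp add: eval_def fun_eq_iff pw)
    then have "SA (\<Psi> - \<Psi>') xs = SA \<Psi> xs - SA \<Psi>' xs" by (simp add: SA_def act_minus shuf_diff)
    then show "SA (\<Psi> - \<Psi>') xs = 0" using t[OF P(1) n(1)] t[OF P(2) n(2)] by simp
  qed
  then show ?thesis by simp
qed

section \<open>Harmonic sections and splitting operators in terms of normal forms\<close>

lemma harmonic_sections_0: "\<alpha> \<in> HS 0 \<longleftrightarrow> \<alpha> \<in> \<Omega> 0 \<and> bottom_part \<alpha> = 0"
  by (auto simp: harmonic_sections_def harmonic_fibre_def forms_def bottom_part_def fun_eq_iff pw)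

lemma harmonic_sections_1: "\<alpha> \<in> HS 1 \<longleftrightarrow> \<alpha> \<in> \<Omega> 1 \<and> bottom_part \<alpha> = 0 \<and> normal 1 \<alpha>"
  by (auto simp: harmonic_sections_def harmonic_fibre_def forms_def bottom_part_def normal_def symtop_def fun_eq_iff pw)

text \<open>Where the top component of \<alpha> is zero, the top component of its derivative is Alt
  up to sign, so membership in the kernel of Alt is a normality condition on the derivative. This is
  why the inclusion can serve as the splitting operator in these degrees.\<close>

lemma harmonic_sections_ge_2:
  assumes k: "k \<ge> 2"
  shows "\<alpha> \<in> HS k \<longleftrightarrow> \<alpha> \<in> \<Omega> k \<and> normal k \<alpha> \<and> normal (Suc k) (dd k \<alpha>)"
proof -
  have Alt: "(\<forall>p. Alt (Tan p) k (\<lambda>vs. snd (\<alpha> p vs)) = 0) \<longleftrightarrow> top_part (dd k \<alpha>) = 0" if a: "\<alpha> \<in> \<Omega> k" and t: "top_part \<alpha> = 0"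
  proof -
    have b: "bottom_part \<alpha> \<in> \<Omega>o k" using a by (simp add: AM_form_iff)
    have ac: "\<alpha> = col 0 (bottom_part \<alpha>)" using col_parts[of \<alpha>] t by simp
    have SAp: "SA (bottom_part \<alpha>) xs p = shuf (\<lambda>v vs. snd (\<alpha> p vs) v) (map (\<lambda>\<xi>. \<xi> p) xs)" for xs p
      unfolding SA_def by (rule shuf_point) (simp add: act_def eval_def bottom_part_def)
    have Altp: "Alt (Tan p) k (\<lambda>vs. snd (\<alpha> p vs)) (map (\<lambda>\<xi>. \<xi> p) xs) = (-1) ^ k *\<^sub>R SA (bottom_part \<alpha>) xs p"
      if "xs \<in> tuples (Suc k) XM" for xs p
      unfolding SAp by (rule Alt_eq_shuf[OF TMb.map_point_tuples[OF that]])
    have "top_part (dd k \<alpha>) = 0 \<longleftrightarrow> (\<forall>r\<in>tuples (Suc k) XM. SA (bottom_part \<alpha>) r = 0)"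
      unfolding form_top_0_iff[OF dd_form[OF a]] using top_dd_col[OF b] ac by simp
    also have "\<dots> \<longleftrightarrow> (\<forall>p. Alt (Tan p) k (\<lambda>vs. snd (\<alpha> p vs)) = 0)"
    proof
      assume z: "\<forall>r\<in>tuples (Suc k) XM. SA (bottom_part \<alpha>) r = 0"
      show "\<forall>p. Alt (Tan p) k (\<lambda>vs. snd (\<alpha> p vs)) = 0"
      proof (rule allI, rule ext)
        fix p vs
        show "Alt (Tan p) k (\<lambda>vs. snd (\<alpha> p vs)) vs = 0 vs"
        proof (cases "vs \<in> tuples (Suc k) (Tan p)")
          case True
          then obtain xs where xs: "xs \<in> tuples (Suc k) XM" "map (\<lambda>\<xi>. \<xi> p) xs = vs" by (rule TMb.tuples_through)
          show ?thesis using Altp[OF xs(1), of p] z xs by (simp add: pw)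
        qed (simp add: Alt_def pw)
      qed
    next
      assume z: "\<forall>p. Alt (Tan p) k (\<lambda>vs. snd (\<alpha> p vs)) = 0"
      show "\<forall>r\<in>tuples (Suc k) XM. SA (bottom_part \<alpha>) r = 0"
      proof (rule ballI, rule ext)
        fix r p assume r: "r \<in> tuples (Suc k) XM"
        have "(-1) ^ k *\<^sub>R SA (bottom_part \<alpha>) r p = 0" using Altp[OF r, of p] z by (simp add: pw)
        then show "SA (bottom_part \<alpha>) r p = 0 p" by (simp add: pw)
      qed
    qed
    finally show ?thesis by blast
  qed
  have "\<alpha> \<in> HS k \<longleftrightarrow> \<alpha> \<in> \<Omega> k \<and> top_part \<alpha> = 0 \<and> (\<forall>p. Alt (Tan p) k (\<lambda>vs. snd (\<alpha> p vs)) = 0)"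
    using k unfolding harmonic_sections_def harmonic_fibre_def
    by (auto simp: forms_def top_part_def fun_eq_iff[of "\<lambda>p vs. fst (\<alpha> p vs)"] fun_eq_iff[of "\<lambda>vs. fst (\<alpha> _ vs)"] pw)
  then show ?thesis using Alt k by (auto simp: normal_def)
qed

lemma harmonic_sections_low:
  assumes "k \<le> 1" shows "\<alpha> \<in> HS k \<longleftrightarrow> \<alpha> \<in> \<Omega> k \<and> bottom_part \<alpha> = 0 \<and> normal k \<alpha>"
proof -
  have "k = 0 \<or> k = 1" using assms by linarith
  then show ?thesis using harmonic_sections_0 harmonic_sections_1 by (auto simp: normal_def)
qed

lemma harmonic_col_top: "\<omega> \<in> \<Omega> 1 \<Longrightarrow> col (top_part \<omega>) 0 \<in> HS 1 \<longleftrightarrow> normal 1 \<omega>"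
proof -
  assume "\<omega> \<in> \<Omega> 1"
  then have "col (top_part \<omega>) 0 \<in> \<Omega> 1" using subspace_0[OF OMb.forms_subspace] by (simp add: AM_form_iff)
  moreover have "symtop (col (top_part \<omega>) 0) \<longleftrightarrow> symtop \<omega>" by (simp add: symtop_def col_def top_part_def)
  ultimately show ?thesis by (simp add: harmonic_sections_1[unfolded One_nat_def] normal_def)
qed

text \<open>The two definite descriptions in \<open>splitting\<close> are one: choose the bottom
  component such that the derivative is normal, which means symmetric top component for k = 0 and
  vanishing top component for k = 1.\<close>

lemma splitting_low:
  assumes k: "k \<le> 1" and a: "\<alpha> \<in> HS k"
  obtains \<Psi> where "\<Psi> \<in> \<Omega>o k" "splitting A g nabla k \<alpha> = \<alpha> + col 0 \<Psi>" "normal (Suc k) (dd k (\<alpha> + col 0 \<Psi>))"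
    "\<And>\<Psi>'. \<Psi>' \<in> \<Omega>o k \<Longrightarrow> normal (Suc k) (dd k (\<alpha> + col 0 \<Psi>')) \<Longrightarrow> \<Psi>' = \<Psi>"
proof -
  have a': "\<alpha> \<in> \<Omega> k" "bottom_part \<alpha> = 0" using a harmonic_sections_low[OF k] by auto
  have c: "col (top_part \<alpha>) \<Psi> = \<alpha> + col 0 \<Psi>" for \<Psi>
    using col_add[of "top_part \<alpha>" 0 "bottom_part \<alpha>" \<Psi>] a'(2) col_parts[of \<alpha>] by simp
  have dc: "dd k (\<alpha> + col 0 \<Psi>) = dd k \<alpha> + dd k (col 0 \<Psi>)" if "\<Psi> \<in> \<Omega>o k" for \<Psi>
    by (rule dd_add[OF a'(1) col_bottom_form[OF that]])
  have F: "dd k (\<alpha> + col 0 \<Psi>) \<in> \<Omega> (Suc k)" if "\<Psi> \<in> \<Omega>o k" for \<Psi>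
    by (rule dd_form[OF subspace_add[OF AMb.forms_subspace a'(1) col_bottom_form[OF that]]])
  obtain \<Psi> where P: "\<Psi> \<in> \<Omega>o k" "normal (Suc k) (dd k \<alpha> + dd k (col 0 \<Psi>))"
    by (rule normalizing_bottom[OF dd_form[OF a'(1)]]) (rule that)
  have n: "normal (Suc k) (dd k (\<alpha> + col 0 \<Psi>))" using P dc by simp
  have u: "\<Psi>' = \<Psi>" if p: "\<Psi>' \<in> \<Omega>o k" "normal (Suc k) (dd k (\<alpha> + col 0 \<Psi>'))" for \<Psi>'
    by (rule normalizing_bottom_unique[OF k dd_form[OF a'(1)] p(1) P(1) _ P(2)]) (use p dc in simp)
  have "(THE \<Psi>. \<Psi> \<in> \<Omega>o k \<and> normal (Suc k) (dd k (\<alpha> + col 0 \<Psi>))) = \<Psi>"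
  proof (rule the_equality)
    show "\<Psi> \<in> \<Omega>o k \<and> normal (Suc k) (dd k (\<alpha> + col 0 \<Psi>))" using P(1) n ..
    show "\<Psi>' = \<Psi>" if "\<Psi>' \<in> \<Omega>o k \<and> normal (Suc k) (dd k (\<alpha> + col 0 \<Psi>'))" for \<Psi>'
      by (rule u[OF conjunct1[OF that] conjunct2[OF that]])
  qed
  moreover have "splitting A g nabla k \<alpha> = \<alpha> + col 0 (THE \<Psi>. \<Psi> \<in> \<Omega>o k \<and> normal (Suc k) (dd k (\<alpha> + col 0 \<Psi>)))"
  proof (cases "k = 0")
    case True
    have "(\<Phi> \<in> \<Omega>o 0 \<and> col (top_part (dd 0 (\<alpha> + col 0 \<Phi>))) 0 \<in> HS 1) \<longleftrightarrow> (\<Phi> \<in> \<Omega>o 0 \<and> normal 1 (dd 0 (\<alpha> + col 0 \<Phi>)))" for \<Phi>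
      using harmonic_col_top F True by auto
    then show ?thesis using True by (simp add: splitting_def c)
  next
    case False
    then have "k = 1" using k by simp
    then show ?thesis by (simp add: splitting_def c normal_def)
  qed
  ultimately have "splitting A g nabla k \<alpha> = \<alpha> + col 0 \<Psi>" by simp
  then show thesis by (rule that[OF P(1) _ n u])
qed

lemma splitting_high:
  assumes "k \<ge> 2" "top_part \<alpha> = 0" shows "splitting A g nabla k \<alpha> = \<alpha>"
  using col_parts[of \<alpha>] assms by (simp add: splitting_def)

text \<open>The inverse of the splitting operators on their image: in degrees 0 and 1 they only add
  a bottom component, which is forgotten here, and from degree 2 on they are inclusions.\<close>

definition proj :: "nat \<Rightarrow> 'a aform \<Rightarrow> 'a aform" where
  "proj k \<phi> = (if k \<le> 1 then col (top_part \<phi>) 0 else \<phi>)"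

lemma normal_add_bottom: assumes "k \<le> 1" shows "normal k (\<phi> + col 0 \<Psi>) \<longleftrightarrow> normal k \<phi>"
proof -
  have "symtop (\<phi> + col 0 \<Psi>) \<longleftrightarrow> symtop \<phi>" by (simp add: symtop_def col_def pw)
  then show ?thesis using assms by (simp add: normal_def)
qed

sublocale BGG: bgg_frame \<Omega> HS dd "splitting A g nabla" "bgg A g nabla" proj normal
proof unfold_locales
  fix k and \<alpha> :: "'a aform"
  assume a: "\<alpha> \<in> HS k"
  have "splitting A g nabla k \<alpha> \<in> \<Omega> k \<and> normal k (splitting A g nabla k \<alpha>) \<and>
      normal (Suc k) (dd k (splitting A g nabla k \<alpha>)) \<and> proj k (splitting A g nabla k \<alpha>) = \<alpha>"
  proof (cases "k \<le> 1")
    case True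
    have a': "\<alpha> \<in> \<Omega> k" "bottom_part \<alpha> = 0" "normal k \<alpha>" using a harmonic_sections_low[OF True] by auto
    obtain \<Psi> where P: "\<Psi> \<in> \<Omega>o k" "splitting A g nabla k \<alpha> = \<alpha> + col 0 \<Psi>" "normal (Suc k) (dd k (\<alpha> + col 0 \<Psi>))"
      using splitting_low[OF True a] by metis
    have "proj k (\<alpha> + col 0 \<Psi>) = \<alpha>"
      using parts_lincomb(1)[of 1 \<alpha> 1 "col 0 \<Psi>"] True a'(2) col_parts[of \<alpha>] by (simp add: proj_def)
    then show ?thesis
      using P a' normal_add_bottom[OF True] subspace_add[OF AMb.forms_subspace a'(1) col_bottom_form[OF P(1)]] by simp
  next
    case False
    then have k: "k \<ge> 2" by simp
    have "\<alpha> \<in> \<Omega> k \<and> normal k \<alpha> \<and> normal (Suc k) (dd k \<alpha>)" using a harmonic_sections_ge_2[OF k] by blast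
    then show ?thesis using splitting_high[OF k] k False by (simp add: proj_def normal_def)
  qed
  then show "splitting A g nabla k \<alpha> \<in> \<Omega> k" "normal k (splitting A g nabla k \<alpha>)"
    "normal (Suc k) (dd k (splitting A g nabla k \<alpha>))" "proj k (splitting A g nabla k \<alpha>) = \<alpha>" by blast+
  \<comment> \<open>\<open>proj (Suc k)\<close> discards the bottom component exactly for k = 0, the
    case that is singled out in \<open>bgg\<close>.\<close>
  show "bgg A g nabla k \<alpha> = proj (Suc k) (dd k (splitting A g nabla k \<alpha>))"
    by (simp add: bgg_def proj_def)
next
  fix k and \<phi> :: "'a aform"
  assume p: "\<phi> \<in> \<Omega> k" and n: "normal k \<phi>" "normal (Suc k) (dd k \<phi>)"
  have "proj k \<phi> \<in> HS k \<and> splitting A g nabla k (proj k \<phi>) = \<phi>"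
  proof (cases "k \<le> 1")
    case True
    let ?\<alpha> = "col (top_part \<phi>) 0"
    have e: "\<phi> = ?\<alpha> + col 0 (bottom_part \<phi>)"
      using col_add[of "top_part \<phi>" 0 0 "bottom_part \<phi>"] by (simp add: col_parts)
    have b: "bottom_part \<phi> \<in> \<Omega>o k" and "?\<alpha> \<in> \<Omega> k"
      using p subspace_0[OF OMb.forms_subspace] by (simp_all add: AM_form_iff)
    moreover have "normal k ?\<alpha>" using n(1) normal_add_bottom[OF True, of ?\<alpha> "bottom_part \<phi>"] e by simp
    ultimately have h: "?\<alpha> \<in> HS k" using harmonic_sections_low[OF True] by simp
    obtain \<Psi> where P: "splitting A g nabla k ?\<alpha> = ?\<alpha> + col 0 \<Psi>"
      "\<And>\<Psi>'. \<Psi>' \<in> \<Omega>o k \<Longrightarrow> normal (Suc k) (dd k (?\<alpha> + col 0 \<Psi>')) \<Longrightarrow> \<Psi>' = \<Psi>"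
      using splitting_low[OF True h] by metis
    \<comment> \<open>Normality of the derivative determines the bottom component, so the one that
      \<phi> already has is the one that the splitting operator adds.\<close>
    have "bottom_part \<phi> = \<Psi>" by (rule P(2)[OF b]) (use n(2) e in simp)
    then show ?thesis using h P(1) e True by (simp add: proj_def)
  next
    case False
    then have k: "k \<ge> 2" by simp
    show ?thesis using p n splitting_high[OF k] harmonic_sections_ge_2[OF k] k False by (simp add: proj_def normal_def)
  qed
  then show "proj k \<phi> \<in> HS k" "splitting A g nabla k (proj k \<phi>) = \<phi>" by blast+
next
  fix k and \<phi> \<psi> :: "'a aform" and a b :: real
  have "col (a *\<^sub>R top_part \<phi> + b *\<^sub>R top_part \<psi>) 0 = a *\<^sub>R col (top_part \<phi>) 0 + b *\<^sub>R col (top_part \<psi>) 0"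
    using col_lincomb[of a "top_part \<phi>" b "top_part \<psi>" 0 0] by simp
  then show "proj k (a *\<^sub>R \<phi> + b *\<^sub>R \<psi>) = a *\<^sub>R proj k \<phi> + b *\<^sub>R proj k \<psi>"
    by (simp add: proj_def parts_lincomb)
next
  fix k and \<phi> :: "'a aform" assume p: "\<phi> \<in> \<Omega> (Suc k)"
  obtain \<Psi> where P: "\<Psi> \<in> \<Omega>o k" "normal (Suc k) (\<phi> + dd k (col 0 \<Psi>))"
    by (rule normalizing_bottom[OF p]) (rule that)
  note c = col_bottom_form[OF P(1)]
  have "dd k ((-1) *\<^sub>R col 0 \<Psi>) = - dd k (col 0 \<Psi>)"
    using dd_lin_on[of k, unfolded lin_on_def, rule_format, OF c c, of "-1" 0] by simp
  then show "\<exists>\<beta>\<in>\<Omega> k. normal (Suc k) (\<phi> - dd k \<beta>)"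
    using P(2) subspace_scale[OF AMb.forms_subspace c, of "-1"] by (intro bexI[of _ "(-1) *\<^sub>R col 0 \<Psi>"]) simp_all
next
  show "normal (Suc (Suc k)) (dd (Suc k) (dd k \<phi>))" if "\<phi> \<in> \<Omega> k" for k \<phi>
    using dd_dd_top[OF that] by (simp add: normal_def)
qed (auto simp: AMb.forms_subspace dd_lin_on dd_form normal_0 normal_lincomb normal_def[of 0])

end

theorem theorem2p8:
  fixes A :: "('a::{t2_space, second_countable_topology}, 'e::euclidean_space) chart set"
    and g :: "'a metric"
    and nabla :: "'a connection"
  assumes "smooth_atlas A"
    and "riemannian_metric A g"
    and "levi_civita A g nabla"
    and "DIM('e) \<ge> 2"
  shows "(\<forall>k<DIM('e). \<forall>\<alpha>\<in>harmonic_sections A g k.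
            splitting A g nabla k \<alpha> \<in> forms A (AM A g) k \<and>
            bgg A g nabla k \<alpha> \<in> harmonic_sections A g (Suc k) \<and>
            dA A g nabla k (splitting A g nabla k \<alpha>) \<in> forms A (AM A g) (Suc k) \<and>
            dA A g nabla k (splitting A g nabla k \<alpha>) =
              splitting A g nabla (Suc k) (bgg A g nabla k \<alpha>)) \<and>
         (constant_sectional_curvature A g nabla \<longrightarrow>
            (\<forall>k. \<forall>\<phi>\<in>forms A (AM A g) k. dA A g nabla (Suc k) (dA A g nabla k \<phi>) = 0) \<and>
            (\<forall>k. \<forall>\<alpha>\<in>harmonic_sections A g k. bgg A g nabla (Suc k) (bgg A g nabla k \<alpha>) = 0) \<and>
            cochain_complex (forms A (AM A g)) (dA A g nabla) \<and>
            cochain_complex (harmonic_sections A g) (bgg A g nabla) \<and>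
            chain_map (harmonic_sections A g) (bgg A g nabla) (forms A (AM A g)) (dA A g nabla)
              (splitting A g nabla) \<and>
            (\<forall>k. cohomology_iso (harmonic_sections A g) (bgg A g nabla)
                   (forms A (AM A g)) (dA A g nabla) (splitting A g nabla) k))"
proof -
  interpret riemannian A g nabla
    by unfold_locales (use assms in auto)
  have flat: "dd (Suc k) (dd k \<phi>) = 0" if cs: "constant_sectional_curvature A g nabla" and p: "\<phi> \<in> \<Omega> k" for k \<phi>
  proof -
    obtain c where "constant_curvature c" using constant_sectional_curvature_imp[OF cs] .
    then show ?thesis by (rule dd_dd_flat[OF _ p])
  qed
  show ?thesis
  proof (intro conjI impI allI ballI)
    fix k \<alpha> assume a: "\<alpha> \<in> HS k"
    show "splitting A g nabla k \<alpha> \<in> \<Omega> k" by (rule BGG.L_in[OF a])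
    show "bgg A g nabla k \<alpha> \<in> HS (Suc k)" by (rule BGG.D_in[OF a])
    show "dd k (splitting A g nabla k \<alpha>) \<in> \<Omega> (Suc k)" by (rule dd_form[OF BGG.L_in[OF a]])
    show "dd k (splitting A g nabla k \<alpha>) = splitting A g nabla (Suc k) (bgg A g nabla k \<alpha>)"
      by (rule BGG.dL_eq_LD[OF a])
  next
    assume cs: "constant_sectional_curvature A g nabla"
    note f = flat[OF cs]
    show "dd (Suc k) (dd k \<phi>) = 0" if "\<phi> \<in> \<Omega> k" for k \<phi> by (rule f[OF that])
    show "bgg A g nabla (Suc k) (bgg A g nabla k \<alpha>) = 0" if "\<alpha> \<in> HS k" for k \<alpha>
      by (rule BGG.D_D[OF f that])
    show "cochain_complex \<Omega> dd" by (rule BGG.\<Omega>_complex[OF f])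
    show "cochain_complex HS (bgg A g nabla)" by (rule BGG.H_complex[OF f])
    show "chain_map HS (bgg A g nabla) \<Omega> dd (splitting A g nabla)" by (rule BGG.L_chain_map[OF f])
    show "cohomology_iso HS (bgg A g nabla) \<Omega> dd (splitting A g nabla) k" for k
      by (rule BGG.L_cohomology_iso[OF f])
  qed
qed

end
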